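(* Let $K_3\subset\mathbb{R}^3$ be a triangular prism. Then $$v_3^{(1)}(K_3)=\frac{1859}{116640}-\frac{\pi^2}{17010}.$$
   Context: $v_3^{(1)}(K_3)=\mathbb{E}[\operatorname{vol}_3\operatorname{conv}(\mathbf{X}_0,\mathbf{X}_1,\mathbf{X}_2,\mathbf{X}_3)]/\operatorname{vol}_3 K_3$, where $\mathbf{X}_0,\ldots,\mathbf{X}_3$ are independent uniformly distributed random points in $K_3$; it is invariant under nondegenerate affine transformations. A triangular prism is (up to affine transformation) the product of a triangle and a segment. *)

theory Defs
  imports "HOL-Probability.Probability"
begin

text \<open>
  The sample space is the product of four copies of the uniform distribution on \<open>K\<close>,
  i.e. the joint law of four independent uniform points \<open>X 0, \<dots>, X 3\<close>.
\<close>

definition v31 :: "(real ^ 3) set \<Rightarrow> real" where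
  "v31 K =
     (\<integral>X. measure lborel (convex hull {X 0, X 1, X 2, X 3})
        \<partial>(\<Pi>\<^sub>M i\<in>{0..3::nat}. uniform_measure lborel K)) / measure lborel K"

text \<open>
  \<^prop>\<open>2 simplex T\<close> says that \<open>T\<close> is the convex hull of three affinely independent points.
\<close>

definition triangular_prism :: "(real ^ 3) set \<Rightarrow> bool" where
  "triangular_prism K \<longleftrightarrow>
     (\<exists>(h :: (real ^ 2) \<times> real \<Rightarrow> real ^ 3) c T a b.
        linear h \<and> inj h \<and> 2 simplex T \<and> a < b \<and>
        K = (\<lambda>x. c + h x) ` (T \<times> {a..b}))"

end

theory Submission
  imports Defs
begin

text \<open>
  Let \<open>(P\<^sub>i, z\<^sub>i)\<close>, \<open>i = 0, \<dots>, 3\<close>, be uniform points of the product of the standard triangle and the unit interval. Six times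
  the volume of their hull is \<open>\<bar>cross P\<^sub>0 P\<^sub>1 P\<^sub>2\<bar>\<close> times the vertical distance of the last point from the plane through
  the first three. Replacing \<open>z\<^sub>0\<close>, \<open>z\<^sub>1\<close>, \<open>z\<^sub>2\<close> by the heights \<open>a\<close>, \<open>b\<close>, \<open>c\<close> of this plane over the vertices of the triangle
  has Jacobian \<open>\<bar>cross P\<^sub>0 P\<^sub>1 P\<^sub>2\<bar>\<close>. Hence the expectation is the integral over \<open>(a, b, c)\<close> of \<open>Psi\<close>: the triple integral of \<open>cross\<^sup>2\<close>
  over the shadow of the section, which is six times the determinant of the shadow's moment matrix, times the mean
  vertical distance of a point of the prism from the plane.

  By symmetry the heights may be sorted, and up to scaling the shadow is \<open>t \<le> m x + y \<le> t'\<close> inside the triangle, with \<open>0 < m < 1\<close>.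
  The positions of \<open>t\<close>, \<open>t'\<close> relative to \<open>0\<close>, \<open>m\<close>, \<open>1\<close> decide its shape. Most shapes contribute rational numbers;
  the quadrilaterals with one cut-off corner and the pentagons together give \<open>\<integral>\<integral> Q(n, s) / (1 - n s)\<^sup>6\<close> over the unit square
  with a polynomial \<open>Q\<close>, which Hermite reduction turns into \<open>\<integral>\<integral> n\<^sup>k / (1 - n s)\<close> and \<open>\<integral>\<integral> s\<^sup>k / (1 - n s)\<close>, that is, into \<open>\<zeta>(2)\<close> and rational numbers.
\<close>

section \<open>Second moments of planar regions\<close>

text \<open>The factor \<open>\<bar>cross\<bar>\<close> of the volume and the equal factor of the
  Jacobian combine to a square. So the base triangle loses its absolute value: the integrand is
  quadratic in each of the three points, and only moments of the shadow up to order two enter. The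
  shadow is the triangle minus at most two pieces cut off by parallel lines. The absolute value in
  the vertical distance costs no more: it is one quadratic polynomial on the whole triangle,
  corrected by squares on the very pieces that are cut off.

  The density over planes is then a polynomial divided by the sixth power of \<open>t' - t\<close>.
  The delicate place is where both lines of a pentagon approach the middle vertex. There a blow-up
  of the two distances cancels all singular factors except \<open>(1 - n s) ^ 6\<close>.

  Integrals are taken over nonnegative functions as far as possible, so that they may be
  interchanged freely. The sign of \<open>beukers_num\<close> is never read off its coefficients: it
  is inherited from the nonnegative densities that the polynomial represents.\<close>

text \<open>
  One equation for the generic quadratic polynomial, so that an affine change of variables
  only recombines the coefficients.
\<close>
definition has_moments ::
    "(real \<times> real) set \<Rightarrow> real \<Rightarrow> real \<Rightarrow> real \<Rightarrow> real \<Rightarrow> real \<Rightarrow> real \<Rightarrow> bool" where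
  "has_moments D m0 mx my mxx mxy myy \<longleftrightarrow> D \<in> sets borel \<and>
    (\<forall>a b c e f g. has_bochner_integral lborel
       (\<lambda>P. indicator D P * (a + b * fst P + c * snd P + e * (fst P)\<^sup>2 + f * (fst P * snd P) + g * (snd P)\<^sup>2))
       (a * m0 + b * mx + c * my + e * mxx + f * mxy + g * myy))"

lemma has_moments_empty: "has_moments {} 0 0 0 0 0 0"
  by (simp add: has_moments_def has_bochner_integral_zero)

lemma has_moments_diff:
  assumes "has_moments D m0 mx my mxx mxy myy" "has_moments D' n0 nx ny nxx nxy nyy" "D' \<subseteq> D"
  shows "has_moments (D - D') (m0 - n0) (mx - nx) (my - ny) (mxx - nxx) (mxy - nxy) (myy - nyy)"
  unfolding has_moments_def
proof (intro conjI allI)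
  show "D - D' \<in> sets borel"
    using assms by (auto simp: has_moments_def)
  fix a b c e f g :: real
  let ?q = "\<lambda>P. a + b * fst P + c * snd P + e * (fst P)\<^sup>2 + f * (fst P * snd P) + g * (snd P)\<^sup>2"
  have "has_bochner_integral lborel (\<lambda>P. indicator D P * ?q P - indicator D' P * ?q P)
     ((a * m0 + b * mx + c * my + e * mxx + f * mxy + g * myy) -
      (a * n0 + b * nx + c * ny + e * nxx + f * nxy + g * nyy))"
    using assms by (intro has_bochner_integral_diff) (auto simp: has_moments_def)
  also have "(\<lambda>P. indicator D P * ?q P - indicator D' P * ?q P) = (\<lambda>P. indicator (D - D') P * ?q P)"
    using \<open>D' \<subseteq> D\<close> by (auto simp: fun_eq_iff indicator_def)
  finally show "has_bochner_integral lborel (\<lambda>P. indicator (D - D') P * ?q P)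
     (a * (m0 - n0) + b * (mx - nx) + c * (my - ny) + e * (mxx - nxx) + f * (mxy - nxy) + g * (myy - nyy))"
    by (simp add: algebra_simps)
qed

lemma borel_measurable_fst_snd [measurable]:
  "fst \<in> borel_measurable (borel :: ('a::topological_space \<times> 'b::topological_space) measure)"
  "snd \<in> borel_measurable (borel :: ('a::topological_space \<times> 'b::topological_space) measure)"
  by (intro borel_measurable_continuous_onI continuous_intros)+

lemma nn_integral_lborel_pair:
  fixes f :: "'a::euclidean_space \<times> 'b::euclidean_space \<Rightarrow> ennreal"
  assumes [measurable]: "f \<in> borel_measurable borel"
  shows "(\<integral>\<^sup>+P. f P \<partial>lborel) = (\<integral>\<^sup>+x. \<integral>\<^sup>+y. f (x, y) \<partial>lborel \<partial>lborel)"
proof -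
  have "(\<integral>\<^sup>+P. f P \<partial>lborel) = (\<integral>\<^sup>+P. f P \<partial>(lborel \<Otimes>\<^sub>M lborel))"
    by (simp add: lborel_prod)
  also have "\<dots> = (\<integral>\<^sup>+x. \<integral>\<^sup>+y. f (x, y) \<partial>lborel \<partial>lborel)"
    by (rule lborel.nn_integral_fst[symmetric]) (simp add: lborel_prod)
  finally show ?thesis .
qed

lemma nn_integral_lborel_swap:
  fixes f :: "'a::euclidean_space \<Rightarrow> 'b::euclidean_space \<Rightarrow> ennreal"
  assumes [measurable]: "case_prod f \<in> borel_measurable (borel \<Otimes>\<^sub>M borel)"
  shows "(\<integral>\<^sup>+x. \<integral>\<^sup>+y. f x y \<partial>lborel \<partial>lborel) = (\<integral>\<^sup>+y. \<integral>\<^sup>+x. f x y \<partial>lborel \<partial>lborel)"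
  by (rule lborel_pair.Fubini') simp

text \<open>The map is the affine involution that exchanges the vertices \<open>(0, 0)\<close> and
  \<open>(0, 1)\<close> of the standard triangle and fixes \<open>(1, 0)\<close>. It reflects every
  vertical line in itself, so Fubini shows that it preserves area.\<close>

lemma reflect_lborel:
  "distr lborel borel (\<lambda>P. (fst P, 1 - fst P - snd P)) = (lborel :: (real \<times> real) measure)"
proof (rule measure_eqI)
  fix A :: "(real \<times> real) set" assume "A \<in> sets (distr lborel borel (\<lambda>P. (fst P, 1 - fst P - snd P)))"
  then have [measurable]: "A \<in> sets borel" by simp
  have [measurable]: "(\<lambda>P::real\<times>real. (fst P, 1 - fst P - snd P)) \<in> borel_measurable borel"
    by (intro borel_measurable_continuous_onI continuous_intros)
  have "emeasure (distr lborel borel (\<lambda>P. (fst P, 1 - fst P - snd P))) A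
      = (\<integral>\<^sup>+P. indicator A P \<partial>(distr lborel borel (\<lambda>P::real\<times>real. (fst P, 1 - fst P - snd P))))"
    by simp
  also have "\<dots> = (\<integral>\<^sup>+P. indicator A (fst P, 1 - fst P - snd P) \<partial>(lborel :: (real \<times> real) measure))"
    by (subst nn_integral_distr) auto
  also have "\<dots> = (\<integral>\<^sup>+x. \<integral>\<^sup>+y. indicator A (x, 1 - x - y) \<partial>lborel \<partial>lborel)"
    by (subst nn_integral_lborel_pair) auto
  also have "\<dots> = (\<integral>\<^sup>+x. \<integral>\<^sup>+y. indicator A (x, y) \<partial>lborel \<partial>lborel)"
  proof (rule nn_integral_cong)
    fix x :: real
    show "(\<integral>\<^sup>+y. indicator A (x, 1 - x - y) \<partial>lborel) = (\<integral>\<^sup>+y. indicator A (x, y) \<partial>lborel)"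
      using nn_integral_real_affine[of "\<lambda>y. indicator A (x, y)" "-1" "1 - x"] by simp
  qed
  also have "\<dots> = emeasure lborel A"
    by (subst nn_integral_lborel_pair[symmetric]) auto
  finally show "emeasure (distr lborel borel (\<lambda>P. (fst P, 1 - fst P - snd P))) A = emeasure lborel A" .
qed simp

text \<open>This carries the moments of a corner at the origin to the corner at
  \<open>(0, 1)\<close>. The new values are the moments in \<open>x\<close> and
  \<open>1 - x - y\<close>, expanded.\<close>

lemma has_moments_reflect:
  assumes "has_moments D m0 mx my mxx mxy myy"
  shows "has_moments {P. (fst P, 1 - fst P - snd P) \<in> D} m0 mx (m0 - mx - my) mxx
           (mx - mxx - mxy) (m0 + mxx + myy - 2 * mx - 2 * my + 2 * mxy)"
  unfolding has_moments_def
proof (intro conjI allI)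
  have [measurable]: "(\<lambda>P::real\<times>real. (fst P, 1 - fst P - snd P)) \<in> borel_measurable borel"
    by (intro borel_measurable_continuous_onI continuous_intros)
  have [measurable]: "D \<in> sets borel" using assms by (simp add: has_moments_def)
  show "{P. (fst P, 1 - fst P - snd P) \<in> D} \<in> sets borel"
    using measurable_sets_borel[of "\<lambda>P::real\<times>real. (fst P, 1 - fst P - snd P)" borel D]
    by (simp add: vimage_def)
  fix a b c e f g :: real
  let ?q = "\<lambda>P::real\<times>real. a + b * fst P + c * (1 - fst P - snd P) + e * (fst P)\<^sup>2 + f * (fst P * (1 - fst P - snd P)) + g * (1 - fst P - snd P)\<^sup>2"
  have q: "?q P = (a+c+g) + (b-c+f-2*g) * fst P + (-c-2*g) * snd P + (e-f+g)* (fst P)\<^sup>2 + (2*g-f) * (fst P * snd P) + g * (snd P)\<^sup>2" for P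
    by (simp add: power2_eq_square algebra_simps)
  have "has_bochner_integral lborel (\<lambda>P. indicator D P * ?q P)
     ((a+c+g) * m0 + (b-c+f-2*g) * mx + (-c-2*g) * my + (e-f+g) * mxx + (2*g-f) * mxy + g * myy)"
    unfolding q using assms by (simp add: has_moments_def)
  then have "has_bochner_integral (distr lborel borel (\<lambda>P. (fst P, 1 - fst P - snd P))) (\<lambda>P. indicator D P * ?q P)
     ((a+c+g) * m0 + (b-c+f-2*g) * mx + (-c-2*g) * my + (e-f+g) * mxx + (2*g-f) * mxy + g * myy)"
    by (simp add: reflect_lborel)
  then have *: "has_bochner_integral lborel (\<lambda>P. indicator D (fst P, 1 - fst P - snd P) * ?q (fst P, 1 - fst P - snd P))
     ((a+c+g) * m0 + (b-c+f-2*g) * mx + (-c-2*g) * my + (e-f+g) * mxx + (2*g-f) * mxy + g * myy)"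
    using integrable_distr_eq[of "\<lambda>P. (fst P, 1 - fst P - snd P)" lborel borel "\<lambda>P. indicator D P * ?q P"]
      integral_distr[of "\<lambda>P. (fst P, 1 - fst P - snd P)" lborel borel "\<lambda>P. indicator D P * ?q P"]
    by (simp add: has_bochner_integral_iff)
  have eq: "(\<lambda>P. indicator D (fst P, 1 - fst P - snd P) * ?q (fst P, 1 - fst P - snd P)) =
     (\<lambda>P. indicator {P. (fst P, 1 - fst P - snd P) \<in> D} P *
      (a + b * fst P + c * snd P + e * (fst P)\<^sup>2 + f * (fst P * snd P) + g * (snd P)\<^sup>2))"
    by (simp add: fun_eq_iff indicator_def)
  have v: "(a+c+g) * m0 + (b-c+f-2*g) * mx + (-c-2*g) * my + (e-f+g) * mxx + (2*g-f) * mxy + g * myy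
     = a * m0 + b * mx + c * (m0 - mx - my) + e * mxx + f * (mx - mxx - mxy) + g * (m0 + mxx + myy - 2 * mx - 2 * my + 2 * mxy)"
    by (simp add: algebra_simps)
  show "has_bochner_integral lborel (\<lambda>P. indicator {P. (fst P, 1 - fst P - snd P) \<in> D} P *
      (a + b * fst P + c * snd P + e * (fst P)\<^sup>2 + f * (fst P * snd P) + g * (snd P)\<^sup>2))
     (a * m0 + b * mx + c * (m0 - mx - my) + e * mxx + f * (mx - mxx - mxy) + g * (m0 + mxx + myy - 2 * mx - 2 * my + 2 * mxy))"
    using * unfolding eq v .
qed

context
  fixes p s :: real and S :: "(real \<times> real) set"
  assumes p: "0 < p" and s: "0 < s" and S[measurable]: "S \<in> sets borel"
    and lower: "{P. 0 < fst P \<and> 0 < snd P \<and> fst P / p + snd P / s < 1} \<subseteq> S"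
    and upper: "S \<subseteq> {P. 0 \<le> fst P \<and> 0 \<le> snd P \<and> fst P / p + snd P / s \<le> 1}"
begin

text \<open>\<open>S\<close> may be any set between the open and the closed triangle with legs
  \<open>p\<close> and \<open>s\<close>, which covers strict and weak inequalities at once: apart
  from the null abscissas \<open>0\<close> and \<open>p\<close>, a slice is known up to its two
  endpoints. \<open>F\<close> is an antiderivative of the integral over the vertical slice at
  \<open>x\<close>.\<close>

lemma has_bochner_integral_triangle_monomial:
  fixes i j :: nat
  assumes F: "\<And>x. (F has_real_derivative x ^ i * (s * (1 - x / p)) ^ Suc j / Suc j) (at x)"
    and v: "v = F p - F 0"
  shows "has_bochner_integral lborel (\<lambda>P. indicator S P * ((fst P) ^ i * (snd P) ^ j)) v"
proof (rule has_bochner_integral_nn_integral)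
  show "(\<lambda>P. indicator S P * ((fst P) ^ i * (snd P) ^ j)) \<in> borel_measurable lborel"
    by measurable
  show "AE P in lborel. 0 \<le> indicator S P * ((fst P) ^ i * (snd P) ^ j)"
    using upper by (intro AE_I2) (auto simp: indicator_def)
  have pos: "0 \<le> x ^ i * (s * (1 - x / p)) ^ Suc j / Suc j" if "x \<in> {0..p}" for x
    using that p s by auto
  have "F 0 \<le> F p"
    using p F pos by (intro DERIV_nonneg_imp_nondecreasing[of 0 p F]) auto
  then show "0 \<le> v" by (simp add: v)
  have inner: "(\<integral>\<^sup>+y. ennreal (indicator S (x, y) * (x ^ i * y ^ j)) \<partial>lborel)
      = ennreal (x ^ i * (s * (1 - x / p)) ^ Suc j / Suc j) * indicator {0..p} x"
    if "x \<noteq> 0" "x \<noteq> p" for x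
  proof (cases "x \<in> {0..p}")
    case True
    define t where "t = s * (1 - x / p)"
    have t: "0 < t" using True that p s by (auto simp: t_def)
    have iff: "x / p + y / s < 1 \<longleftrightarrow> y < t" for y
      using p s by (auto simp: t_def field_simps)
    have iff': "x / p + y / s \<le> 1 \<longleftrightarrow> y \<le> t" for y
      using p s by (auto simp: t_def field_simps)
    have "(\<integral>\<^sup>+y. ennreal (indicator S (x, y) * (x ^ i * y ^ j)) \<partial>lborel)
        = (\<integral>\<^sup>+y. ennreal (x ^ i * y ^ j) * indicator {0..t} y \<partial>lborel)"
    proof (rule nn_integral_cong_AE)
      have "AE y in lborel. y \<noteq> 0 \<and> y \<noteq> t"
        using AE_lborel_singleton[of 0] AE_lborel_singleton[of t] by eventually_elim auto
      then show "AE y in lborel. ennreal (indicator S (x, y) * (x ^ i * y ^ j)) = ennreal (x ^ i * y ^ j) * indicator {0..t} y"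
      proof eventually_elim
        case (elim y)
        have "(x, y) \<in> S \<longleftrightarrow> y \<in> {0..t}"
          using lower upper True elim that iff[of y] iff'[of y] by (auto simp: subset_iff)
        then show ?case by (auto simp: indicator_def)
      qed
    qed
    also have "\<dots> = ennreal (x ^ i * t ^ Suc j / Suc j - x ^ i * 0 ^ Suc j / Suc j)"
      using t True
      by (intro nn_integral_FTC_Icc[where F = "\<lambda>y. x ^ i * y ^ Suc j / Suc j"])
         (auto intro!: derivative_eq_intros simp del: power_Suc)
    finally show ?thesis using True by (simp add: t_def)
  next
    case False
    then have "(x, y) \<notin> S" for y
    proof -
      have "x < 0 \<or> x / p > 1" using False p by auto
      moreover have "0 \<le> y \<Longrightarrow> 0 \<le> y / s" using s by simp
      ultimately show ?thesis using upper by fastforce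
    qed
    then show ?thesis using False by simp
  qed
  have "(\<integral>\<^sup>+P. ennreal (indicator S P * ((fst P) ^ i * (snd P) ^ j)) \<partial>lborel)
      = (\<integral>\<^sup>+x. \<integral>\<^sup>+y. ennreal (indicator S (x, y) * (x ^ i * y ^ j)) \<partial>lborel \<partial>lborel)"
    by (subst nn_integral_lborel_pair) auto
  also have "\<dots> = (\<integral>\<^sup>+x. ennreal (x ^ i * (s * (1 - x / p)) ^ Suc j / Suc j) * indicator {0..p} x \<partial>lborel)"
  proof (rule nn_integral_cong_AE)
    have "AE x in lborel. x \<noteq> 0 \<and> x \<noteq> p"
      using AE_lborel_singleton[of 0] AE_lborel_singleton[of p] by eventually_elim auto
    then show "AE x in lborel. (\<integral>\<^sup>+y. ennreal (indicator S (x, y) * (x ^ i * y ^ j)) \<partial>lborel)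
      = ennreal (x ^ i * (s * (1 - x / p)) ^ Suc j / Suc j) * indicator {0..p} x"
      by eventually_elim (rule inner, auto)
  qed
  also have "\<dots> = ennreal v"
    unfolding v using F pos p by (intro nn_integral_FTC_Icc) auto
  finally show "(\<integral>\<^sup>+P. ennreal (indicator S P * ((fst P) ^ i * (snd P) ^ j)) \<partial>lborel) = ennreal v" .
qed

lemma has_moments_triangle:
  "has_moments S (p * s / 2) (p\<^sup>2 * s / 6) (p * s\<^sup>2 / 6) (p ^ 3 * s / 12) (p\<^sup>2 * s\<^sup>2 / 24) (p * s ^ 3 / 12)"
  unfolding has_moments_def
proof (intro conjI allI)
  fix a b c e f g :: real
  note [simp] = p[THEN less_imp_neq, symmetric] s[THEN less_imp_neq, symmetric]
  have "has_bochner_integral lborel (\<lambda>P. indicator S P * ((fst P) ^ 0 * (snd P) ^ 0)) (p * s / 2)"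
    by (rule has_bochner_integral_triangle_monomial[where F = "\<lambda>x. s * (x - x\<^sup>2 / (2 * p))"])
       (auto intro!: derivative_eq_intros simp: field_simps power2_eq_square)
  moreover have "has_bochner_integral lborel (\<lambda>P. indicator S P * ((fst P) ^ 1 * (snd P) ^ 0)) (p\<^sup>2 * s / 6)"
    by (rule has_bochner_integral_triangle_monomial[where F = "\<lambda>x. s * (x\<^sup>2 / 2 - x^3 / (3 * p))"])
       (auto intro!: derivative_eq_intros simp: field_simps power2_eq_square power3_eq_cube)
  moreover have "has_bochner_integral lborel (\<lambda>P. indicator S P * ((fst P) ^ 2 * (snd P) ^ 0)) (p ^ 3 * s / 12)"
    by (rule has_bochner_integral_triangle_monomial[where F = "\<lambda>x. s * (x^3 / 3 - x^4 / (4 * p))"])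
       (auto intro!: derivative_eq_intros simp: field_simps power2_eq_square power3_eq_cube power4_eq_xxxx)
  moreover have "has_bochner_integral lborel (\<lambda>P. indicator S P * ((fst P) ^ 0 * (snd P) ^ 1)) (p * s\<^sup>2 / 6)"
    by (rule has_bochner_integral_triangle_monomial[where F = "\<lambda>x. s\<^sup>2 / 2 * (x - x\<^sup>2 / p + x^3 / (3 * p\<^sup>2))"])
       (auto intro!: derivative_eq_intros simp: field_simps power2_eq_square power3_eq_cube)
  moreover have "has_bochner_integral lborel (\<lambda>P. indicator S P * ((fst P) ^ 1 * (snd P) ^ 1)) (p\<^sup>2 * s\<^sup>2 / 24)"
    by (rule has_bochner_integral_triangle_monomial[where F = "\<lambda>x. s\<^sup>2 / 2 * (x\<^sup>2 / 2 - 2 * x^3 / (3 * p) + x^4 / (4 * p\<^sup>2))"])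
       (auto intro!: derivative_eq_intros simp: field_simps power2_eq_square power3_eq_cube power4_eq_xxxx)
  moreover have "has_bochner_integral lborel (\<lambda>P. indicator S P * ((fst P) ^ 0 * (snd P) ^ 2)) (p * s ^ 3 / 12)"
    by (rule has_bochner_integral_triangle_monomial[where F = "\<lambda>x. s^3 / 3 * (x - 3 * x\<^sup>2 / (2 * p) + x^3 / p\<^sup>2 - x^4 / (4 * p^3))"])
       (auto intro!: derivative_eq_intros simp: field_simps power2_eq_square power3_eq_cube power4_eq_xxxx numeral_2_eq_2)
  ultimately have "has_bochner_integral lborel (\<lambda>P. a * (indicator S P * ((fst P) ^ 0 * (snd P) ^ 0))
     + b * (indicator S P * ((fst P) ^ 1 * (snd P) ^ 0)) + c * (indicator S P * ((fst P) ^ 0 * (snd P) ^ 1))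
     + e * (indicator S P * ((fst P) ^ 2 * (snd P) ^ 0)) + f * (indicator S P * ((fst P) ^ 1 * (snd P) ^ 1))
     + g * (indicator S P * ((fst P) ^ 0 * (snd P) ^ 2)))
     (a * (p * s / 2) + b * (p\<^sup>2 * s / 6) + c * (p * s\<^sup>2 / 6) + e * (p ^ 3 * s / 12) + f * (p\<^sup>2 * s\<^sup>2 / 24) + g * (p * s ^ 3 / 12))"
    by (intro has_bochner_integral_add has_bochner_integral_mult_right) auto
  then show "has_bochner_integral lborel
        (\<lambda>P. indicator S P * (a + b * fst P + c * snd P + e * (fst P)\<^sup>2 + f * (fst P * snd P) + g * (snd P)\<^sup>2))
        (a * (p * s / 2) + b * (p\<^sup>2 * s / 6) + c * (p * s\<^sup>2 / 6) + e * (p ^ 3 * s / 12) + f * (p\<^sup>2 * s\<^sup>2 / 24) + g * (p * s ^ 3 / 12))"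
    by (simp add: algebra_simps)
qed simp

end

text \<open>The value is the integral of a nonnegative function, so its sign comes for free. In this
  way the moment determinant is seen to be nonnegative without any algebra.\<close>

lemma has_moments_nn_integral:
  assumes "has_moments D m0 mx my mxx mxy myy"
    and "\<And>P. P \<in> D \<Longrightarrow> q P = a + b * fst P + c * snd P + e * (fst P)\<^sup>2 + f * (fst P * snd P) + g * (snd P)\<^sup>2"
    and nn: "\<And>P. P \<in> D \<Longrightarrow> 0 \<le> q P"
    and v: "v = a * m0 + b * mx + c * my + e * mxx + f * mxy + g * myy"
  shows "(\<integral>\<^sup>+P. indicator D P * ennreal (q P) \<partial>lborel) = ennreal v" and "0 \<le> v"
proof -
  have *: "has_bochner_integral lborel (\<lambda>P. indicator D P * (a + b * fst P + c * snd P + e * (fst P)\<^sup>2 + f * (fst P * snd P) + g * (snd P)\<^sup>2)) v"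
    using assms(1) by (simp add: has_moments_def v)
  have eq: "(\<lambda>P. indicator D P * (a + b * fst P + c * snd P + e * (fst P)\<^sup>2 + f * (fst P * snd P) + g * (snd P)\<^sup>2))
     = (\<lambda>P. indicator D P * q P)"
    using assms(2) by (auto simp: fun_eq_iff indicator_def)
  have "(\<integral>\<^sup>+P. ennreal (indicator D P * q P) \<partial>lborel) = ennreal v"
    using * nn unfolding eq
    by (subst nn_integral_eq_integral) (auto simp: has_bochner_integral_iff indicator_def)
  also have "(\<lambda>P. ennreal (indicator D P * q P)) = (\<lambda>P. indicator D P * ennreal (q P))"
    by (auto simp: fun_eq_iff indicator_def)
  finally show "(\<integral>\<^sup>+P. indicator D P * ennreal (q P) \<partial>lborel) = ennreal v" .
  have "0 \<le> integral\<^sup>L lborel (\<lambda>P. indicator D P * q P)"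
    using nn by (intro integral_nonneg_AE) (auto simp: indicator_def)
  then show "0 \<le> v" using * unfolding eq by (simp add: has_bochner_integral_iff)
qed

text \<open>Twice the signed area of the triangle \<open>P Q R\<close>.\<close>

definition cross :: "real \<times> real \<Rightarrow> real \<times> real \<Rightarrow> real \<times> real \<Rightarrow> real" where
  "cross P Q R = (fst Q - fst P) * (snd R - snd P) - (fst R - fst P) * (snd Q - snd P)"

text \<open>The determinant of the Gram matrix of the functions \<open>1\<close>, \<open>x\<close>,
  \<open>y\<close> on the region.\<close>

definition det_mom :: "real \<Rightarrow> real \<Rightarrow> real \<Rightarrow> real \<Rightarrow> real \<Rightarrow> real \<Rightarrow> real" where
  "det_mom m0 mx my mxx mxy myy =
    m0 * (mxx * myy - mxy\<^sup>2) - mx * (mx * myy - mxy * my) + my * (mx * mxy - mxx * my)"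

text \<open>Andreief's identity: \<open>cross P Q R\<close> is the determinant with rows
  \<open>(1, x, y)\<close> at the three points, so the integral of its square is 3! times the Gram
  determinant. Here the points are integrated out one at a time, which yields nonnegativity at every
  stage.\<close>

lemma nn_integral_cross_square:
  assumes D: "has_moments D m0 mx my mxx mxy myy"
  shows "(\<integral>\<^sup>+P. indicator D P * (\<integral>\<^sup>+Q. indicator D Q * (\<integral>\<^sup>+R. indicator D R * ennreal ((cross P Q R)\<^sup>2) \<partial>lborel) \<partial>lborel) \<partial>lborel)
      = ennreal (6 * det_mom m0 mx my mxx mxy myy)" (is "?I = _")
    and "0 \<le> det_mom m0 mx my mxx mxy myy"
proof -
  \<comment> \<open>The coefficients of \<open>cross P Q R\<close> as an affine function of
    \<open>R\<close>.\<close>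
  define A B C where "A = (\<lambda>(P :: real \<times> real) (Q :: real \<times> real). fst P * snd Q - fst Q * snd P :: real)"
    and "B = (\<lambda>(P :: real \<times> real) (Q :: real \<times> real). snd P - snd Q)" and "C = (\<lambda>(P :: real \<times> real) (Q :: real \<times> real). fst Q - fst P :: real)"
  note ABC = A_def B_def C_def
  define I1 where "I1 P Q = (A P Q)\<^sup>2 * m0 + 2 * A P Q * B P Q * mx + 2 * A P Q * C P Q * my
     + (B P Q)\<^sup>2 * mxx + 2 * B P Q * C P Q * mxy + (C P Q)\<^sup>2 * myy" for P Q
  have 1: "(\<integral>\<^sup>+R. indicator D R * ennreal ((cross P Q R)\<^sup>2) \<partial>lborel) = ennreal (I1 P Q) \<and> 0 \<le> I1 P Q" for P Q
  proof -
    have eq: "(cross P Q R)\<^sup>2 = (A P Q)\<^sup>2 + (2 * A P Q * B P Q) * fst R + (2 * A P Q * C P Q) * snd R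
      + (B P Q)\<^sup>2 * (fst R)\<^sup>2 + (2 * B P Q * C P Q) * (fst R * snd R) + (C P Q)\<^sup>2 * (snd R)\<^sup>2" for R
      unfolding cross_def ABC by algebra
    show ?thesis
      using has_moments_nn_integral[OF D eq, of "I1 P Q"] by (simp add: I1_def)
  qed
  \<comment> \<open>Twice the quadratic form of the adjugate of the moment matrix at
    \<open>(1, x, y)\<close>. Integrating it gives twice the trace of adjugate times matrix, that
    is, six determinants.\<close>
  define I2 where "I2 x y = 2 * (y\<^sup>2 * (m0 * mxx - mx\<^sup>2) + x\<^sup>2 * (m0 * myy - my\<^sup>2) + (mxx * myy - mxy\<^sup>2)
     + 2 * y * (mx * mxy - my * mxx) + 2 * x * (my * mxy - mx * myy) + 2 * x * y * (mx * my - m0 * mxy))" for x y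
  have 2: "(\<integral>\<^sup>+Q. indicator D Q * ennreal (I1 P Q) \<partial>lborel) = ennreal (I2 (fst P) (snd P)) \<and> 0 \<le> I2 (fst P) (snd P)" for P
  proof -
    obtain x y where P: "P = (x, y)" by (cases P)
    have eq: "I1 P Q = (y\<^sup>2 * mxx + x\<^sup>2 * myy - 2 * x * y * mxy)
        + (-2*y\<^sup>2 * mx + 2*x*y*my + 2*y*mxy - 2*x*myy) * fst Q
        + (2*x*y*mx - 2*x\<^sup>2*my - 2*y*mxx + 2*x*mxy) * snd Q
        + (y\<^sup>2 * m0 + myy - 2*y*my) * (fst Q)\<^sup>2 + (-2*x*y*m0 + 2*y*mx + 2*x*my - 2*mxy) * (fst Q * snd Q)
        + (x\<^sup>2 * m0 + mxx - 2*x*mx) * (snd Q)\<^sup>2" for Q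
      unfolding I1_def ABC P fst_conv snd_conv by algebra
    have v: "I2 (fst P) (snd P) = (y\<^sup>2 * mxx + x\<^sup>2 * myy - 2 * x * y * mxy) * m0
        + (-2*y\<^sup>2 * mx + 2*x*y*my + 2*y*mxy - 2*x*myy) * mx
        + (2*x*y*mx - 2*x\<^sup>2*my - 2*y*mxx + 2*x*mxy) * my
        + (y\<^sup>2 * m0 + myy - 2*y*my) * mxx + (-2*x*y*m0 + 2*y*mx + 2*x*my - 2*mxy) * mxy
        + (x\<^sup>2 * m0 + mxx - 2*x*mx) * myy"
      unfolding I2_def P fst_conv snd_conv by algebra
    show ?thesis
      using has_moments_nn_integral[OF D eq _ v] 1 by blast
  qed
  have "(\<integral>\<^sup>+P. indicator D P * ennreal (I2 (fst P) (snd P)) \<partial>lborel) = ennreal (6 * det_mom m0 mx my mxx mxy myy)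
     \<and> 0 \<le> 6 * det_mom m0 mx my mxx mxy myy"
  proof -
    have eq: "I2 (fst P) (snd P) = 2*(mxx * myy - mxy\<^sup>2) + (4 * (my * mxy - mx * myy)) * fst P
       + (4 * (mx * mxy - my * mxx)) * snd P + (2 * (m0 * myy - my\<^sup>2)) * (fst P)\<^sup>2
       + (4 *(mx * my - m0 * mxy)) * (fst P * snd P) + (2*(m0 * mxx - mx\<^sup>2)) * (snd P)\<^sup>2" for P
      unfolding I2_def by algebra
    have v: "6 * det_mom m0 mx my mxx mxy myy = 2*(mxx * myy - mxy\<^sup>2) * m0 + (4 * (my * mxy - mx * myy)) * mx
       + (4 * (mx * mxy - my * mxx)) * my + (2 * (m0 * myy - my\<^sup>2)) * mxx
       + (4 *(mx * my - m0 * mxy)) * mxy + (2*(m0 * mxx - mx\<^sup>2)) * myy"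
      unfolding det_mom_def by algebra
    show ?thesis
      using has_moments_nn_integral[OF D eq _ v] 2 by blast
  qed
  then show "?I = ennreal (6 * det_mom m0 mx my mxx mxy myy)" "0 \<le> det_mom m0 mx my mxx mxy myy"
    by (auto simp: 1 2)
qed

section \<open>Planes through the prism\<close>

definition unit_tri :: "(real \<times> real) set" where
  "unit_tri = {P. 0 \<le> fst P \<and> 0 \<le> snd P \<and> fst P + snd P \<le> 1}"

definition height :: "real \<Rightarrow> real \<Rightarrow> real \<Rightarrow> real \<times> real \<Rightarrow> real" where
  "height a b c P = a + (b - a) * fst P + (c - a) * snd P"

text \<open>
  The plane with heights \<open>a\<close>, \<open>b\<close>, \<open>c\<close> over the vertices of the triangle meets the prism exactly over the
  points \<open>P\<close> with \<open>slab a b c P = 1\<close>.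
\<close>
definition slab :: "real \<Rightarrow> real \<Rightarrow> real \<Rightarrow> real \<times> real \<Rightarrow> ennreal" where
  "slab a b c P = indicator unit_tri P * indicator {0..1} (height a b c P)"

definition section_moment :: "real \<Rightarrow> real \<Rightarrow> real \<Rightarrow> ennreal" where
  "section_moment a b c = (\<integral>\<^sup>+P. slab a b c P * (\<integral>\<^sup>+Q. slab a b c Q *
      (\<integral>\<^sup>+R. slab a b c R * ennreal ((cross P Q R)\<^sup>2) \<partial>lborel) \<partial>lborel) \<partial>lborel)"

definition mean_gap :: "real \<Rightarrow> real \<Rightarrow> real \<Rightarrow> ennreal" where
  "mean_gap a b c = (\<integral>\<^sup>+P. indicator unit_tri P *
      (\<integral>\<^sup>+z. indicator {0..1} z * ennreal \<bar>z - height a b c P\<bar> \<partial>lborel) \<partial>lborel)"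

definition Psi :: "real \<Rightarrow> real \<Rightarrow> real \<Rightarrow> ennreal" where
  "Psi a b c = section_moment a b c * mean_gap a b c"

lemma unit_tri_borel [measurable]: "unit_tri \<in> sets borel"
proof -
  have "closed unit_tri"
    unfolding unit_tri_def by (intro closed_Collect_conj closed_Collect_le continuous_intros)
  then show ?thesis by simp
qed

lemma has_moments_unit_tri: "has_moments unit_tri (1/2) (1/6) (1/6) (1/12) (1/24) (1/12)"
proof -
  have "{P. 0 < fst P \<and> 0 < snd P \<and> fst P / 1 + snd P / 1 < 1} \<subseteq> unit_tri"
    "unit_tri \<subseteq> {P. 0 \<le> fst P \<and> 0 \<le> snd P \<and> fst P / 1 + snd P / 1 \<le> 1}"
    by (auto simp: unit_tri_def)
  from has_moments_triangle[OF _ _ _ this] show ?thesis by simp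
qed

lemma measurable_height [measurable (raw)]:
  assumes [measurable]: "a \<in> borel_measurable M" "b \<in> borel_measurable M" "c \<in> borel_measurable M"
    "P \<in> borel_measurable M"
  shows "(\<lambda>x. height (a x) (b x) (c x) (P x)) \<in> borel_measurable M"
  unfolding height_def by measurable

lemma measurable_cross [measurable (raw)]:
  assumes [measurable]: "P \<in> borel_measurable M" "Q \<in> borel_measurable M" "R \<in> borel_measurable M"
  shows "(\<lambda>x. cross (P x) (Q x) (R x)) \<in> borel_measurable M"
  unfolding cross_def by measurable

lemma measurable_slab [measurable (raw)]:
  assumes [measurable]: "a \<in> borel_measurable M" "b \<in> borel_measurable M" "c \<in> borel_measurable M"
    "P \<in> borel_measurable M"
  shows "(\<lambda>x. slab (a x) (b x) (c x) (P x)) \<in> borel_measurable M"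
  unfolding slab_def by measurable

lemma measurable_Psi [measurable (raw)]:
  assumes [measurable]: "a \<in> borel_measurable M" "b \<in> borel_measurable M" "c \<in> borel_measurable M"
  shows "(\<lambda>x. Psi (a x) (b x) (c x)) \<in> borel_measurable M"
  unfolding Psi_def section_moment_def mean_gap_def by measurable

section \<open>Symmetries: permuting the vertices and turning the prism over\<close>

lemma nn_integral_reflect:
  fixes f :: "real \<times> real \<Rightarrow> ennreal"
  assumes [measurable]: "f \<in> borel_measurable borel"
  shows "(\<integral>\<^sup>+P. f P \<partial>lborel) = (\<integral>\<^sup>+P. f (fst P, 1 - fst P - snd P) \<partial>lborel)"
  by (subst reflect_lborel[symmetric]) (simp add: nn_integral_distr)

lemma nn_integral_swap:
  fixes f :: "real \<times> real \<Rightarrow> ennreal"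
  assumes [measurable]: "f \<in> borel_measurable borel"
  shows "(\<integral>\<^sup>+P. f P \<partial>lborel) = (\<integral>\<^sup>+P. f (snd P, fst P) \<partial>lborel)"
proof -
  have "(\<integral>\<^sup>+P. f P \<partial>lborel) = (\<integral>\<^sup>+x. \<integral>\<^sup>+y. f (x, y) \<partial>lborel \<partial>lborel)"
    by (rule nn_integral_lborel_pair) simp
  also have "\<dots> = (\<integral>\<^sup>+y. \<integral>\<^sup>+x. f (x, y) \<partial>lborel \<partial>lborel)"
    by (rule nn_integral_lborel_swap) (simp add: borel_prod)
  also have "\<dots> = (\<integral>\<^sup>+P. f (snd P, fst P) \<partial>lborel)"
    by (subst nn_integral_lborel_pair) simp_all
  finally show ?thesis .
qed

text \<open>For an area preserving \<open>\<sigma>\<close> that keeps squared areas of triangles,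
  the substitution is made from the innermost point outwards, each time replacing one argument of
  \<open>cross\<close>.\<close>

lemma nn_integral_cross_square_transform:
  fixes s :: "real \<times> real \<Rightarrow> ennreal" and \<sigma> :: "real \<times> real \<Rightarrow> real \<times> real"
  assumes \<sigma>: "\<And>f::real \<times> real \<Rightarrow> ennreal. f \<in> borel_measurable borel \<Longrightarrow> (\<integral>\<^sup>+P. f P \<partial>lborel) = (\<integral>\<^sup>+P. f (\<sigma> P) \<partial>lborel)"
    and c: "\<And>P Q R. (cross (\<sigma> P) (\<sigma> Q) (\<sigma> R))\<^sup>2 = (cross P Q R)\<^sup>2"
    and [measurable]: "s \<in> borel_measurable borel"
  shows "(\<integral>\<^sup>+P. s (\<sigma> P) * (\<integral>\<^sup>+Q. s (\<sigma> Q) * (\<integral>\<^sup>+R. s (\<sigma> R) * ennreal ((cross P Q R)\<^sup>2) \<partial>lborel) \<partial>lborel) \<partial>lborel)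
    = (\<integral>\<^sup>+P. s P * (\<integral>\<^sup>+Q. s Q * (\<integral>\<^sup>+R. s R * ennreal ((cross P Q R)\<^sup>2) \<partial>lborel) \<partial>lborel) \<partial>lborel)"
proof -
  have 1: "(\<integral>\<^sup>+R. s (\<sigma> R) * ennreal ((cross P Q R)\<^sup>2) \<partial>lborel) = (\<integral>\<^sup>+R. s R * ennreal ((cross (\<sigma> P) (\<sigma> Q) R)\<^sup>2) \<partial>lborel)" for P Q
    by (subst \<sigma>[of "\<lambda>R. s R * ennreal ((cross (\<sigma> P) (\<sigma> Q) R)\<^sup>2)"]) (measurable, simp add: c)
  have 2: "(\<integral>\<^sup>+Q. s (\<sigma> Q) * (\<integral>\<^sup>+R. s R * ennreal ((cross (\<sigma> P) (\<sigma> Q) R)\<^sup>2) \<partial>lborel) \<partial>lborel)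
    = (\<integral>\<^sup>+Q. s Q * (\<integral>\<^sup>+R. s R * ennreal ((cross (\<sigma> P) Q R)\<^sup>2) \<partial>lborel) \<partial>lborel)" for P
  proof -
    have "(\<lambda>Q. s Q * (\<integral>\<^sup>+R. s R * ennreal ((cross P' Q R)\<^sup>2) \<partial>lborel)) \<in> borel_measurable borel" for P'
      by measurable
    from \<sigma>[OF this[of "\<sigma> P"]] show ?thesis by simp
  qed
  have "(\<lambda>P. s P * (\<integral>\<^sup>+Q. s Q * (\<integral>\<^sup>+R. s R * ennreal ((cross P Q R)\<^sup>2) \<partial>lborel) \<partial>lborel)) \<in> borel_measurable borel"
    by measurable
  from \<sigma>[OF this] show ?thesis
    unfolding 1 2 by simp
qed

text \<open>Reflection in the diagonal exchanges the vertices \<open>(1, 0)\<close> and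
  \<open>(0, 1)\<close>. Together with \<open>Psi_reflect\<close> it generates all permutations of
  the three heights.\<close>

lemma Psi_swap: "Psi a c b = Psi a b c"
proof -
  have s: "slab a c b P = slab a b c (snd P, fst P)" for P
    by (auto simp: slab_def unit_tri_def height_def indicator_def algebra_simps)
  have c: "(cross P Q R)\<^sup>2 = (cross (snd P, fst P) (snd Q, fst Q) (snd R, fst R))\<^sup>2" for P Q R
    by (simp add: cross_def power2_eq_square algebra_simps)
  have h: "height a c b P = height a b c (snd P, fst P)" for P
    by (simp add: height_def)
  have i: "indicator unit_tri P = (indicator unit_tri (snd P, fst P) :: ennreal)" for P
    by (auto simp: unit_tri_def indicator_def)
  have "section_moment a c b = section_moment a b c"
    unfolding section_moment_def s
    by (rule nn_integral_cross_square_transform) (auto intro: nn_integral_swap c[symmetric])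
  moreover have "mean_gap a c b = mean_gap a b c"
    unfolding mean_gap_def h
    by (subst nn_integral_swap[of "\<lambda>P. indicator unit_tri P * (\<integral>\<^sup>+z. indicator {0..1} z * ennreal \<bar>z - height a b c P\<bar> \<partial>lborel)"]) (measurable, simp add: i[symmetric])
  ultimately show ?thesis by (simp add: Psi_def)
qed

lemma Psi_reflect: "Psi c b a = Psi a b c"
proof -
  have s: "slab c b a P = slab a b c (fst P, 1 - fst P - snd P)" for P
    by (auto simp: slab_def unit_tri_def height_def indicator_def algebra_simps)
  have c: "(cross P Q R)\<^sup>2 = (cross (fst P, 1 - fst P - snd P) (fst Q, 1 - fst Q - snd Q) (fst R, 1 - fst R - snd R))\<^sup>2" for P Q R
    by (simp add: cross_def power2_eq_square algebra_simps)
  have h: "height c b a P = height a b c (fst P, 1 - fst P - snd P)" for P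
    by (simp add: height_def algebra_simps)
  have i: "indicator unit_tri P = (indicator unit_tri (fst P, 1 - fst P - snd P) :: ennreal)" for P
    by (auto simp: unit_tri_def indicator_def)
  have "section_moment c b a = section_moment a b c"
    unfolding section_moment_def s
    by (rule nn_integral_cross_square_transform) (auto intro: nn_integral_reflect c[symmetric])
  moreover have "mean_gap c b a = mean_gap a b c"
    unfolding mean_gap_def h
    by (subst nn_integral_reflect[of "\<lambda>P. indicator unit_tri P * (\<integral>\<^sup>+z. indicator {0..1} z * ennreal \<bar>z - height a b c P\<bar> \<partial>lborel)"]) (measurable, simp add: i[symmetric])
  ultimately show ?thesis by (simp add: Psi_def)
qed

text \<open>Turning the prism upside down, \<open>z\<close> to \<open>1 - z\<close>, moves no point
  of the triangle, so the shadow stays the same and only the inner integral over \<open>z\<close> is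
  reflected.\<close>

lemma Psi_flip: "Psi (1 - a) (1 - b) (1 - c) = Psi a b c"
proof -
  have h: "height (1 - a) (1 - b) (1 - c) P = 1 - height a b c P" for P
    by (simp add: height_def algebra_simps)
  have s: "slab (1 - a) (1 - b) (1 - c) P = slab a b c P" for P
    by (auto simp: slab_def h indicator_def)
  have z: "(\<integral>\<^sup>+z. indicator {0..1} z * ennreal \<bar>z - (1 - u)\<bar> \<partial>lborel) =
      (\<integral>\<^sup>+z. indicator {0..1} z * ennreal \<bar>z - u\<bar> \<partial>lborel)" for u :: real
    by (subst nn_integral_real_affine[of _ "-1" 1])
       (auto intro!: nn_integral_cong simp: indicator_def abs_minus_commute algebra_simps)
  show ?thesis by (simp add: Psi_def section_moment_def mean_gap_def s h z)
qed

text \<open>One antiderivative across the kink \<open>t = u\<close>, so that the mean distance below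
  needs no splitting of the interval at \<open>u\<close>.\<close>

lemma has_real_derivative_half_square_abs:
  "((\<lambda>t. (t - u) * \<bar>t - u\<bar> / 2) has_real_derivative \<bar>t - u\<bar>) (at (t::real))"
proof -
  consider "t < u" | "t = u" | "t > u" by linarith
  then show ?thesis
  proof cases
    case 1
    have "((\<lambda>t. - ((t - u)\<^sup>2 / 2)) has_real_derivative \<bar>t - u\<bar>) (at t)"
      using 1 by (auto intro!: derivative_eq_intros simp: field_simps)
    then show ?thesis
      by (rule has_field_derivative_transform_within_open[where S="{..<u}"])
         (use 1 in \<open>auto simp: power2_eq_square field_simps\<close>)
  next
    case 3
    have "((\<lambda>t. (t - u)\<^sup>2 / 2) has_real_derivative \<bar>t - u\<bar>) (at t)"
      using 3 by (auto intro!: derivative_eq_intros simp: field_simps)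
    then show ?thesis
      by (rule has_field_derivative_transform_within_open[where S="{u<..}"])
         (use 3 in \<open>auto simp: power2_eq_square field_simps\<close>)
  next
    case 2
    have "((\<lambda>h. ((t + h - u) * \<bar>t + h - u\<bar> / 2 - (t - u) * \<bar>t - u\<bar> / 2) / h) \<longlongrightarrow> 0) (at 0)"
    proof (rule Lim_transform_eventually)
      show "((\<lambda>h::real. \<bar>h\<bar> / 2) \<longlongrightarrow> 0) (at 0)"
        by (auto intro!: tendsto_eq_intros)
      show "eventually (\<lambda>h. \<bar>h\<bar> / 2 = ((t + h - u) * \<bar>t + h - u\<bar> / 2 - (t - u) * \<bar>t - u\<bar> / 2) / h) (at 0)"
        using 2 by (auto simp: eventually_at_filter)
    qed
    then show ?thesis using 2 by (simp add: DERIV_def)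
  qed
qed

text \<open>For \<open>u\<close> in the unit interval the mean distance is a quadratic polynomial;
  outside it is \<open>\<bar>u - 1/2\<bar>\<close>. The two corrections are the squared distance of
  \<open>u\<close> from the interval. Over the triangle they live only where the plane has left the
  prism.\<close>

lemma nn_integral_unit_abs_diff:
  "(\<integral>\<^sup>+z. indicator {0..1} z * ennreal \<bar>z - u\<bar> \<partial>lborel)
     = ennreal (u\<^sup>2 - u + 1/2 - (if u < 0 then u\<^sup>2 else 0) - (if u > 1 then (u - 1)\<^sup>2 else 0))"
proof -
  have "(\<integral>\<^sup>+z. indicator {0..1} z * ennreal \<bar>z - u\<bar> \<partial>lborel) =
      (\<integral>\<^sup>+z. ennreal \<bar>z - u\<bar> * indicator {0..1} z \<partial>lborel)"
    by (simp add: mult.commute)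
  also have "\<dots> = ennreal ((1 - u) * \<bar>1 - u\<bar> / 2 - (0 - u) * \<bar>0 - u\<bar> / 2)"
    by (rule nn_integral_FTC_Icc) (auto intro: has_real_derivative_half_square_abs)
  also have "(1 - u) * \<bar>1 - u\<bar> / 2 - (0 - u) * \<bar>0 - u\<bar> / 2 = u\<^sup>2 - u + 1/2 - (if u < 0 then u\<^sup>2 else 0) - (if u > 1 then (u - 1)\<^sup>2 else 0)"
    by (auto simp: power2_eq_square field_simps)
  finally show ?thesis .
qed

text \<open>
  The integral of \<open>(t - (m x + y))\<^sup>2\<close> over a region with the given moments.
\<close>
definition gap_mom :: "real \<Rightarrow> real \<Rightarrow> real \<Rightarrow> real \<Rightarrow> real \<Rightarrow> real \<Rightarrow> real \<Rightarrow> real \<Rightarrow> real" where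
  "gap_mom m t m0 mx my mxx mxy myy =
     t\<^sup>2 * m0 - 2 * t * (m * mx + my) + (m\<^sup>2 * mxx + 2 * m * mxy + myy)"

text \<open>The plane with these heights is \<open>(m x + y - t) / k\<close>. It runs below the
  floor over the first piece and above the ceiling over the second, so the shadow is the triangle
  without both, and \<open>D\<close> is its moment determinant. \<open>W\<close> is
  \<open>k\<^sup>2\<close> times the mean gap: a quadratic integrated over the whole triangle, minus
  a squared distance integrated over each removed piece.\<close>

lemma Psi_eval:
  fixes m t t' :: real
  defines "k \<equiv> t' - t"
  assumes k: "t < t'"
    and C: "has_moments {P \<in> unit_tri. m * fst P + snd P < t} c0 cx cy cxx cxy cyy"
    and E: "has_moments {P \<in> unit_tri. m * fst P + snd P > t'} e0 ex ey exx exy eyy"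
  defines "D \<equiv> det_mom (1/2 - c0 - e0) (1/6 - cx - ex) (1/6 - cy - ey) (1/12 - cxx - exx) (1/24 - cxy - exy) (1/12 - cyy - eyy)"
  defines "W \<equiv> (m\<^sup>2 + m + 1) / 12 - (t + t') * (1 + m) / 6 + t * t' / 2 + k\<^sup>2 / 4
      - gap_mom m t c0 cx cy cxx cxy cyy - gap_mom m t' e0 ex ey exx exy eyy"
  shows "Psi (- t / k) ((m - t) / k) ((1 - t) / k) = ennreal (6 * D * W / k\<^sup>2)" "0 \<le> D" "0 \<le> W"
proof -
  let ?l = "\<lambda>P. m * fst P + snd P"
  let ?C = "{P \<in> unit_tri. m * fst P + snd P < t}" and ?E = "{P \<in> unit_tri. m * fst P + snd P > t'}"
  have k0: "0 < k" using k by (simp add: k_def)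
  have h: "height (- t / k) ((m - t) / k) ((1 - t) / k) P = (?l P - t) / k" for P
    using k0 by (simp add: height_def field_simps)
  have "has_moments (unit_tri - ?C - ?E) (1/2 - c0 - e0) (1/6 - cx - ex) (1/6 - cy - ey) (1/12 - cxx - exx) (1/24 - cxy - exy) (1/12 - cyy - eyy)"
    using k by (intro has_moments_diff[OF has_moments_diff[OF has_moments_unit_tri C] E]) auto
  note sec = nn_integral_cross_square[OF this]
  have slab: "slab (- t / k) ((m - t) / k) ((1 - t) / k) P = indicator (unit_tri - ?C - ?E) P" for P
  proof -
    have "0 \<le> (?l P - t) / k \<longleftrightarrow> \<not> ?l P < t" "(?l P - t) / k \<le> 1 \<longleftrightarrow> \<not> ?l P > t'"
      using k0 by (auto simp: field_simps k_def)
    then show ?thesis unfolding slab_def h by (auto simp: indicator_def)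
  qed
  have sm: "section_moment (- t / k) ((m - t) / k) ((1 - t) / k) = ennreal (6 * D)"
    unfolding section_moment_def slab sec(1) D_def ..
  show D0: "0 \<le> D" using sec(2) by (simp add: D_def)
  \<comment> \<open>\<open>k\<^sup>2\<close> times the mean vertical distance above
    \<open>P\<close>, with the corrections on the two pieces.\<close>
  define g where "g P = indicator unit_tri P * ((?l P - t) * (?l P - t') + k\<^sup>2 / 2)
     - indicator ?C P * (?l P - t)\<^sup>2 - indicator ?E P * (?l P - t')\<^sup>2" for P
  have g: "indicator unit_tri P * (\<integral>\<^sup>+z. indicator {0..1} z * ennreal \<bar>z - (?l P - t) / k\<bar> \<partial>lborel) = ennreal (g P / k\<^sup>2)"
    for P
  proof (cases "P \<in> unit_tri")
    case True
    let ?u = "(?l P - t) / k"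
    have u: "?u < 0 \<longleftrightarrow> ?l P < t" "?u > 1 \<longleftrightarrow> ?l P > t'"
      using k0 by (auto simp: field_simps k_def)
    have eq: "k * ?u = ?l P - t" using k0 by simp
    have "k\<^sup>2 * (?u\<^sup>2 - ?u + 1/2 - (if ?u < 0 then ?u\<^sup>2 else 0) - (if ?u > 1 then (?u - 1)\<^sup>2 else 0))
      = (k * ?u)\<^sup>2 - k * (k * ?u) + k\<^sup>2/2 - (if ?u < 0 then (k * ?u)\<^sup>2 else 0) - (if ?u > 1 then (k * ?u - k)\<^sup>2 else 0)"
      by (simp add: power2_eq_square algebra_simps)
    also have "\<dots> = g P"
      unfolding eq u using True
      by (auto simp: g_def k_def indicator_def power2_eq_square algebra_simps)
    finally have "?u\<^sup>2 - ?u + 1/2 - (if ?u < 0 then ?u\<^sup>2 else 0) - (if ?u > 1 then (?u - 1)\<^sup>2 else 0) = g P / k\<^sup>2"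
      using k0 by (simp add: field_simps)
    then show ?thesis using True by (simp add: nn_integral_unit_abs_diff)
  qed (auto simp: g_def)
  have bC: "has_bochner_integral lborel (\<lambda>P. indicator ?C P * (?l P - t)\<^sup>2) (gap_mom m t c0 cx cy cxx cxy cyy)"
  proof -
    have "has_bochner_integral lborel (\<lambda>P. indicator ?C P * (t\<^sup>2 + (-2*t*m) * fst P + (-2*t) * snd P + m\<^sup>2 * (fst P)\<^sup>2 + (2 * m) * (fst P * snd P) + 1 * (snd P)\<^sup>2))
       (t\<^sup>2 * c0 + (-2*t*m) * cx + (-2*t) * cy + m\<^sup>2 * cxx + (2 * m) * cxy + 1 * cyy)"
      using C by (simp only: has_moments_def)
    moreover have "t\<^sup>2 + (-2*t*m) * fst P + (-2*t) * snd P + m\<^sup>2 * (fst P)\<^sup>2 + (2 * m) * (fst P * snd P) + 1 * (snd P)\<^sup>2 = (?l P - t)\<^sup>2" for P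
      by (simp add: power2_eq_square algebra_simps)
    moreover have "t\<^sup>2 * c0 + (-2*t*m) * cx + (-2*t) * cy + m\<^sup>2 * cxx + (2 * m) * cxy + 1 * cyy = gap_mom m t c0 cx cy cxx cxy cyy"
      by (simp add: gap_mom_def algebra_simps)
    ultimately show ?thesis by simp
  qed
  have bE: "has_bochner_integral lborel (\<lambda>P. indicator ?E P * (?l P - t')\<^sup>2) (gap_mom m t' e0 ex ey exx exy eyy)"
  proof -
    have "has_bochner_integral lborel (\<lambda>P. indicator ?E P * (t'\<^sup>2 + (-2*t'*m) * fst P + (-2*t') * snd P + m\<^sup>2 * (fst P)\<^sup>2 + (2 * m) * (fst P * snd P) + 1 * (snd P)\<^sup>2))
       (t'\<^sup>2 * e0 + (-2*t'*m) * ex + (-2*t') * ey + m\<^sup>2 * exx + (2 * m) * exy + 1 * eyy)"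
      using E by (simp only: has_moments_def)
    moreover have "t'\<^sup>2 + (-2*t'*m) * fst P + (-2*t') * snd P + m\<^sup>2 * (fst P)\<^sup>2 + (2 * m) * (fst P * snd P) + 1 * (snd P)\<^sup>2 = (?l P - t')\<^sup>2" for P
      by (simp add: power2_eq_square algebra_simps)
    moreover have "t'\<^sup>2 * e0 + (-2*t'*m) * ex + (-2*t') * ey + m\<^sup>2 * exx + (2 * m) * exy + 1 * eyy = gap_mom m t' e0 ex ey exx exy eyy"
      by (simp add: gap_mom_def algebra_simps)
    ultimately show ?thesis by simp
  qed
  have bT: "has_bochner_integral lborel (\<lambda>P. indicator unit_tri P * ((?l P - t) * (?l P - t') + k\<^sup>2 / 2))
      ((m\<^sup>2 + m + 1) / 12 - (t + t') * (1 + m) / 6 + t * t' / 2 + k\<^sup>2 / 4)"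
  proof -
    have "has_bochner_integral lborel (\<lambda>P. indicator unit_tri P * ((t * t' + k\<^sup>2 / 2) + (- (t + t') * m) * fst P + (- (t + t')) * snd P + m\<^sup>2 * (fst P)\<^sup>2 + (2 * m) * (fst P * snd P) + 1 * (snd P)\<^sup>2))
       ((t * t' + k\<^sup>2 / 2) * (1/2) + (- (t + t') * m) * (1/6) + (- (t + t')) * (1/6) + m\<^sup>2 * (1/12) + (2 * m) * (1/24) + 1 * (1/12))"
      using has_moments_unit_tri by (simp only: has_moments_def)
    moreover have "(t * t' + k\<^sup>2 / 2) + (- (t + t') * m) * fst P + (- (t + t')) * snd P + m\<^sup>2 * (fst P)\<^sup>2 + (2 * m) * (fst P * snd P) + 1 * (snd P)\<^sup>2
       = (?l P - t) * (?l P - t') + k\<^sup>2 / 2" for P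
      by (simp add: power2_eq_square algebra_simps)
    moreover have "(t * t' + k\<^sup>2 / 2) * (1/2) + (- (t + t') * m) * (1/6) + (- (t + t')) * (1/6) + m\<^sup>2 * (1/12) + (2 * m) * (1/24) + 1 * (1/12)
       = (m\<^sup>2 + m + 1) / 12 - (t + t') * (1 + m) / 6 + t * t' / 2 + k\<^sup>2 / 4"
      by (simp add: field_simps)
    ultimately show ?thesis by (simp only:)
  qed
  have bg: "has_bochner_integral lborel g W"
    unfolding g_def W_def by (intro has_bochner_integral_diff bT bC bE)
  have g0: "0 \<le> g P" for P
  proof -
    have "k\<^sup>2 > 0" using k0 by simp
    show ?thesis
    proof (cases "P \<in> ?C \<or> P \<in> ?E")
      case True
      then show ?thesis
      proof
        assume P: "P \<in> ?C"
        then have "g P = (t - ?l P) * (t' - t) + k\<^sup>2 / 2"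
          using k by (auto simp: g_def indicator_def power2_eq_square algebra_simps)
        then show ?thesis using P k by (auto intro!: add_nonneg_nonneg mult_nonneg_nonneg)
      next
        assume P: "P \<in> ?E"
        then have "g P = (?l P - t') * (t' - t) + k\<^sup>2 / 2"
          using k by (auto simp: g_def indicator_def power2_eq_square algebra_simps)
        then show ?thesis using P k by (auto intro!: add_nonneg_nonneg mult_nonneg_nonneg)
      qed
    next
      case False
      \<comment> \<open>Completing the square around the middle of the strip. On the removed pieces
        the correction left a positive linear function instead.\<close>
      have "(?l P - t) * (?l P - t') + k\<^sup>2 / 2 = (?l P - (t + t') / 2)\<^sup>2 + k\<^sup>2 / 4"
        by (simp add: k_def power2_eq_square field_simps)
      then show ?thesis using False by (auto simp: g_def indicator_def)
    qed
  qed
  show W0: "0 \<le> W"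
    using bg Bochner_Integration.integral_nonneg[of lborel g] g0 by (simp add: has_bochner_integral_iff)
  have "mean_gap (- t / k) ((m - t) / k) ((1 - t) / k) = (\<integral>\<^sup>+P. ennreal (g P / k\<^sup>2) \<partial>lborel)"
    unfolding mean_gap_def h g ..
  also have "\<dots> = ennreal (W / k\<^sup>2)"
    using bg g0 by (subst nn_integral_eq_integral) (auto simp: has_bochner_integral_iff)
  finally show "Psi (- t / k) ((m - t) / k) ((1 - t) / k) = ennreal (6 * D * W / k\<^sup>2)"
    unfolding Psi_def sm using D0 W0 by (simp add: ennreal_mult[symmetric])
qed

section \<open>The contribution of each shape of section\<close>

text \<open>The sign of \<open>f\<close> is asked at interior points only, because there the
  explicit integrands are identified with nonnegative densities; the endpoints are null. The second
  part hands the sign on to the integral.\<close>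

lemma nn_integral_FTC_open:
  fixes f F :: "real \<Rightarrow> real"
  assumes ab: "a \<le> b"
    and D: "\<And>x. a \<le> x \<Longrightarrow> x \<le> b \<Longrightarrow> (F has_real_derivative f x) (at x)"
    and c: "\<And>x. a \<le> x \<Longrightarrow> x \<le> b \<Longrightarrow> isCont f x"
    and nn: "\<And>x. a < x \<Longrightarrow> x < b \<Longrightarrow> 0 \<le> f x"
  shows "(\<integral>\<^sup>+x. indicator {a<..<b} x * ennreal (f x) \<partial>lborel) = ennreal (F b - F a)" "0 \<le> F b - F a"
proof -
  have I: "has_bochner_integral lborel (\<lambda>x. f x * indicator {a..b} x) (F b - F a)"
    using ab D c by (intro has_bochner_integral_FTC_Icc_real) auto
  have open_closed: "AE x in lborel. x \<noteq> a \<and> x \<noteq> b"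
    using AE_lborel_singleton[of a] AE_lborel_singleton[of b] by eventually_elim auto
  have pos: "AE x in lborel. 0 \<le> f x * indicator {a..b} x"
    using open_closed by eventually_elim (auto simp: indicator_def nn)
  have "(\<integral>\<^sup>+x. indicator {a<..<b} x * ennreal (f x) \<partial>lborel) = (\<integral>\<^sup>+x. ennreal (f x * indicator {a..b} x) \<partial>lborel)"
    by (rule nn_integral_cong_AE, use open_closed in eventually_elim) (auto simp: indicator_def)
  also have "\<dots> = ennreal (F b - F a)"
    using I pos by (subst nn_integral_eq_integral) (auto simp: has_bochner_integral_iff)
  finally show "(\<integral>\<^sup>+x. indicator {a<..<b} x * ennreal (f x) \<partial>lborel) = ennreal (F b - F a)" .
  show "0 \<le> F b - F a"
    using I integral_nonneg_AE[OF pos] by (simp add: has_bochner_integral_iff)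
qed

text \<open>In \<open>v = T - t\<close> the integrand is
  \<open>K (a / v ^ 6 + b / v ^ 5 + c / v ^ 4)\<close> on the ray from \<open>T\<close> to infinity,
  and each term has an antiderivative vanishing at infinity.\<close>

lemma nn_integral_ray:
  fixes T K a b c :: real
  assumes T: "0 < T" and nn: "\<And>t. t < 0 \<Longrightarrow> 0 \<le> K * (a + b * (T - t) + c * (T - t)\<^sup>2)"
  shows "(\<integral>\<^sup>+t. indicator {..<0} t * ennreal (K * (a + b * (T - t) + c * (T - t)\<^sup>2) / (T - t) ^ 6) \<partial>lborel)
      = ennreal (K * (a / (5 * T ^ 5) + b / (4 * T ^ 4) + c / (3 * T ^ 3)))"
    and "0 \<le> K * (a / (5 * T ^ 5) + b / (4 * T ^ 4) + c / (3 * T ^ 3))"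
proof -
  \<comment> \<open>The truncation makes \<open>f\<close> nonnegative on the whole line. It changes
    nothing for \<open>s \<ge> 0\<close>: the assumption covers \<open>s > 0\<close>, and continuity
    adds the endpoint (\<open>nn0\<close>).\<close>
  define f where "f s = max 0 (K * (a + b * (T + s) + c * (T + s)\<^sup>2) / (T + s) ^ 6)" for s
  define F where "F s = - (K * (a / (5 * (T + s) ^ 5) + b / (4 * (T + s) ^ 4) + c / (3 * (T + s) ^ 3)))" for s
  have cont: "((\<lambda>s. K * (a + b * (T + s) + c * (T + s)\<^sup>2)) \<longlongrightarrow> K * (a + b * (T + 0) + c * (T + 0)\<^sup>2)) (at_right 0)"
    by (intro tendsto_intros)
  have nn0: "0 \<le> K * (a + b * (T + 0) + c * (T + 0)\<^sup>2)"
    by (rule tendsto_lowerbound[OF cont])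
       (auto simp: eventually_at_filter intro!: always_eventually, use nn[of "- _"] in force)
  have f: "f s = K * (a + b * (T + s) + c * (T + s)\<^sup>2) / (T + s) ^ 6" if "0 \<le> s" for s
  proof -
    have "0 \<le> K * (a + b * (T + s) + c * (T + s)\<^sup>2)"
      using nn[of "- s"] nn0 that by (cases "s = 0") auto
    then show ?thesis using T that by (auto simp: f_def)
  qed
  have D: "(F has_real_derivative f s) (at s)" if "0 \<le> s" for s
  proof -
    define v where "v = T + s"
    have v: "v \<noteq> 0" using that T by (simp add: v_def)
    have "((\<lambda>v. - (K * (a / (5 * v ^ 5) + b / (4 * v ^ 4) + c / (3 * v ^ 3)))) has_real_derivative
       K * (a + b * v + c * v\<^sup>2) / v ^ 6) (at v)"
      using v by (auto intro!: derivative_eq_intros) (simp add: field_simps power_numeral_reduce)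
    then have "((\<lambda>v. - (K * (a / (5 * v ^ 5) + b / (4 * v ^ 4) + c / (3 * v ^ 3)))) has_real_derivative
       K * (a + b * (T + s) + c * (T + s)\<^sup>2) / (T + s) ^ 6) (at (s + T))"
      by (simp add: v_def add.commute)
    from DERIV_shift[THEN iffD1, OF this]
    show ?thesis unfolding f[OF that] F_def by (simp add: add.commute)
  qed
  have pos: "0 \<le> f s" for s by (simp add: f_def)
  have lim0: "((\<lambda>s. x / (y * (T + s) ^ k)) \<longlongrightarrow> 0) at_top" if "0 < k" "y > 0" for x y :: real and k :: nat
  proof -
    have "filterlim (\<lambda>s. y * (T + s) ^ k) at_top at_top"
      using that by (intro filterlim_tendsto_pos_mult_at_top[OF tendsto_const] filterlim_pow_at_top
         filterlim_tendsto_add_at_top[OF tendsto_const] filterlim_ident) auto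
    then show ?thesis
      by (intro tendsto_divide_0[OF tendsto_const] filterlim_at_top_imp_at_infinity)
  qed
  have "(F \<longlongrightarrow> - (K * (0 + 0 + 0))) at_top"
    unfolding F_def by (intro tendsto_intros lim0) auto
  then have lim: "(F \<longlongrightarrow> 0) at_top" by simp
  have "F 0 \<le> F s" if "0 \<le> s" for s
    using that D pos by (intro DERIV_nonneg_imp_nondecreasing[of 0 s F]) auto
  then have "F 0 \<le> 0"
    by (intro tendsto_lowerbound[OF lim]) (auto intro: eventually_at_top_linorderI[of 0])
  then show "0 \<le> K * (a / (5 * T ^ 5) + b / (4 * T ^ 4) + c / (3 * T ^ 3))"
    by (simp add: F_def)
  have [measurable]: "f \<in> borel_measurable borel"
    unfolding f_def by measurable
  have "(\<integral>\<^sup>+t. indicator {..<0} t * ennreal (K * (a + b * (T - t) + c * (T - t)\<^sup>2) / (T - t) ^ 6) \<partial>lborel)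
     = (\<integral>\<^sup>+s. indicator {..<0} (- s) * ennreal (K * (a + b * (T + s) + c * (T + s)\<^sup>2) / (T + s) ^ 6) \<partial>lborel)"
    by (subst nn_integral_real_affine[of _ "-1" 0]) auto
  also have "\<dots> = (\<integral>\<^sup>+s. ennreal (f s) * indicator {0..} s \<partial>lborel)"
    by (rule nn_integral_cong_AE, use AE_lborel_singleton[of 0] in eventually_elim) (auto simp: indicator_def f)
  also have "\<dots> = ennreal (0 - F 0)"
    by (rule nn_integral_FTC_atLeast) (use D pos lim in auto)
  finally show "(\<integral>\<^sup>+t. indicator {..<0} t * ennreal (K * (a + b * (T - t) + c * (T - t)\<^sup>2) / (T - t) ^ 6) \<partial>lborel)
      = ennreal (K * (a / (5 * T ^ 5) + b / (4 * T ^ 4) + c / (3 * T ^ 3)))"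
    by (simp add: F_def)
qed

section \<open>Moments of the pieces that a level line cuts off\<close>

lemma has_moments_corner:
  assumes m: "0 < m" "m < 1" and p: "0 < p" and S: "S \<in> sets borel"
    "{P. 0 < fst P \<and> 0 < snd P \<and> m * fst P + snd P < m * p} \<subseteq> S"
    "S \<subseteq> {P. 0 \<le> fst P \<and> 0 \<le> snd P \<and> m * fst P + snd P \<le> m * p}"
  shows "has_moments S (m * p ^ 2 / 2) (m * p ^ 3 / 6) (m ^ 2 * p ^ 3 / 6) (m * p ^ 4 / 12) (m ^ 2 * p ^ 4 / 24) (m ^ 3 * p ^ 4 / 12)"
proof -
  have mp: "0 < m * p" using m p by simp
  have iff: "x / p + y / (m * p) < 1 \<longleftrightarrow> m * x + y < m * p" "x / p + y / (m * p) \<le> 1 \<longleftrightarrow> m * x + y \<le> m * p" for x y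
    using m p by (auto simp: field_simps)
  have "has_moments S (p * (m * p) / 2) (p\<^sup>2 * (m * p) / 6) (p * (m * p)\<^sup>2 / 6) (p ^ 3 * (m * p) / 12) (p\<^sup>2 * (m * p)\<^sup>2 / 24) (p * (m * p) ^ 3 / 12)"
    by (rule has_moments_triangle) (use p mp S in \<open>simp_all add: iff\<close>)
  then show ?thesis by (simp add: power_numeral_reduce mult_ac)
qed

text \<open>For \<open>p \<le> 1\<close> the level line leaves through the two legs at the origin,
  so the constraint \<open>x + y \<le> 1\<close> is automatic and the piece is a full right triangle
  with legs \<open>p\<close> and \<open>m p\<close>. The weak form serves for complements.\<close>

lemma has_moments_lower:
  assumes m: "0 < m" "m < 1" and p: "0 < p" "p \<le> 1"
  shows "has_moments {P \<in> unit_tri. m * fst P + snd P < m * p} (m * p ^ 2 / 2) (m * p ^ 3 / 6) (m ^ 2 * p ^ 3 / 6) (m * p ^ 4 / 12) (m ^ 2 * p ^ 4 / 24) (m ^ 3 * p ^ 4 / 12)" (is ?A)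
   and "has_moments {P \<in> unit_tri. m * fst P + snd P \<le> m * p} (m * p ^ 2 / 2) (m * p ^ 3 / 6) (m ^ 2 * p ^ 3 / 6) (m * p ^ 4 / 12) (m ^ 2 * p ^ 4 / 24) (m ^ 3 * p ^ 4 / 12)" (is ?B)
proof -
  have sub: "fst P + snd P \<le> 1" if "0 < snd P \<or> 0 \<le> snd P" "m * fst P + snd P \<le> m * p" for P
  proof -
    have "m * (fst P + snd P) \<le> m * fst P + snd P"
      using m that by (auto simp: algebra_simps intro: mult_left_le_one_le)
    also have "\<dots> \<le> m * 1" using that p m by (intro order_trans[OF that(2)] mult_left_mono) auto
    finally show ?thesis using m by simp
  qed
  have "{P. m * fst P + snd P < m * p} \<in> sets borel" "{P. m * fst P + snd P \<le> m * p} \<in> sets borel"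
    by (intro borel_open borel_closed open_Collect_less closed_Collect_le continuous_intros)+
  then have "{P \<in> unit_tri. m * fst P + snd P < m * p} \<in> sets borel" "{P \<in> unit_tri. m * fst P + snd P \<le> m * p} \<in> sets borel"
    using unit_tri_borel by (auto simp: Collect_conj_eq)
  then show ?A ?B
    by (intro has_moments_corner m p; use sub in \<open>force simp: unit_tri_def\<close>)+
qed

lemma has_moments_lower_empty:
  assumes "0 < m" "t \<le> 0"
  shows "has_moments {P \<in> unit_tri. m * fst P + snd P < t} 0 0 0 0 0 0"
proof -
  have "0 \<le> m * fst P + snd P" if "P \<in> unit_tri" for P
    using that assms by (auto simp: unit_tri_def)
  then have eq: "{P \<in> unit_tri. m * fst P + snd P < t} = {}" using assms by fastforce
  show ?thesis unfolding eq by (rule has_moments_empty)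
qed

lemma has_moments_upper_empty:
  assumes "0 < m" "m < 1" "1 \<le> t"
  shows "has_moments {P \<in> unit_tri. m * fst P + snd P > t} 0 0 0 0 0 0"
proof -
  have "m * fst P + snd P \<le> 1" if "P \<in> unit_tri" for P
  proof -
    have "m * fst P \<le> fst P" using that assms by (auto simp: unit_tri_def intro: mult_left_le_one_le)
    then show ?thesis using that by (auto simp: unit_tri_def)
  qed
  then have eq: "{P \<in> unit_tri. m * fst P + snd P > t} = {}" using assms by fastforce
  show ?thesis unfolding eq by (rule has_moments_empty)
qed

text \<open>With \<open>m = 1 - n\<close> the involution of the triangle turns
  \<open>m x + y\<close> into \<open>1 - (n x + y)\<close>. The piece at the vertex
  \<open>(0, 1)\<close> thus becomes the corner of relative size \<open>q\<close> at the origin, for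
  the slope \<open>n\<close>.\<close>

lemma has_moments_upper:
  assumes n: "0 < n" "n < 1" and q: "0 < q" "q \<le> 1"
  shows "has_moments {P \<in> unit_tri. (1 - n) * fst P + snd P > 1 - n * q}
     (n * q ^ 2 / 2) (n * q ^ 3 / 6) (n * q ^ 2 / 2 - n * q ^ 3 / 6 - n ^ 2 * q ^ 3 / 6) (n * q ^ 4 / 12)
     (n * q ^ 3 / 6 - n * q ^ 4 / 12 - n ^ 2 * q ^ 4 / 24)
     (n * q ^ 2 / 2 + n * q ^ 4 / 12 + n ^ 3 * q ^ 4 / 12 - 2 * (n * q ^ 3 / 6) - 2 * (n ^ 2 * q ^ 3 / 6) + 2 * (n ^ 2 * q ^ 4 / 24))"
proof -
  have "{P \<in> unit_tri. (1 - n) * fst P + snd P > 1 - n * q}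
    = {P. (fst P, 1 - fst P - snd P) \<in> {P \<in> unit_tri. n * fst P + snd P < n * q}}"
    by (auto simp: unit_tri_def algebra_simps)
  then show ?thesis
    using has_moments_reflect[OF has_moments_lower(1)[OF n q]] by simp
qed

text \<open>For a level up to \<open>m\<close>, that of the vertex \<open>(1, 0)\<close>, the upper
  piece is what remains of the triangle outside a corner at the origin.\<close>

lemma has_moments_upper_small:
  assumes m: "0 < m" "m < 1" and p: "0 < p" "p \<le> 1"
  shows "has_moments {P \<in> unit_tri. m * fst P + snd P > m * p} (1/2 - m * p ^ 2 / 2) (1/6 - m * p ^ 3 / 6) (1/6 - m ^ 2 * p ^ 3 / 6) (1/12 - m * p ^ 4 / 12) (1/24 - m ^ 2 * p ^ 4 / 24) (1/12 - m ^ 3 * p ^ 4 / 12)"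
proof -
  have "{P \<in> unit_tri. m * fst P + snd P > m * p} = unit_tri - {P \<in> unit_tri. m * fst P + snd P \<le> m * p}"
    by auto
  then show ?thesis
    using has_moments_diff[OF has_moments_unit_tri has_moments_lower(2)[OF m p]] by simp
qed

text \<open>
  \<open>Psi\<close> at the heights \<open>-t/k\<close>, \<open>(m - t)/k\<close>, \<open>(1 - t)/k\<close> with \<open>k = t' - t\<close>; the factor \<open>1/k\<^sup>4\<close> is the Jacobian of
  this parametrization of increasing triples. The plane meets the prism over \<open>t \<le> m x + y \<le> t'\<close>.
\<close>
definition dens :: "real \<Rightarrow> real \<Rightarrow> real \<Rightarrow> ennreal" where
  "dens m t t' = (if t < t' then ennreal (1 / (t' - t) ^ 4) *
      Psi (- t / (t' - t)) ((m - t) / (t' - t)) ((1 - t) / (t' - t)) else 0)"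

lemma measurable_dens [measurable (raw)]:
  assumes [measurable]: "m \<in> borel_measurable M" "t \<in> borel_measurable M" "t' \<in> borel_measurable M"
  shows "(\<lambda>x. dens (m x) (t x) (t' x)) \<in> borel_measurable M"
  unfolding dens_def by measurable

text \<open>Turning the prism over reverses the order of the heights, and exchanging the lowest and
  the highest vertex sorts them again. On the parameters this acts as \<open>m\<close> to
  \<open>1 - m\<close>, with the two lines trading places.\<close>

lemma dens_reflect: "dens (1 - m) (1 - t') (1 - t) = dens m t t'"
proof (cases "t < t'")
  case True
  define k where "k = t' - t"
  have k: "k \<noteq> 0" using True by (simp add: k_def)
  have "Psi (- (1 - t') / k) ((1 - m - (1 - t')) / k) ((1 - (1 - t')) / k)
     = Psi (1 - (1 - t) / k) (1 - (m - t) / k) (1 - (- t) / k)"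
    using k by (intro arg_cong3[where f = Psi]) (auto simp: field_simps k_def)
  also have "\<dots> = Psi (- t / k) ((m - t) / k) ((1 - t) / k)"
    by (simp only: Psi_flip Psi_reflect)
  finally show ?thesis using True by (simp add: dens_def k_def)
qed (simp add: dens_def)

text \<open>Of the six powers of \<open>t' - t\<close>, four come from the Jacobian in
  \<open>dens\<close> and two from the mean gap.\<close>

lemma dens_eval:
  assumes k: "t < t'"
    and C: "has_moments {P \<in> unit_tri. m * fst P + snd P < t} c0 cx cy cxx cxy cyy"
    and E: "has_moments {P \<in> unit_tri. m * fst P + snd P > t'} e0 ex ey exx exy eyy"
    and D: "D = det_mom (1/2 - c0 - e0) (1/6 - cx - ex) (1/6 - cy - ey) (1/12 - cxx - exx) (1/24 - cxy - exy) (1/12 - cyy - eyy)"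
    and W: "W = (m\<^sup>2 + m + 1) / 12 - (t + t') * (1 + m) / 6 + t * t' / 2 + (t' - t)\<^sup>2 / 4
      - gap_mom m t c0 cx cy cxx cxy cyy - gap_mom m t' e0 ex ey exx exy eyy"
  shows "dens m t t' = ennreal (6 * D * W / (t' - t) ^ 6)" and "0 \<le> D" and "0 \<le> W"
proof -
  note P = Psi_eval[OF k C E, folded D W]
  show "0 \<le> D" "0 \<le> W" by (rule P)+
  define v where "v = t' - t"
  have v: "0 < v" using k by (simp add: v_def)
  have "dens m t t' = ennreal (1 / v ^ 4) * ennreal (6 * D * W / v\<^sup>2)"
    by (simp only: dens_def k if_True P(1) v_def)
  also have "\<dots> = ennreal (6 * D * W / v ^ 6)"
    using v by (simp add: ennreal_mult'[symmetric] field_simps power_numeral_reduce)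
  finally show "dens m t t' = ennreal (6 * D * W / (t' - t) ^ 6)" by (simp add: v_def)
qed

text \<open>For \<open>t < 0\<close> the plane stays above the floor over the whole triangle. The
  shadow, hence the determinant, does not depend on \<open>t\<close>, and the gap is a quadratic
  polynomial in \<open>T - t\<close>, as \<open>nn_integral_ray\<close> requires.\<close>

lemma nn_integral_dens_ray:
  assumes m: "0 < m" and T: "0 < T"
    and E: "has_moments {P \<in> unit_tri. m * fst P + snd P > T} e0 ex ey exx exy eyy"
    and V: "V = 6 * det_mom (1/2 - e0) (1/6 - ex) (1/6 - ey) (1/12 - exx) (1/24 - exy) (1/12 - eyy) *
       (((m\<^sup>2 + m + 1) / 12 - T * (1 + m) / 3 + T\<^sup>2 / 2 - gap_mom m T e0 ex ey exx exy eyy) / (5 * T ^ 5)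
        + ((1 + m) / 6 - T / 2) / (4 * T ^ 4) + 1 / (12 * T ^ 3))"
  shows "(\<integral>\<^sup>+t. indicator {..<0} t * dens m t T \<partial>lborel) = ennreal V" and "0 \<le> V"
proof -
  define D where "D = det_mom (1/2 - e0) (1/6 - ex) (1/6 - ey) (1/12 - exx) (1/24 - exy) (1/12 - eyy)"
  define a where "a = (m\<^sup>2 + m + 1) / 12 - T * (1 + m) / 3 + T\<^sup>2 / 2 - gap_mom m T e0 ex ey exx exy eyy"
  define b where "b = (1 + m) / 6 - T / 2"
  have W: "(m\<^sup>2 + m + 1) / 12 - (t + T) * (1 + m) / 6 + t * T / 2 + (T - t)\<^sup>2 / 4
      - gap_mom m t 0 0 0 0 0 0 - gap_mom m T e0 ex ey exx exy eyy = a + b * (T - t) + 1 / 4 * (T - t)\<^sup>2" for t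
    by (simp add: a_def b_def gap_mom_def power2_eq_square field_simps)
  have d: "dens m t T = ennreal (6 * D * (a + b * (T - t) + 1 / 4 * (T - t)\<^sup>2) / (T - t) ^ 6)"
    and nn: "0 \<le> 6 * D * (a + b * (T - t) + 1 / 4 * (T - t)\<^sup>2)" if "t < 0" for t
  proof -
    have less: "t < T" using that T by simp
    note * = dens_eval[OF less has_moments_lower_empty[OF m] E refl refl, unfolded W]
    show "dens m t T = ennreal (6 * D * (a + b * (T - t) + 1 / 4 * (T - t)\<^sup>2) / (T - t) ^ 6)"
      using *(1) that by (simp add: D_def)
    show "0 \<le> 6 * D * (a + b * (T - t) + 1 / 4 * (T - t)\<^sup>2)"
      using *(2,3) that by (simp add: D_def)
  qed
  have "(\<integral>\<^sup>+t. indicator {..<0} t * dens m t T \<partial>lborel)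
     = (\<integral>\<^sup>+t. indicator {..<0} t * ennreal (6 * D * (a + b * (T - t) + 1 / 4 * (T - t)\<^sup>2) / (T - t) ^ 6) \<partial>lborel)"
    by (rule nn_integral_cong) (auto simp: indicator_def d)
  moreover have "V = 6 * D * (a / (5 * T ^ 5) + b / (4 * T ^ 4) + (1/4) / (3 * T ^ 3))"
    by (simp add: V D_def a_def b_def)
  ultimately show "(\<integral>\<^sup>+t. indicator {..<0} t * dens m t T \<partial>lborel) = ennreal V" "0 \<le> V"
    using nn_integral_ray[OF T nn] by auto
qed

section \<open>Shapes whose contribution is a polynomial in the slope\<close>

definition reg :: "real \<Rightarrow> real set \<Rightarrow> real set \<Rightarrow> ennreal" where
  "reg m A B = (\<integral>\<^sup>+t. \<integral>\<^sup>+t'. indicator A t * (indicator B t' * dens m t t') \<partial>lborel \<partial>lborel)"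

lemma reg_swap:
  assumes [measurable]: "A \<in> sets borel" "B \<in> sets borel"
  shows "reg m A B = (\<integral>\<^sup>+t'. indicator B t' * (\<integral>\<^sup>+t. indicator A t * dens m t t' \<partial>lborel) \<partial>lborel)"
proof -
  have "reg m A B = (\<integral>\<^sup>+t'. \<integral>\<^sup>+t. indicator B t' * (indicator A t * dens m t t') \<partial>lborel \<partial>lborel)"
    unfolding reg_def by (subst nn_integral_lborel_swap) (simp_all add: mult_ac)
  then show ?thesis by (simp add: nn_integral_cmult)
qed

text \<open>The plane meets all three vertical edges, and the shadow is the whole triangle.\<close>

lemma reg_all:
  assumes m: "0 < m" "m < 1"
  shows "reg m {..<0} {1<..} = ennreal ((m\<^sup>2 - m + 6) / 138240)"
proof -
  \<comment> \<open>\<open>1/576\<close> is six times the moment determinant \<open>1/3456\<close>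
    of the standard triangle.\<close>
  define f where "f T = (1/576) * ((m\<^sup>2 + m + 1) / 60 / T ^ 5 - (1 + m) / 40 / T ^ 4 + 7/120 / T ^ 3)" for T
  have V: "6 * det_mom (1/2 - 0) (1/6 - 0) (1/6 - 0) (1/12 - 0) (1/24 - 0) (1/12 - 0) *
       (((m\<^sup>2 + m + 1) / 12 - T * (1 + m) / 3 + T\<^sup>2 / 2 - gap_mom m T 0 0 0 0 0 0) / (5 * T ^ 5)
        + ((1 + m) / 6 - T / 2) / (4 * T ^ 4) + 1 / (12 * T ^ 3)) = f T" if "T > 0" for T
    using that by (simp add: f_def det_mom_def gap_mom_def field_simps power_numeral_reduce)
  have I: "(\<integral>\<^sup>+t. indicator {..<0} t * dens m t T \<partial>lborel) = ennreal (f T)" "0 \<le> f T" if "1 \<le> T" for T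
    using nn_integral_dens_ray[OF m(1) _ has_moments_upper_empty[OF m that], of "f T"] that V[of T] by auto
  define F where "F T = - (1/576) * ((m\<^sup>2 + m + 1) / 240 / T ^ 4 - (1 + m) / 120 / T ^ 3 + 7/240 / T ^ 2)" for T
  have D: "(F has_real_derivative f T) (at T)" if "1 \<le> T" for T
    using that unfolding F_def f_def by (auto intro!: derivative_eq_intros) (simp add: field_simps power_numeral_reduce)
  have lim0: "((\<lambda>s. x / s ^ k) \<longlongrightarrow> 0) at_top" if "0 < k" for x :: real and k :: nat
    using that by (intro tendsto_divide_0[OF tendsto_const] filterlim_at_top_imp_at_infinity filterlim_pow_at_top filterlim_ident)
  have "(F \<longlongrightarrow> - (1/576) * (0 - 0 + 0)) at_top"
    unfolding F_def by (intro tendsto_intros lim0) auto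
  then have lim: "(F \<longlongrightarrow> 0) at_top" by simp
  define g where "g T = max 0 (f T)" for T
  have [measurable]: "g \<in> borel_measurable borel"
    unfolding g_def f_def by measurable
  have g: "g T = f T" if "1 \<le> T" for T using I(2)[OF that] by (simp add: g_def)
  have "reg m {..<0} {1<..} = (\<integral>\<^sup>+T. indicator {1<..} T * (\<integral>\<^sup>+t. indicator {..<0} t * dens m t T \<partial>lborel) \<partial>lborel)"
    by (rule reg_swap) auto
  also have "\<dots> = (\<integral>\<^sup>+T. ennreal (g T) * indicator {1..} T \<partial>lborel)"
    by (rule nn_integral_cong_AE, use AE_lborel_singleton[of 1] in eventually_elim) (auto split: split_indicator simp: I g)
  also have "\<dots> = ennreal (0 - F 1)"
  proof (rule nn_integral_FTC_atLeast)
    show "g \<in> borel_measurable borel" by measurable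
    show "(F has_real_derivative g T) (at T)" if "1 \<le> T" for T
      using D[OF that] g[OF that] by simp
    show "0 \<le> g T" for T by (simp add: g_def)
  qed (rule lim)
  also have "0 - F 1 = (m\<^sup>2 - m + 6) / 138240"
    by (simp add: F_def field_simps)
  finally show ?thesis .
qed

text \<open>Only the vertical edge over the origin is met, and the shadow is the corner of relative
  size \<open>p = t' / m\<close>.\<close>

lemma reg_corner:
  assumes m: "0 < m" "m < 1"
  shows "reg m {..<0} {0<..<m} = ennreal (1/576 * (m ^ 4 / 600 + (1 + m) * m ^ 2 / 168 - m ^ 3 / 192))"
proof -
  define r where "r = 1 / m"
  have r: "r * m = 1" using m by (simp add: r_def)
  define f where "f T = (1/576) * (r ^ 6 / 60 * T ^ 9 + (1 + m) * r ^ 5 / 24 * T ^ 6 - r ^ 5 / 24 * T ^ 7)" for T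
  define F where "F T = (1/576) * (r ^ 6 / 600 * T ^ 10 + (1 + m) * r ^ 5 / 168 * T ^ 7 - r ^ 5 / 192 * T ^ 8)" for T
  have V: "6 * det_mom (1/2 - (1/2 - m * p ^ 2 / 2)) (1/6 - (1/6 - m * p ^ 3 / 6)) (1/6 - (1/6 - m ^ 2 * p ^ 3 / 6)) (1/12 - (1/12 - m * p ^ 4 / 12)) (1/24 - (1/24 - m ^ 2 * p ^ 4 / 24)) (1/12 - (1/12 - m ^ 3 * p ^ 4 / 12)) *
       (((m\<^sup>2 + m + 1) / 12 - m * p * (1 + m) / 3 + (m * p)\<^sup>2 / 2 - gap_mom m (m * p) (1/2 - m * p ^ 2 / 2) (1/6 - m * p ^ 3 / 6) (1/6 - m ^ 2 * p ^ 3 / 6) (1/12 - m * p ^ 4 / 12) (1/24 - m ^ 2 * p ^ 4 / 24) (1/12 - m ^ 3 * p ^ 4 / 12)) / (5 * (m * p) ^ 5)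
        + ((1 + m) / 6 - m * p / 2) / (4 * (m * p) ^ 4) + 1 / (12 * (m * p) ^ 3)) = f (m * p)" if "p > 0" for p
  proof -
    \<comment> \<open>Under a linear map the moment determinant scales with the fifth power of the
      Jacobian, here \<open>m p\<^sup>2\<close>: three factors from the masses, two from the
      coordinates.\<close>
    have 1: "det_mom (m * p ^ 2 / 2) (m * p ^ 3 / 6) (m ^ 2 * p ^ 3 / 6) (m * p ^ 4 / 12) (m ^ 2 * p ^ 4 / 24) (m ^ 3 * p ^ 4 / 12) = (m * p\<^sup>2) ^ 5 / 3456"
      by (simp add: det_mom_def field_simps power_numeral_reduce)
    \<comment> \<open>The squared distance from the line over the triangle, minus that over the
      upper piece, leaves its integral over the corner.\<close>
    have 2: "(m\<^sup>2 + m + 1) / 12 - m * p * (1 + m) / 3 + (m * p)\<^sup>2 / 2 - gap_mom m (m * p) (1/2 - m * p ^ 2 / 2) (1/6 - m * p ^ 3 / 6) (1/6 - m ^ 2 * p ^ 3 / 6) (1/12 - m * p ^ 4 / 12) (1/24 - m ^ 2 * p ^ 4 / 24) (1/12 - m ^ 3 * p ^ 4 / 12) = m ^ 3 * p ^ 4 / 12"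
      by (simp add: gap_mom_def field_simps power_numeral_reduce)
    show ?thesis unfolding 2 using that m
      by (simp add: 1 f_def r_def) (simp add: field_simps power_numeral_reduce)
  qed
  have I: "(\<integral>\<^sup>+t. indicator {..<0} t * dens m t T \<partial>lborel) = ennreal (f T)" "0 \<le> f T" if "0 < T" "T < m" for T
  proof -
    define p where "p = T / m"
    have p: "0 < p" "p \<le> 1" "T = m * p" using that m by (auto simp: p_def)
    show "(\<integral>\<^sup>+t. indicator {..<0} t * dens m t T \<partial>lborel) = ennreal (f T)" "0 \<le> f T"
      using nn_integral_dens_ray[OF m(1) that(1) has_moments_upper_small[OF m p(1,2), folded p(3)], of "f T"] V[OF p(1)] unfolding p(3) by auto
  qed
  have "reg m {..<0} {0<..<m} = (\<integral>\<^sup>+T. indicator {0<..<m} T * (\<integral>\<^sup>+t. indicator {..<0} t * dens m t T \<partial>lborel) \<partial>lborel)"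
    by (rule reg_swap) auto
  also have "\<dots> = (\<integral>\<^sup>+T. indicator {0<..<m} T * ennreal (f T) \<partial>lborel)"
    by (rule nn_integral_cong) (auto split: split_indicator simp: I)
  also have "\<dots> = ennreal (F m - F 0)"
    by (rule nn_integral_FTC_open)
       (use m I in \<open>auto simp: F_def f_def intro!: derivative_eq_intros continuous_intros\<close>)
  also have "F m - F 0 = 1/576 * (m ^ 4 / 600 + (1 + m) * m ^ 2 / 168 - m ^ 3 / 192)"
    using m by (simp add: F_def r_def field_simps power_numeral_reduce)
  finally show ?thesis .
qed

text \<open>The shadow is the difference of two homothetic corners with ratio
  \<open>y = t / t'\<close>. In this variable the determinant is divisible by
  \<open>(1 - y) ^ 5\<close> and the gap by \<open>1 - y\<close>, which cancels the sixth power in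
  the denominator and leaves a polynomial.\<close>

lemma reg_trapezoid:
  assumes m: "0 < m" "m < 1"
  shows "reg m {0<..<m} {0<..<m} = ennreal (1/576 * (49/6 * ((1 + m) * m\<^sup>2 / 42 - m ^ 3 / 16) + 244/105 * m ^ 3 / 32 + 28319/1260 * m ^ 4 / 120))"
proof -
  define r where "r = 1 / m"
  \<comment> \<open>The cofactor of \<open>(1 - y) ^ 5\<close> in the determinant of the trapezoid,
    relative to the determinant of the larger corner.\<close>
  define dl where "dl y = y ^ 5 + 5 * y ^ 4 + 6 * y ^ 3 + 6 * y ^ 2 + 5 * y + (1::real)" for y
  define g where "g T y = r ^ 5 * T ^ 6 / 576 * (dl y * ((1 + m) / 6 - T / 2 + T * (1 - y) / 4 + r * T ^ 3 * (1 + y + y\<^sup>2 + y ^ 3) / 12))" for T y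
  have dens: "ennreal T * dens m (T * y) T = ennreal (g T y)" "0 \<le> g T y" if T: "0 < T" "T < m" and y: "0 < y" "y < 1" for T y
  proof -
    define p where "p = T / m"
    have p: "0 < p" "p \<le> 1" and Tp: "T = m * p" using T m by (auto simp: p_def)
    have yp: "0 < p * y" "p * y \<le> 1" using p y by (auto intro: mult_le_one)
    have less: "m * (p * y) < m * p" using m p y by simp
    define D where "D = det_mom (1/2 - m * (p * y) ^ 2 / 2 - (1/2 - m * p ^ 2 / 2)) (1/6 - m * (p * y) ^ 3 / 6 - (1/6 - m * p ^ 3 / 6)) (1/6 - m ^ 2 * (p * y) ^ 3 / 6 - (1/6 - m ^ 2 * p ^ 3 / 6))
     (1/12 - m * (p * y) ^ 4 / 12 - (1/12 - m * p ^ 4 / 12)) (1/24 - m ^ 2 * (p * y) ^ 4 / 24 - (1/24 - m ^ 2 * p ^ 4 / 24)) (1/12 - m ^ 3 * (p * y) ^ 4 / 12 - (1/12 - m ^ 3 * p ^ 4 / 12))"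
    define W where "W = (m\<^sup>2 + m + 1) / 12 - (m * (p * y) + m * p) * (1 + m) / 6 + m * (p * y) * (m * p) / 2 + (m * p - m * (p * y))\<^sup>2 / 4
      - gap_mom m (m * (p * y)) (m * (p * y) ^ 2 / 2) (m * (p * y) ^ 3 / 6) (m ^ 2 * (p * y) ^ 3 / 6) (m * (p * y) ^ 4 / 12) (m ^ 2 * (p * y) ^ 4 / 24) (m ^ 3 * (p * y) ^ 4 / 12)
      - gap_mom m (m * p) (1/2 - m * p ^ 2 / 2) (1/6 - m * p ^ 3 / 6) (1/6 - m ^ 2 * p ^ 3 / 6) (1/12 - m * p ^ 4 / 12) (1/24 - m ^ 2 * p ^ 4 / 24) (1/12 - m ^ 3 * p ^ 4 / 12)"
    note * = dens_eval[OF less has_moments_lower(1)[OF m yp] has_moments_upper_small[OF m p] D_def W_def]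
    have D: "D = (m * p\<^sup>2) ^ 5 / 3456 * ((1 - y) ^ 5 * dl y)"
    proof -
      \<comment> \<open>By homogeneity the moments of the trapezoid of order 0, 1, 2 are those of
        the larger corner times \<open>1 - y\<^sup>2\<close>, \<open>1 - y ^ 3\<close>,
        \<open>1 - y ^ 4\<close>.\<close>
      have "D = (m * p\<^sup>2) ^ 5 / 3456 * (24 * ((1 - y\<^sup>2) * (2 * (1 - y ^ 4) * (2 * (1 - y ^ 4)) - (1 - y ^ 4)\<^sup>2) / 2
          - 4 * (1 - y ^ 3) / 3 * ((1 - y ^ 3) * (2 * (1 - y ^ 4)) - (1 - y ^ 4) * (1 - y ^ 3)) / 2
          + 4 * (1 - y ^ 3) / 3 * ((1 - y ^ 3) * (1 - y ^ 4) - 2 * (1 - y ^ 4) * (1 - y ^ 3)) / 2) / 4)"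
        unfolding D_def det_mom_def by (simp add: field_simps) algebra
      also have "24 * ((1 - y\<^sup>2) * (2 * (1 - y ^ 4) * (2 * (1 - y ^ 4)) - (1 - y ^ 4)\<^sup>2) / 2
          - 4 * (1 - y ^ 3) / 3 * ((1 - y ^ 3) * (2 * (1 - y ^ 4)) - (1 - y ^ 4) * (1 - y ^ 3)) / 2
          + 4 * (1 - y ^ 3) / 3 * ((1 - y ^ 3) * (1 - y ^ 4) - 2 * (1 - y ^ 4) * (1 - y ^ 3)) / 2) / 4 = (1 - y) ^ 5 * dl y"
        unfolding dl_def by (simp add: field_simps) algebra
      finally show ?thesis .
    qed
    have W: "W = m * p * (1 - y) * ((1 + m) / 6 - m * p / 2 + m * p * (1 - y) / 4 + (m * p) ^ 3 * (1 + y + y\<^sup>2 + y ^ 3) / (12 * m))"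
      using m unfolding W_def gap_mom_def by (simp add: field_simps) algebra
    have eq: "m * p * (6 * D * W / (m * p - m * (p * y)) ^ 6) = g (m * p) y"
    proof -
      define X where "X = (1 + m) / 6 - m * p / 2 + m * p * (1 - y) / 4 + r * (m * p) ^ 3 * (1 + y + y\<^sup>2 + y ^ 3) / 12"
      have W': "W = m * p * (1 - y) * X"
        unfolding W X_def r_def by simp
      have k: "m * p - m * (p * y) = m * p * (1 - y)" by (simp add: algebra_simps)
      have gen: "m * p * (6 * ((m * p\<^sup>2) ^ 5 / 3456 * (v ^ 5 * d)) * (m * p * v * X) / (m * p * v) ^ 6) = r ^ 5 * (m * p) ^ 6 / 576 * (d * X)"
        if "v \<noteq> 0" for v d
        using m p that by (simp add: r_def field_simps power_numeral_reduce)
      show ?thesis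
        unfolding D W' k g_def X_def[symmetric] using gen[of "1 - y" "dl y"] y by simp
    qed
    have "0 \<le> m * p * (6 * D * W / (m * p - m * (p * y)) ^ 6)"
      using *(2,3) m p less by simp
    then show "0 \<le> g T y" unfolding Tp eq .
    have "ennreal T * dens m (T * y) T = ennreal (m * p) * ennreal (6 * D * W / (m * p - m * (p * y)) ^ 6)"
      using *(1) by (simp add: Tp mult.assoc)
    also have "\<dots> = ennreal (g T y)"
      unfolding Tp eq[symmetric] using m p by (intro ennreal_mult'[symmetric]) simp
    finally show "ennreal T * dens m (T * y) T = ennreal (g T y)" .
  qed
  define G where "G T y = r ^ 5 * T ^ 6 / 576 * (((1 + m) / 6 - T / 2) * (y ^ 6 / 6 + y ^ 5 + 3/2 * y ^ 4 + 2 * y ^ 3 + 5/2 * y ^ 2 + y)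
    + T / 4 * (y + 2 * y ^ 2 + y ^ 3 / 3 - y ^ 5 / 5 - 2 / 3 * y ^ 6 - y ^ 7 / 7)
    + r * T ^ 3 / 12 * (y + 3 * y ^ 2 + 4 * y ^ 3 + 9/2 * y ^ 4 + 22/5 * y ^ 5 + 3 * y ^ 6 + 12/7 * y ^ 7 + 3/4 * y ^ 8 + y ^ 9 / 9))" for T y
  \<comment> \<open>The three constants are the integrals over \<open>0 < y < 1\<close> of
    \<open>dl y\<close>, \<open>dl y * (1 - y)\<close> and
    \<open>dl y * (1 + y + y\<^sup>2 + y ^ 3)\<close>.\<close>
  define f where "f T = r ^ 5 * T ^ 6 / 576 * (49/6 * ((1 + m) / 6 - T / 2) + 244/105 * T / 4 + 28319/1260 * r * T ^ 3 / 12)" for T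
  define F where "F T = r ^ 5 / 576 * (49/6 * ((1 + m) / 42 * T ^ 7 - T ^ 8 / 16) + 244/105 * T ^ 8 / 32 + 28319/1260 * r * T ^ 10 / 120)" for T
  have I: "(\<integral>\<^sup>+t. indicator {0<..<m} t * dens m t T \<partial>lborel) = ennreal (f T) \<and> 0 \<le> f T" if T: "0 < T" "T < m" for T
  proof -
    have "(\<integral>\<^sup>+t. indicator {0<..<m} t * dens m t T \<partial>lborel) = ennreal T * (\<integral>\<^sup>+y. indicator {0<..<m} (T * y) * dens m (T * y) T \<partial>lborel)"
      using T by (subst nn_integral_real_affine[of _ T 0]) auto
    also have "\<dots> = (\<integral>\<^sup>+y. ennreal T * (indicator {0<..<m} (T * y) * dens m (T * y) T) \<partial>lborel)"
      by (subst nn_integral_cmult) auto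
    also have "\<dots> = (\<integral>\<^sup>+y. indicator {0<..<1} y * ennreal (g T y) \<partial>lborel)"
    proof (rule nn_integral_cong)
      fix y :: real
      consider "y \<le> 0" | "0 < y" "y < 1" | "1 \<le> y" by linarith
      then show "ennreal T * (indicator {0<..<m} (T * y) * dens m (T * y) T) = indicator {0<..<1} y * ennreal (g T y)"
      proof cases
        case 1
        then show ?thesis using T by (auto simp: indicator_def mult_le_0_iff zero_less_mult_iff)
      next
        case 2
        have "T * y < T * 1" using T 2 by (intro mult_strict_left_mono) auto
        then have "T * y < m" using T by linarith
        with 2 show ?thesis using T dens(1)[OF T, of y] by (simp add: indicator_def)
      next
        case 3
        then have "\<not> T * y < T" using T by simp
        then show ?thesis using 3 by (simp add: dens_def)
      qed
    qed
    finally have 0: "(\<integral>\<^sup>+t. indicator {0<..<m} t * dens m t T \<partial>lborel) = (\<integral>\<^sup>+y. indicator {0<..<1} y * ennreal (g T y) \<partial>lborel)" .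
    have D: "(G T has_real_derivative g T y) (at y)" for y
    proof -
      define C where "C = r ^ 5 * T ^ 6 / 576"
      define a where "a = (1 + m) / 6 - T / 2"
      define e where "e = r * T ^ 3 / 12"
      have "G T = (\<lambda>y. C * (a * (y ^ 6 / 6 + y ^ 5 + 3/2 * y ^ 4 + 2 * y ^ 3 + 5/2 * y ^ 2 + y)
        + T / 4 * (y + 2 * y ^ 2 + y ^ 3 / 3 - y ^ 5 / 5 - 2 / 3 * y ^ 6 - y ^ 7 / 7)
        + e * (y + 3 * y ^ 2 + 4 * y ^ 3 + 9/2 * y ^ 4 + 22/5 * y ^ 5 + 3 * y ^ 6 + 12/7 * y ^ 7 + 3/4 * y ^ 8 + y ^ 9 / 9)))"
        by (simp add: fun_eq_iff G_def C_def a_def e_def)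
      moreover have "g T y = C * (dl y * (a + T * (1 - y) / 4 + e * (1 + y + y\<^sup>2 + y ^ 3)))"
        by (simp add: g_def C_def a_def e_def)
      moreover have "dl y * (a + T * (1 - y) / 4 + e * (1 + y + y\<^sup>2 + y ^ 3)) =
         a * (y ^ 5 + 5 * y ^ 4 + 6 * y ^ 3 + 6 * y ^ 2 + 5 * y + 1)
        + T / 4 * (1 + 4 * y + y ^ 2 - y ^ 4 - 4 * y ^ 5 - y ^ 6)
        + e * (1 + 6 * y + 12 * y ^ 2 + 18 * y ^ 3 + 22 * y ^ 4 + 18 * y ^ 5 + 12 * y ^ 6 + 6 * y ^ 7 + y ^ 8)"
        unfolding dl_def by (simp add: field_simps power_numeral_reduce)
      moreover have
        "((\<lambda>y. y ^ 6 / 6 + y ^ 5 + 3/2 * y ^ 4 + 2 * y ^ 3 + 5/2 * y ^ 2 + y) has_real_derivative y ^ 5 + 5 * y ^ 4 + 6 * y ^ 3 + 6 * y ^ 2 + 5 * y + 1) (at y)"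
        "((\<lambda>y. y + 2 * y ^ 2 + y ^ 3 / 3 - y ^ 5 / 5 - 2 / 3 * y ^ 6 - y ^ 7 / 7) has_real_derivative 1 + 4 * y + y ^ 2 - y ^ 4 - 4 * y ^ 5 - y ^ 6) (at y)"
        "((\<lambda>y. y + 3 * y ^ 2 + 4 * y ^ 3 + 9/2 * y ^ 4 + 22/5 * y ^ 5 + 3 * y ^ 6 + 12/7 * y ^ 7 + 3/4 * y ^ 8 + y ^ 9 / 9) has_real_derivative
          1 + 6 * y + 12 * y ^ 2 + 18 * y ^ 3 + 22 * y ^ 4 + 18 * y ^ 5 + 12 * y ^ 6 + 6 * y ^ 7 + y ^ 8) (at y)"
        by (auto intro!: derivative_eq_intros)
      ultimately show ?thesis
        by (simp only:) ((assumption | rule DERIV_cmult DERIV_add)+)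
    qed
    have c: "isCont (g T) y" for y
    proof -
      have "isCont (\<lambda>y. r ^ 5 * T ^ 6 / 576 * ((y ^ 5 + 5 * y ^ 4 + 6 * y ^ 3 + 6 * y ^ 2 + 5 * y + 1) *
         ((1 + m) / 6 - T / 2 + T * (1 - y) / 4 + r * T ^ 3 * (1 + y + y\<^sup>2 + y ^ 3) / 12))) y"
        by simp
      then show ?thesis by (simp only: g_def[abs_def] dl_def)
    qed
    have 1: "(\<integral>\<^sup>+t. indicator {0<..<m} t * dens m t T \<partial>lborel) = ennreal (G T 1 - G T 0)" "0 \<le> G T 1 - G T 0"
      unfolding 0 by (rule nn_integral_FTC_open[where f = "g T"]; use D c dens(2)[OF T] in simp)+
    moreover have "G T 1 - G T 0 = f T"
      by (simp add: G_def f_def mult.commute)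
    ultimately show ?thesis using 1 by simp
  qed
  have "reg m {0<..<m} {0<..<m} = (\<integral>\<^sup>+T. indicator {0<..<m} T * (\<integral>\<^sup>+t. indicator {0<..<m} t * dens m t T \<partial>lborel) \<partial>lborel)"
    by (rule reg_swap) auto
  also have "\<dots> = (\<integral>\<^sup>+T. indicator {0<..<m} T * ennreal (f T) \<partial>lborel)"
    by (rule nn_integral_cong) (auto split: split_indicator simp: I)
  also have "\<dots> = ennreal (F m - F 0)"
  proof (rule nn_integral_FTC_open)
    show "(F has_real_derivative f T) (at T)" for T
    proof -
      define C a b c where "C = r ^ 5 / 576" and "a = 49/6 * ((1 + m) / 42)"
        and "b = (244/105 / 32 - 49/6 / 16 :: real)" and "c = 28319/1260 * r / 120"
      have "F = (\<lambda>T. C * (a * T ^ 7 + b * T ^ 8 + c * T ^ 10))"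
        by (simp add: fun_eq_iff F_def C_def a_def b_def c_def field_simps)
      moreover have "f T = C * (7 * a * T ^ 6 + 8 * b * T ^ 7 + 10 * c * T ^ 9)"
        by (simp add: f_def C_def a_def b_def c_def field_simps power_numeral_reduce)
      moreover have "((\<lambda>T. C * (a * T ^ 7 + b * T ^ 8 + c * T ^ 10)) has_real_derivative C * (7 * a * T ^ 6 + 8 * b * T ^ 7 + 10 * c * T ^ 9)) (at T)"
        by (auto intro!: derivative_eq_intros)
      ultimately show ?thesis by simp
    qed
    show "isCont f T" for T
      unfolding f_def[abs_def] by simp
  qed (use m I in auto)
  also have "F m - F 0 = 1/576 * (49/6 * ((1 + m) * m\<^sup>2 / 42 - m ^ 3 / 16) + 244/105 * m ^ 3 / 32 + 28319/1260 * m ^ 4 / 120)"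
    using m by (simp add: F_def r_def field_simps power_numeral_reduce)
  finally show ?thesis .
qed

section \<open>A Beukers-type integral\<close>

lemma nn_integral_unit_power:
  "(\<integral>\<^sup>+x. indicator {0<..<1} x * ennreal (x ^ k) \<partial>lborel) = ennreal (1 / real (Suc k))"
proof -
  have "(\<integral>\<^sup>+x. indicator {0<..<1} x * ennreal (x ^ k) \<partial>lborel) = (\<integral>\<^sup>+x. ennreal (x ^ k) * indicator {0..1} x \<partial>lborel)"
  proof (rule nn_integral_cong_AE)
    have "AE x in lborel. x \<noteq> (0::real) \<and> x \<noteq> 1"
      using AE_lborel_singleton[of 0] AE_lborel_singleton[of 1] by eventually_elim auto
    then show "AE x in lborel. indicator {0<..<1} x * ennreal (x ^ k) = ennreal (x ^ k) * indicator {0..1} x"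
      by eventually_elim (auto simp: indicator_def)
  qed
  also have "\<dots> = ennreal (1 ^ Suc k / Suc k - 0 ^ Suc k / Suc k)"
    by (rule nn_integral_FTC_Icc) (auto intro!: derivative_eq_intros simp del: power_Suc)
  finally show ?thesis by simp
qed

text \<open>Partial fractions: each term is \<open>1/k\<close> times the difference of two
  reciprocals at distance \<open>k\<close>. The sums \<open>f j\<close> over a window of
  \<open>k\<close> reciprocals telescope and tend to 0, and the value \<open>f 0\<close> is the
  harmonic number of \<open>k\<close> divided by \<open>k\<close>.\<close>

lemma inverse_telescope_sums:
  assumes "0 < k"
  shows "(\<lambda>j. 1 / (real (Suc (k + j)) * real (Suc j))) sums ((\<Sum>i<k. 1 / real (Suc i)) / k)"
proof -
  define f where "f j = (\<Sum>i<k. 1 / real (Suc (j + i))) / k" for j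
  have f: "f j - f (Suc j) = 1 / (real (Suc (k + j)) * real (Suc j))" for j
  proof -
    have "f j - f (Suc j) = (\<Sum>i<k. 1 / real (Suc (j + i)) - 1 / real (Suc (j + Suc i))) / k"
      by (simp add: f_def sum_subtractf diff_divide_distrib)
    also have "(\<Sum>i<k. 1 / real (Suc (j + i)) - 1 / real (Suc (j + Suc i))) = 1 / real (Suc j) - 1 / real (Suc (j + k))"
      by (subst sum_lessThan_telescope') simp
    also have "\<dots> / k = 1 / (real (Suc (k + j)) * real (Suc j))"
    proof -
      define a b where "a = real (Suc j)" and "b = real (Suc (k + j))"
      have "b = a + k" "0 < a" "0 < b" by (auto simp: a_def b_def)
      then have "(1 / a - 1 / b) / k = 1 / (b * a)"
        using assms by (simp add: diff_frac_eq)
      then show ?thesis by (simp add: a_def b_def add.commute)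
    qed
    finally show ?thesis .
  qed
  have "f \<longlonglongrightarrow> (\<Sum>i<k. 0) / k"
    unfolding f_def
  proof (intro tendsto_intros)
    fix i
    have "(\<lambda>j. 1 / real (Suc j)) \<longlonglongrightarrow> 0" by (rule lim_1_over_n[THEN LIMSEQ_Suc])
    from LIMSEQ_ignore_initial_segment[OF this, of i]
    show "(\<lambda>j. 1 / real (Suc (j + i))) \<longlonglongrightarrow> 0" by simp
  qed (use assms in auto)
  then have "f \<longlonglongrightarrow> 0" by simp
  from telescope_sums'[OF this] show ?thesis
    by (simp add: f) (simp add: f_def)
qed

text \<open>The geometric series in \<open>x y\<close> separates the variables, and nonnegativity
  justifies integration term by term. For \<open>k = 0\<close> the resulting series is
  \<open>\<zeta>(2)\<close>, for \<open>k > 0\<close> it is rational.\<close>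

lemma nn_integral_beukers:
  assumes "(\<lambda>j. 1 / (real (Suc (k + j)) * real (Suc j))) sums v"
  shows "(\<integral>\<^sup>+x. \<integral>\<^sup>+y. indicator {0<..<1} x * indicator {0<..<1} y * ennreal (x ^ k / (1 - x * y)) \<partial>lborel \<partial>lborel) = ennreal v"
proof -
  have eq: "indicator {0<..<1} x * indicator {0<..<1} y * ennreal (x ^ k / (1 - x * y))
     = (\<Sum>j. (indicator {0<..<1} x * ennreal (x ^ (k + j))) * (indicator {0<..<1} y * ennreal (y ^ j)))" for x y :: real
  proof (cases "x \<in> {0<..<1} \<and> y \<in> {0<..<1}")
    case True
    then have "x * y < 1 * 1" by (intro mult_strict_mono) auto
    then have "norm (x * y) < 1" using True by auto
    then have "(\<lambda>j. x ^ k * (x * y) ^ j) sums (x ^ k * (1 / (1 - x * y)))"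
      by (intro sums_mult geometric_sums)
    then have "(\<lambda>j. x ^ (k + j) * y ^ j) sums (x ^ k / (1 - x * y))"
      by (simp add: power_add power_mult_distrib mult.assoc)
    then have "(\<Sum>j. ennreal (x ^ (k + j) * y ^ j)) = ennreal (x ^ k / (1 - x * y))"
      using True by (subst suminf_ennreal_eq) auto
    then show ?thesis using True by (simp add: ennreal_mult[symmetric])
  next
    case False
    then show ?thesis by (auto simp: indicator_def)
  qed
  have "(\<integral>\<^sup>+x. \<integral>\<^sup>+y. indicator {0<..<1} x * indicator {0<..<1} y * ennreal (x ^ k / (1 - x * y)) \<partial>lborel \<partial>lborel)
     = (\<integral>\<^sup>+x. (\<Sum>j. indicator {0<..<1} x * ennreal (x ^ (k + j)) * ennreal (1 / real (Suc j))) \<partial>lborel)"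
    unfolding eq by (subst nn_integral_suminf) (auto simp: nn_integral_cmult nn_integral_unit_power)
  also have "\<dots> = (\<Sum>j. ennreal (1 / real (Suc (k + j))) * ennreal (1 / real (Suc j)))"
    by (subst nn_integral_suminf) (auto simp: nn_integral_multc nn_integral_unit_power)
  also have "\<dots> = (\<Sum>j. ennreal (1 / (real (Suc (k + j)) * real (Suc j))))"
    by (subst ennreal_mult[symmetric]) auto
  also have "\<dots> = ennreal v"
    using assms by (intro suminf_ennreal_eq) auto
  finally show ?thesis .
qed

definition unit_sq :: "(real \<times> real) set" where
  "unit_sq = {P. 0 < fst P \<and> fst P < 1 \<and> 0 < snd P \<and> snd P < 1}"

lemma unit_sq_borel [measurable]: "unit_sq \<in> sets borel"
  unfolding unit_sq_def
  by (intro borel_open open_Collect_conj open_Collect_less continuous_intros)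

text \<open>Bochner integrals admit the signed combination in \<open>tail_num\<close>. The second
  part is the first with the variables exchanged.\<close>

lemma has_bochner_integral_beukers:
  assumes "(\<lambda>j. 1 / (real (Suc (k + j)) * real (Suc j))) sums v"
  shows "has_bochner_integral lborel (\<lambda>P. indicator unit_sq P * ((fst P) ^ k / (1 - fst P * snd P))) v"
    and "has_bochner_integral lborel (\<lambda>P. indicator unit_sq P * ((snd P) ^ k / (1 - fst P * snd P))) v"
proof -
  have v: "0 \<le> v" using assms by (rule sums_le[OF _ sums_zero, rotated]) auto
  have less: "x * y < 1" if "0 < x" "x < 1" "0 < y" "y < 1" for x y :: real
    using mult_strict_mono[of x 1 y 1] that by auto
  have nn: "AE P in lborel. 0 \<le> indicator unit_sq P * ((fst P) ^ k / (1 - fst P * snd P))"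
    "AE P in lborel. 0 \<le> indicator unit_sq P * ((snd P) ^ k / (1 - fst P * snd P))"
    by (intro AE_I2; auto simp: indicator_def unit_sq_def intro!: divide_nonneg_nonneg less_imp_le[OF less])+
  have ind: "ennreal (indicator unit_sq (x, y) * t) = indicator {0<..<1} x * indicator {0<..<1} y * ennreal t" for x y t
    by (auto simp: unit_sq_def indicator_def)
  have "(\<integral>\<^sup>+P. ennreal (indicator unit_sq P * ((fst P) ^ k / (1 - fst P * snd P))) \<partial>lborel) = ennreal v"
    by (subst nn_integral_lborel_pair, measurable) (simp only: ind fst_conv snd_conv nn_integral_beukers[OF assms])
  then show "has_bochner_integral lborel (\<lambda>P. indicator unit_sq P * ((fst P) ^ k / (1 - fst P * snd P))) v"
    using nn(1) v by (intro has_bochner_integral_nn_integral) auto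
  have "(\<integral>\<^sup>+P. ennreal (indicator unit_sq P * ((snd P) ^ k / (1 - fst P * snd P))) \<partial>lborel)
    = (\<integral>\<^sup>+x. \<integral>\<^sup>+y. indicator {0<..<1} x * indicator {0<..<1} y * ennreal (y ^ k / (1 - x * y)) \<partial>lborel \<partial>lborel)"
    by (subst nn_integral_lborel_pair, measurable) (simp only: ind fst_conv snd_conv)
  also have "\<dots> = (\<integral>\<^sup>+y. \<integral>\<^sup>+x. indicator {0<..<1} x * indicator {0<..<1} y * ennreal (y ^ k / (1 - x * y)) \<partial>lborel \<partial>lborel)"
    by (rule lborel_pair.Fubini') simp
  also have "\<dots> = ennreal v"
    using nn_integral_beukers[OF assms] by (simp add: mult_ac)
  finally have "(\<integral>\<^sup>+P. ennreal (indicator unit_sq P * ((snd P) ^ k / (1 - fst P * snd P))) \<partial>lborel) = ennreal v" .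
  then show "has_bochner_integral lborel (\<lambda>P. indicator unit_sq P * ((snd P) ^ k / (1 - fst P * snd P))) v"
    using nn(2) v by (intro has_bochner_integral_nn_integral) auto
qed

lemma beukers_sums:
  "(\<lambda>j. 1 / (real (Suc (0 + j)) * real (Suc j))) sums (pi\<^sup>2 / 6)"
  "(\<lambda>j. 1 / (real (Suc (1 + j)) * real (Suc j))) sums 1"
  "(\<lambda>j. 1 / (real (Suc (2 + j)) * real (Suc j))) sums (3/4)"
  "(\<lambda>j. 1 / (real (Suc (3 + j)) * real (Suc j))) sums (11/18)"
  "(\<lambda>j. 1 / (real (Suc (4 + j)) * real (Suc j))) sums (25/48)"
proof -
  show "(\<lambda>j. 1 / (real (Suc (0 + j)) * real (Suc j))) sums (pi\<^sup>2 / 6)"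
    using inverse_squares_sums by (simp add: power2_eq_square algebra_simps)
qed (use inverse_telescope_sums[of 1] inverse_telescope_sums[of 2]
    inverse_telescope_sums[of 3] inverse_telescope_sums[of 4] in
    \<open>simp_all add: add.commute eval_nat_numeral\<close>)

text \<open>Modulo \<open>1 - n s\<close> every monomial reduces to a power of \<open>n\<close>
  alone or of \<open>s\<close> alone, so the remainder of the Hermite reduction can be given this
  form, which the Beukers integrals cover. Only its constant term \<open>-960\<close> meets
  \<open>\<zeta>(2)\<close>; it is the source of \<open>\<pi>\<close> in the result.\<close>

definition tail_num :: "real \<Rightarrow> real \<Rightarrow> real" where
  "tail_num n s = -17280 * n^4 + 25920 * n^3 - 37680 * n^2 + 14520 * n - 181440 * s^4 + 485880 * s^3 - 495120 * s^2 + 206160 * s - 960"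

lemma has_bochner_integral_tail:
  "has_bochner_integral lborel (\<lambda>P. indicator unit_sq P * (tail_num (fst P) (snd P) / (1 - fst P * snd P)))
     (91040/3 - 160 * pi\<^sup>2)"
proof -
  note I = beukers_sums[THEN has_bochner_integral_beukers(1)] beukers_sums[THEN has_bochner_integral_beukers(2)]
  let ?x = "\<lambda>k P. indicator unit_sq P * ((fst P) ^ k / (1 - fst P * snd P))"
  let ?y = "\<lambda>k P. indicator unit_sq P * ((snd P) ^ k / (1 - fst P * snd P))"
  have "has_bochner_integral lborel (\<lambda>P. (-960) * ?x 0 P + (206160) * ?y 1 P + (-495120) * ?y 2 P + (485880) * ?y 3 P + (-181440) * ?y 4 P + (14520) * ?x 1 P + (-37680) * ?x 2 P + (25920) * ?x 3 P + (-17280) * ?x 4 P) ((-960) * (pi\<^sup>2 / 6) + (206160) * 1 + (-495120) * (3/4) + (485880) * (11/18) + (-181440) * (25/48) + (14520) * 1 + (-37680) * (3/4) + (25920) * (11/18) + (-17280) * (25/48))"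
    by (intro has_bochner_integral_add has_bochner_integral_mult_right I)
  moreover have "(\<lambda>P. (-960) * ?x 0 P + (206160) * ?y 1 P + (-495120) * ?y 2 P + (485880) * ?y 3 P + (-181440) * ?y 4 P + (14520) * ?x 1 P + (-37680) * ?x 2 P + (25920) * ?x 3 P + (-17280) * ?x 4 P) = (\<lambda>P. indicator unit_sq P * (tail_num (fst P) (snd P) / (1 - fst P * snd P)))"
    by (simp add: fun_eq_iff tail_num_def diff_divide_distrib add_divide_distrib algebra_simps)
  ultimately show ?thesis by simp
qed

text \<open>
  The common numerator of the quadrilateral and pentagon contributions, see \<open>quad_pent_sum\<close>.
  Hermite reduction in \<open>s\<close> (\<open>beukers_num_split\<close>) writes \<open>10 beukers_num / (1 - n s)\<^sup>6\<close> as
  the derivative of \<open>prim_num / (1 - n s)\<^sup>5 + prim_poly\<close> plus \<open>tail_num / (1 - n s)\<close>; the pole of the boundary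
  term at \<open>n = 1\<close> cancels (\<open>prim_num_1\<close>).
\<close>
definition beukers_num :: "real \<Rightarrow> real \<Rightarrow> real" where
  "beukers_num n s = -504 * n^10 * s^15 - 252 * n^10 * s^14 - 392 * n^10 * s^13 - 574 * n^10 * s^12 - 816 * n^10 * s^11 - 1144 * n^10 * s^10 - 1584 * n^10 * s^9 - 2136 * n^10 * s^8 - 2688 * n^10 * s^7 - 2688 * n^10 * s^6 + 756 * n^9 * s^14 + 6692 * n^9 * s^13 - 497 * n^9 * s^12 + 5748 * n^9 * s^11 + 6298 * n^9 * s^10 + 9188 * n^9 * s^9 + 13128 * n^9 * s^8 + 18048 * n^9 * s^7 + 22368 * n^9 * s^6 + 17856 * n^9 * s^5 - 336 * n^9 * s^4 + 672 * n^9 * s^3 - 16065 * n^8 * s^12 - 16656 * n^8 * s^11 - 2489 * n^8 * s^10 - 32838 * n^8 * s^9 - 30972 * n^8 * s^8 - 51120 * n^8 * s^7 - 69552 * n^8 * s^6 - 80352 * n^8 * s^5 - 49264 * n^8 * s^4 - 768 * n^8 * s^3 - 2256 * n^8 * s^2 + 13236 * n^7 * s^11 + 65710 * n^7 * s^10 - 12596 * n^7 * s^9 + 75522 * n^7 * s^8 + 72368 * n^7 * s^7 + 121068 * n^7 * s^6 + 161688 * n^7 * s^5 + 161316 * n^7 * s^4 + 75824 * n^7 * s^3 + 5208 * n^7 * s^2 + 2544 * n^7 * s - 5879 * n^6 * s^10 - 95982 * n^6 * s^9 - 2139 * n^6 * s^8 - 77064 * n^6 * s^7 - 137954 * n^6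 * s^6 - 189924 * n^6 * s^5 - 250558 * n^6 * s^4 - 198592 * n^6 * s^3 - 71868 * n^6 * s^2 - 6984 * n^6 * s - 960 * n^6 + 87213 * n^5 * s^8 + 19968 * n^5 * s^7 + 45732 * n^5 * s^6 + 173124 * n^5 * s^5 + 220631 * n^5 * s^4 + 263724 * n^5 * s^3 + 154422 * n^5 * s^2 + 40684 * n^5 * s + 2880 * n^5 - 41504 * n^4 * s^7 - 44082 * n^4 * s^6 + 21588 * n^4 * s^5 - 165403 * n^4 * s^4 - 182608 * n^4 * s^3 - 188529 * n^4 * s^2 - 71502 * n^4 * s - 10796 * n^4 + 11180 * n^3 * s^6 + 27816 * n^3 * s^5 - 28558 * n^3 * s^4 + 80844 * n^3 * s^3 + 125754 * n^3 * s^2 + 75820 * n^3 * s + 17296 * n^3 - 12820 * n^2 * s^4 + 21888 * n^2 * s^3 - 31803 * n^2 * s^2 - 44846 * n^2 * s - 17577 * n^2 + 10669 * n"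

definition prim_num :: "real \<Rightarrow> real \<Rightarrow> real" where
  "prim_num n s = (-9600 * n^6 + 28800 * n^5 - 107960 * n^4 + 172960 * n^3 - 175770 * n^2 + 106690 * n) * s^1
      + (31920 * n^7 - 92520 * n^6 + 419340 * n^5 - 703430 * n^4 + 730640 * n^3 - 437610 * n^2) * s^2
      + (-39440 * n^8 + 109880 * n^7 - 658900 * n^6 + 1218170 * n^5 - 1359070 * n^4 + 856790 * n^3 - 106010 * n^2) * s^3
      + (21400 * n^9 - 56860 * n^8 + 519010 * n^7 - 1105565 * n^6 + 1338845 * n^5 - 884915 * n^4 + 255115 * n^3 + 54720 * n^2) * s^4
      + (-4280 * n^10 + 10700 * n^9 - 202330 * n^8 + 543745 * n^7 - 768885 * n^6 + 618245 * n^5 - 381829 * n^4 - 68060 * n^3 - 25640 * n^2) * s^5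
      + (59520 * n^9 - 267840 * n^8 + 538960 * n^7 - 633080 * n^6 + 577080 * n^5 + 71960 * n^4 + 92720 * n^3) * s^6
      + (-145920 * n^10 + 759360 * n^9 - 1773440 * n^8 + 2476840 * n^7 - 2533700 * n^6 + 313400 * n^5 - 626260 * n^4 + 111800 * n^3) * s^7
      + (287520 * n^11 - 1727280 * n^10 + 4682260 * n^9 - 7700690 * n^8 + 8694020 * n^7 - 3486010 * n^6 + 2393330 * n^5 - 1532660 * n^4) * s^8
      + (-281760 * n^12 + 2121840 * n^11 - 7113460 * n^10 + 14410010 * n^9 - 18627020 * n^8 + 15420790 * n^7 - 4915160 * n^6 + 10600070 * n^5) * s^9
      + (137856 * n^13 - 1459584 * n^12 + 6524336 * n^11 - 17061904 * n^10 + 26728368 * n^9 - 37967690 * n^8 + 4010444 * n^7 - 41755966 * n^6) * s^10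
      + (-26880 * n^14 + 532800 * n^13 - 3611200 * n^12 + 13068920 * n^11 - 26879120 * n^10 + 57385110 * n^9 + 2335990 * n^8 + 103732570 * n^7 - 1352170 * n^6) * s^11
      + (-80640 * n^14 + 1118160 * n^13 - 6333480 * n^12 + 18884610 * n^11 - 54930445 * n^10 - 4260775 * n^9 - 168723655 * n^8 + 10603755 * n^7) * s^12
      + (-149520 * n^14 + 1778280 * n^13 - 8794170 * n^12 + 33419225 * n^11 - 6257825 * n^10 + 178301865 * n^9 - 39005505 * n^8) * s^13
      + (-221760 * n^14 + 2407440 * n^13 - 12730480 * n^12 + 15913660 * n^11 - 116991280 * n^10 + 83569780 * n^9) * s^14
      + (-288288 * n^14 + 2923704 * n^13 - 12219060 * n^12 + 43422120 * n^11 - 109431756 * n^10 + 1009512 * n^9) * s^15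
      + (-342720 * n^14 + 3895080 * n^13 - 7950600 * n^12 + 86567670 * n^11 - 5045040 * n^10) * s^16
      + (-378840 * n^14 + 1191960 * n^13 - 38634750 * n^12 + 10090080 * n^11) * s^17
      + (-388080 * n^14 + 8038800 * n^13 - 10090080 * n^12) * s^18
      + (-360360 * n^14 + 5045040 * n^13) * s^19
      + (-1009008 * n^14) * s^20"

definition prim_num' :: "real \<Rightarrow> real \<Rightarrow> real" where
  "prim_num' n s = (-9600 * n^6 + 28800 * n^5 - 107960 * n^4 + 172960 * n^3 - 175770 * n^2 + 106690 * n)
      + 2 * (31920 * n^7 - 92520 * n^6 + 419340 * n^5 - 703430 * n^4 + 730640 * n^3 - 437610 * n^2) * s
      + 3 * (-39440 * n^8 + 109880 * n^7 - 658900 * n^6 + 1218170 * n^5 - 1359070 * n^4 + 856790 * n^3 - 106010 * n^2) * s^2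
      + 4 * (21400 * n^9 - 56860 * n^8 + 519010 * n^7 - 1105565 * n^6 + 1338845 * n^5 - 884915 * n^4 + 255115 * n^3 + 54720 * n^2) * s^3
      + 5 * (-4280 * n^10 + 10700 * n^9 - 202330 * n^8 + 543745 * n^7 - 768885 * n^6 + 618245 * n^5 - 381829 * n^4 - 68060 * n^3 - 25640 * n^2) * s^4
      + 6 * (59520 * n^9 - 267840 * n^8 + 538960 * n^7 - 633080 * n^6 + 577080 * n^5 + 71960 * n^4 + 92720 * n^3) * s^5
      + 7 * (-145920 * n^10 + 759360 * n^9 - 1773440 * n^8 + 2476840 * n^7 - 2533700 * n^6 + 313400 * n^5 - 626260 * n^4 + 111800 * n^3) * s^6
      + 8 * (287520 * n^11 - 1727280 * n^10 + 4682260 * n^9 - 7700690 * n^8 + 8694020 * n^7 - 3486010 * n^6 + 2393330 * n^5 - 1532660 * n^4) * s^7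
      + 9 * (-281760 * n^12 + 2121840 * n^11 - 7113460 * n^10 + 14410010 * n^9 - 18627020 * n^8 + 15420790 * n^7 - 4915160 * n^6 + 10600070 * n^5) * s^8
      + 10 * (137856 * n^13 - 1459584 * n^12 + 6524336 * n^11 - 17061904 * n^10 + 26728368 * n^9 - 37967690 * n^8 + 4010444 * n^7 - 41755966 * n^6) * s^9
      + 11 * (-26880 * n^14 + 532800 * n^13 - 3611200 * n^12 + 13068920 * n^11 - 26879120 * n^10 + 57385110 * n^9 + 2335990 * n^8 + 103732570 * n^7 - 1352170 * n^6) * s^10
      + 12 * (-80640 * n^14 + 1118160 * n^13 - 6333480 * n^12 + 18884610 * n^11 - 54930445 * n^10 - 4260775 * n^9 - 168723655 * n^8 + 10603755 * n^7) * s^11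
      + 13 * (-149520 * n^14 + 1778280 * n^13 - 8794170 * n^12 + 33419225 * n^11 - 6257825 * n^10 + 178301865 * n^9 - 39005505 * n^8) * s^12
      + 14 * (-221760 * n^14 + 2407440 * n^13 - 12730480 * n^12 + 15913660 * n^11 - 116991280 * n^10 + 83569780 * n^9) * s^13
      + 15 * (-288288 * n^14 + 2923704 * n^13 - 12219060 * n^12 + 43422120 * n^11 - 109431756 * n^10 + 1009512 * n^9) * s^14
      + 16 * (-342720 * n^14 + 3895080 * n^13 - 7950600 * n^12 + 86567670 * n^11 - 5045040 * n^10) * s^15
      + 17 * (-378840 * n^14 + 1191960 * n^13 - 38634750 * n^12 + 10090080 * n^11) * s^16
      + 18 * (-388080 * n^14 + 8038800 * n^13 - 10090080 * n^12) * s^17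
      + 19 * (-360360 * n^14 + 5045040 * n^13) * s^18
      + 20 * (-1009008 * n^14) * s^19"

definition prim_poly :: "real \<Rightarrow> real \<Rightarrow> real" where
  "prim_poly n s = (17280 * n^4 - 25920 * n^3 + 37680 * n^2 - 14520 * n + 960) * s^1
      + (8640 * n^5 - 12960 * n^4 + 18840 * n^3 - 7260 * n^2 + 480 * n - 103080) * s^2
      + (5760 * n^6 - 8640 * n^5 + 12560 * n^4 - 4840 * n^3 + 320 * n^2 - 68720 * n + 165040) * s^3
      + (4320 * n^7 - 6480 * n^6 + 9420 * n^5 - 3630 * n^4 + 240 * n^3 - 51540 * n^2 + 123780 * n - 121470) * s^4
      + (3456 * n^8 - 5184 * n^7 + 7536 * n^6 - 2904 * n^5 + 192 * n^4 - 41232 * n^3 + 99024 * n^2 - 97176 * n + 36288) * s^5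
      + (-26880 * n^9 + 129600 * n^8 - 263200 * n^7 + 314120 * n^6 - 288380 * n^5 - 70340 * n^4 + 36160 * n^3 - 80980 * n^2 + 30240 * n) * s^6
      + (-80640 * n^9 + 370560 * n^8 - 768480 * n^7 + 935280 * n^6 - 452280 * n^5 + 408840 * n^4 - 165240 * n^3 + 25920 * n^2) * s^7
      + (-149520 * n^9 + 669480 * n^8 - 1081290 * n^7 + 1627185 * n^6 - 166425 * n^5 + 944895 * n^4 + 22680 * n^3) * s^8
      + (-221760 * n^9 + 966000 * n^8 - 3252760 * n^7 - 14840 * n^6 - 4586680 * n^5 + 20160 * n^4) * s^9
      + (-288288 * n^9 + 1210104 * n^8 + 1573740 * n^7 + 7965720 * n^6 + 18144 * n^5) * s^10
      + (-342720 * n^9 + 2000880 * n^8 - 7812000 * n^7 + 1363320 * n^6) * s^11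
      + (-378840 * n^9 - 748440 * n^8 - 3846150 * n^7) * s^12
      + (-388080 * n^9 + 6237000 * n^8) * s^13
      + (-360360 * n^9) * s^14
      + (-1009008 * n^9) * s^15"

definition prim_poly' :: "real \<Rightarrow> real \<Rightarrow> real" where
  "prim_poly' n s = (17280 * n^4 - 25920 * n^3 + 37680 * n^2 - 14520 * n + 960)
      + 2 * (8640 * n^5 - 12960 * n^4 + 18840 * n^3 - 7260 * n^2 + 480 * n - 103080) * s
      + 3 * (5760 * n^6 - 8640 * n^5 + 12560 * n^4 - 4840 * n^3 + 320 * n^2 - 68720 * n + 165040) * s^2
      + 4 * (4320 * n^7 - 6480 * n^6 + 9420 * n^5 - 3630 * n^4 + 240 * n^3 - 51540 * n^2 + 123780 * n - 121470) * s^3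
      + 5 * (3456 * n^8 - 5184 * n^7 + 7536 * n^6 - 2904 * n^5 + 192 * n^4 - 41232 * n^3 + 99024 * n^2 - 97176 * n + 36288) * s^4
      + 6 * (-26880 * n^9 + 129600 * n^8 - 263200 * n^7 + 314120 * n^6 - 288380 * n^5 - 70340 * n^4 + 36160 * n^3 - 80980 * n^2 + 30240 * n) * s^5
      + 7 * (-80640 * n^9 + 370560 * n^8 - 768480 * n^7 + 935280 * n^6 - 452280 * n^5 + 408840 * n^4 - 165240 * n^3 + 25920 * n^2) * s^6
      + 8 * (-149520 * n^9 + 669480 * n^8 - 1081290 * n^7 + 1627185 * n^6 - 166425 * n^5 + 944895 * n^4 + 22680 * n^3) * s^7
      + 9 * (-221760 * n^9 + 966000 * n^8 - 3252760 * n^7 - 14840 * n^6 - 4586680 * n^5 + 20160 * n^4) * s^8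
      + 10 * (-288288 * n^9 + 1210104 * n^8 + 1573740 * n^7 + 7965720 * n^6 + 18144 * n^5) * s^9
      + 11 * (-342720 * n^9 + 2000880 * n^8 - 7812000 * n^7 + 1363320 * n^6) * s^10
      + 12 * (-378840 * n^9 - 748440 * n^8 - 3846150 * n^7) * s^11
      + 13 * (-388080 * n^9 + 6237000 * n^8) * s^12
      + 14 * (-360360 * n^9) * s^13
      + 15 * (-1009008 * n^9) * s^14"

text \<open>With indeterminate coefficients the derivative is computed once. For the primitives it
  follows by unification, without touching coefficients that are themselves polynomials in
  \<open>n\<close>.\<close>

lemma has_real_derivative_poly20:
  "((\<lambda>s. b1 * s^1 + b2 * s^2 + b3 * s^3 + b4 * s^4 + b5 * s^5 + b6 * s^6 + b7 * s^7 + b8 * s^8 + b9 * s^9 + b10 * s^10 + b11 * s^11 + b12 * s^12 + b13 * s^13 + b14 * s^14 + b15 * s^15 + b16 * s^16 + b17 * s^17 + b18 * s^18 + b19 * s^19 + b20 * s^20) has_real_derivative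
    b1 + 2 * b2 * s + 3 * b3 * s^2 + 4 * b4 * s^3 + 5 * b5 * s^4 + 6 * b6 * s^5 + 7 * b7 * s^6 + 8 * b8 * s^7 + 9 * b9 * s^8 + 10 * b10 * s^9 + 11 * b11 * s^10 + 12 * b12 * s^11 + 13 * b13 * s^12 + 14 * b14 * s^13 + 15 * b15 * s^14 + 16 * b16 * s^15 + 17 * b17 * s^16 + 18 * b18 * s^17 + 19 * b19 * s^18 + 20 * b20 * s^19) (at (s::real))"
  by (rule derivative_eq_intros refl)+ simp

lemma has_real_derivative_poly15:
  "((\<lambda>s. b1 * s^1 + b2 * s^2 + b3 * s^3 + b4 * s^4 + b5 * s^5 + b6 * s^6 + b7 * s^7 + b8 * s^8 + b9 * s^9 + b10 * s^10 + b11 * s^11 + b12 * s^12 + b13 * s^13 + b14 * s^14 + b15 * s^15) has_real_derivative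
    b1 + 2 * b2 * s + 3 * b3 * s^2 + 4 * b4 * s^3 + 5 * b5 * s^4 + 6 * b6 * s^5 + 7 * b7 * s^6 + 8 * b8 * s^7 + 9 * b9 * s^8 + 10 * b10 * s^9 + 11 * b11 * s^10 + 12 * b12 * s^11 + 13 * b13 * s^12 + 14 * b14 * s^13 + 15 * b15 * s^14) (at (s::real))"
  by (rule derivative_eq_intros refl)+ simp

lemma has_real_derivative_prim_num: "((\<lambda>s. prim_num n s) has_real_derivative prim_num' n s) (at s)"
  unfolding prim_num_def prim_num'_def by (rule has_real_derivative_poly20)

lemma has_real_derivative_prim_poly: "((\<lambda>s. prim_poly n s) has_real_derivative prim_poly' n s) (at s)"
  unfolding prim_poly_def prim_poly'_def by (rule has_real_derivative_poly15)

lemma beukers_num_split: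
  "prim_num' n s * (1 - n * s) + 5 * n * prim_num n s + prim_poly' n s * (1 - n * s) ^ 6
     + tail_num n s * (1 - n * s) ^ 5 - 10 * beukers_num n s = 0"
  unfolding prim_num'_def prim_num_def prim_poly'_def tail_num_def beukers_num_def by algebra

lemma prim_num_1:
  "prim_num n 1 + prim_poly n 1 * (1 - n) ^ 5 - (4280 * n^5 - 67842 * n^4 + 141453 * n^3 - 133696 * n^2 + 80774 * n - 22262) * (1 - n) ^ 5 = 0"
  unfolding prim_num_def prim_poly_def power_one mult_1_right by algebra

definition edge_prim :: "real \<Rightarrow> real" where
  "edge_prim n = 2140/3 * n^6 - 67842/5 * n^5 + 141453/4 * n^4 - 133696/3 * n^3 + 40387 * n^2 - 22262 * n"

definition edge_poly :: "real \<Rightarrow> real" where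
  "edge_poly n = 4280 * n^5 - 67842 * n^4 + 141453 * n^3 - 133696 * n^2 + 80774 * n - 22262"

text \<open>The boundary term \<open>edge_poly n\<close> and the numerator of the tail take both
  signs. The computation therefore uses Bochner integrals and returns to nonnegative ones for the
  sum alone, whose sign comes from the integrand.\<close>

lemma inner_integral:
  assumes n: "0 < n" "n < 1" and nn: "\<And>s. 0 < s \<Longrightarrow> s < 1 \<Longrightarrow> 0 \<le> beukers_num n s"
  defines "k \<equiv> (\<integral>s. indicator unit_sq (n, s) * (tail_num n s / (1 - n * s)) \<partial>lborel)"
  shows "(\<integral>\<^sup>+s. indicator {0<..<1} s * ennreal (beukers_num n s / (1 - n * s) ^ 6) \<partial>lborel) = ennreal ((edge_poly n + k) / 10)"
    and "0 \<le> edge_poly n + k"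
proof -
  have w: "0 < 1 - n * s" if "s \<in> {0..1}" for s
  proof -
    have "n * s \<le> n * 1" using n that by (intro mult_left_mono) auto
    then have "n * s \<le> n" by (simp only: mult_1_right)
    then show ?thesis using n by linarith
  qed
  define F where "F s = prim_num n s / (1 - n * s) ^ 5 + prim_poly n s" for s
  define f where "f s = (prim_num' n s * (1 - n * s) + 5 * n * prim_num n s) / (1 - n * s) ^ 6 + prim_poly' n s" for s
  have D: "(F has_real_derivative f s) (at s)" if "0 \<le> s" "s \<le> 1" for s
  proof -
    have w0: "1 - n * s \<noteq> 0" using w[of s] that by auto
    have "((\<lambda>s. (1 - n * s) ^ 5) has_real_derivative - 5 * n * (1 - n * s) ^ 4) (at s)"
      by (auto intro!: derivative_eq_intros)
    from DERIV_add[OF DERIV_divide[OF has_real_derivative_prim_num this] has_real_derivative_prim_poly]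
    have "(F has_real_derivative (prim_num' n s * (1 - n * s) ^ 5 - prim_num n s * (- 5 * n * (1 - n * s) ^ 4)) / ((1 - n * s) ^ 5 * (1 - n * s) ^ 5) + prim_poly' n s) (at s)"
      unfolding F_def using w0 by simp
    also have "(prim_num' n s * (1 - n * s) ^ 5 - prim_num n s * (- 5 * n * (1 - n * s) ^ 4)) / ((1 - n * s) ^ 5 * (1 - n * s) ^ 5)
      = (prim_num' n s * (1 - n * s) + 5 * n * prim_num n s) / (1 - n * s) ^ 6"
    proof -
      define v where "v = 1 - n * s"
      have "v \<noteq> 0" using w0 by (simp add: v_def)
      then have "(prim_num' n s * v ^ 5 - prim_num n s * (- 5 * n * v ^ 4)) / (v ^ 5 * v ^ 5) = (prim_num' n s * v + 5 * n * prim_num n s) / v ^ 6"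
        by (simp add: frac_eq_eq) algebra
      then show ?thesis by (simp add: v_def)
    qed
    finally show ?thesis by (simp add: f_def)
  qed
  have cont1: "continuous_on {0..1} (\<lambda>s. tail_num n s / (1 - n * s))"
    unfolding tail_num_def by (intro continuous_intros ballI) (use w in force)
  have cont2: "isCont f s" if "0 \<le> s" "s \<le> 1" for s
    unfolding f_def prim_num_def prim_num'_def prim_poly'_def
    by (intro continuous_intros) (use w[of s] that in force)
  have f_int: "has_bochner_integral lborel (\<lambda>s. f s * indicator {0..1} s) (F 1 - F 0)"
    using D cont2 by (intro has_bochner_integral_FTC_Icc_real) auto
  \<comment> \<open>Neither primitive has a constant term in \<open>s\<close>, so only the endpoint
    \<open>s = 1\<close> contributes.\<close>
  have F: "F 1 - F 0 = edge_poly n"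
    using prim_num_1[of n] n by (simp add: F_def edge_poly_def prim_num_def[of n 0] prim_poly_def[of n 0] field_simps)
  have open_closed: "AE s in lborel. s \<noteq> (0::real) \<and> s \<noteq> 1"
    using AE_lborel_singleton[of 0] AE_lborel_singleton[of 1] by eventually_elim auto
  have tI: "integrable lborel (\<lambda>s. tail_num n s / (1 - n * s) * indicator {0..1} s)"
    using borel_integrable_atLeastAtMost'[OF cont1] by (simp add: set_integrable_def mult.commute)
  have "(\<integral>s. tail_num n s / (1 - n * s) * indicator {0..1} s \<partial>lborel) = k"
    unfolding k_def
  proof (rule integral_cong_AE)
    show "AE s in lborel. tail_num n s / (1 - n * s) * indicator {0..1} s = indicator unit_sq (n, s) * (tail_num n s / (1 - n * s))"
      using open_closed by eventually_elim (use n in \<open>auto simp: unit_sq_def indicator_def\<close>)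
  qed (unfold tail_num_def, measurable)
  with f_int tI have I: "has_bochner_integral lborel (\<lambda>s. f s * indicator {0..1} s + tail_num n s / (1 - n * s) * indicator {0..1} s) (edge_poly n + k)"
    unfolding F by (intro has_bochner_integral_add) (auto simp: has_bochner_integral_iff)
  have split: "f s + tail_num n s / (1 - n * s) = 10 * (beukers_num n s / (1 - n * s) ^ 6)" if "s \<in> {0..1}" for s
  proof -
    have w0: "1 - n * s \<noteq> 0" using w[of s] that by auto
    define v where "v = 1 - n * s"
    have v: "v \<noteq> 0" using w0 by (simp add: v_def)
    have "f s + tail_num n s / v = (prim_num' n s * v + 5 * n * prim_num n s + prim_poly' n s * v ^ 6 + tail_num n s * v ^ 5) / v ^ 6"
      using v by (simp add: f_def v_def[symmetric] field_simps power_numeral_reduce)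
    also have "\<dots> = 10 * beukers_num n s / v ^ 6"
      using beukers_num_split[of n s] by (simp add: v_def)
    finally show ?thesis by (simp add: v_def)
  qed
  have AE: "AE s in lborel. f s * indicator {0..1} s + tail_num n s / (1 - n * s) * indicator {0..1} s
     = indicator {0<..<1} s * (10 * (beukers_num n s / (1 - n * s) ^ 6))"
    using open_closed
  proof eventually_elim
    case (elim s)
    then show ?case using split[of s] by (auto simp: indicator_def)
  qed
  have pos: "AE s in lborel. 0 \<le> f s * indicator {0..1} s + tail_num n s / (1 - n * s) * indicator {0..1} s"
    using AE
  proof eventually_elim
    case (elim s)
    show ?case unfolding elim using nn[of s] w[of s] by (auto simp: indicator_def)
  qed
  show k0: "0 \<le> edge_poly n + k"
    using I integral_nonneg_AE[OF pos] by (simp add: has_bochner_integral_iff)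
  have "ennreal (edge_poly n + k) = (\<integral>\<^sup>+s. ennreal (f s * indicator {0..1} s + tail_num n s / (1 - n * s) * indicator {0..1} s) \<partial>lborel)"
    using I pos by (subst nn_integral_eq_integral) (auto simp: has_bochner_integral_iff)
  also have "\<dots> = (\<integral>\<^sup>+s. 10 * (indicator {0<..<1} s * ennreal (beukers_num n s / (1 - n * s) ^ 6)) \<partial>lborel)"
  proof (rule nn_integral_cong_AE, use AE in eventually_elim)
    case (elim s)
    have "ennreal (10 * X) = 10 * ennreal X" for X
      by (simp add: ennreal_mult')
    then show ?case unfolding elim by (cases "s \<in> {0<..<1}") (simp_all only: simp_thms indicator_simps mult_1 mult_zero_left mult_zero_right ennreal_0)
  qed
  also have "\<dots> = 10 * (\<integral>\<^sup>+s. indicator {0<..<1} s * ennreal (beukers_num n s / (1 - n * s) ^ 6) \<partial>lborel)"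
    by (subst nn_integral_cmult) (auto simp: beukers_num_def)
  finally have "ennreal (1 / 10) * ennreal (edge_poly n + k) = (ennreal (1 / 10) * 10) * (\<integral>\<^sup>+s. indicator {0<..<1} s * ennreal (beukers_num n s / (1 - n * s) ^ 6) \<partial>lborel)"
    by (simp add: mult.assoc)
  also have "ennreal (1 / 10) * 10 = 1"
    by (simp flip: ennreal_numeral ennreal_mult ennreal_1)
  finally show "(\<integral>\<^sup>+s. indicator {0<..<1} s * ennreal (beukers_num n s / (1 - n * s) ^ 6) \<partial>lborel) = ennreal ((edge_poly n + k) / 10)"
    using k0 by (simp flip: ennreal_mult)
qed

text \<open>The value is a tenth of \<open>edge_prim 1 + 91040/3 - 160 * pi\<^sup>2\<close>, because
  the Hermite reduction is made for ten times the integrand.\<close>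

lemma nn_integral_beukers_num:
  assumes nn: "\<And>n s. 0 < n \<Longrightarrow> n < 1 \<Longrightarrow> 0 < s \<Longrightarrow> s < 1 \<Longrightarrow> 0 \<le> beukers_num n s"
  shows "(\<integral>\<^sup>+n. \<integral>\<^sup>+s. indicator {0<..<1} n * (indicator {0<..<1} s * ennreal (beukers_num n s / (1 - n * s) ^ 6)) \<partial>lborel \<partial>lborel)
     = ennreal (1584871/600 - 16 * pi\<^sup>2)"
proof -
  define k where "k n = (\<integral>s. indicator unit_sq (n, s) * (tail_num n s / (1 - n * s)) \<partial>lborel)" for n
  let ?f = "\<lambda>P. indicator unit_sq P * (tail_num (fst P) (snd P) / (1 - fst P * snd P))"
  have "integrable (lborel \<Otimes>\<^sub>M lborel) ?f" and int: "integral\<^sup>L (lborel \<Otimes>\<^sub>M lborel) ?f = 91040/3 - 160 * pi\<^sup>2"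
    using has_bochner_integral_tail by (simp_all add: has_bochner_integral_iff lborel_prod)
  from lborel_pair.integrable_fst'[OF this(1)] lborel_pair.integral_fst'[OF this(1)]
  have k: "has_bochner_integral lborel k (91040/3 - 160 * pi\<^sup>2)"
    unfolding has_bochner_integral_iff k_def[abs_def] int by (simp only: fst_conv snd_conv)
  have "has_bochner_integral lborel (\<lambda>n. edge_poly n * indicator {0..1} n) (edge_prim 1 - edge_prim 0)"
    by (rule has_bochner_integral_FTC_Icc_real)
       (auto simp: edge_poly_def edge_prim_def intro!: derivative_eq_intros continuous_intros)
  from has_bochner_integral_add[OF this k]
  have I: "has_bochner_integral lborel (\<lambda>n. edge_poly n * indicator {0..1} n + k n) (10 * (1584871/600 - 16 * pi\<^sup>2))"
    by (simp add: edge_prim_def)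
  have open_closed: "AE s in lborel. s \<noteq> (0::real) \<and> s \<noteq> 1"
    using AE_lborel_singleton[of 0] AE_lborel_singleton[of 1] by eventually_elim auto
  have k0: "k n = 0" if "n \<notin> {0<..<1}" for n
    using that by (auto simp: k_def unit_sq_def indicator_def)
  have pos: "AE n in lborel. 0 \<le> edge_poly n * indicator {0..1} n + k n"
    using open_closed
  proof eventually_elim
    case (elim n)
    then show ?case
      using inner_integral(2)[of n] nn k0[of n] by (cases "n \<in> {0<..<1}") (auto simp: k_def)
  qed
  have "(\<integral>\<^sup>+n. \<integral>\<^sup>+s. indicator {0<..<1} n * (indicator {0<..<1} s * ennreal (beukers_num n s / (1 - n * s) ^ 6)) \<partial>lborel \<partial>lborel)
     = (\<integral>\<^sup>+n. ennreal ((edge_poly n * indicator {0..1} n + k n) / 10) \<partial>lborel)"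
  proof (rule nn_integral_cong_AE, use open_closed in eventually_elim)
    case (elim n)
    show ?case
    proof (cases "n \<in> {0<..<1}")
      case True
      then show ?thesis using inner_integral(1)[of n] nn by (simp add: k_def)
    next
      case False
      then show ?thesis using k0[of n] elim by auto
    qed
  qed
  also have "\<dots> = ennreal (10 * (1584871/600 - 16 * pi\<^sup>2) / 10)"
  proof -
    have I': "has_bochner_integral lborel (\<lambda>n. (edge_poly n * indicator {0..1} n + k n) / 10) (10 * (1584871/600 - 16 * pi\<^sup>2) / 10)"
      using I by (rule has_bochner_integral_divide_zero)
    have pos': "AE n in lborel. 0 \<le> (edge_poly n * indicator {0..1} n + k n) / 10"
      using pos by eventually_elim simp
    show ?thesis
      using I' pos' by (subst nn_integral_eq_integral) (auto simp: has_bochner_integral_iff)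
  qed
  also have "10 * (1584871/600 - 16 * pi\<^sup>2) / 10 = 1584871/600 - 16 * pi\<^sup>2" by simp
  finally show ?thesis .
qed

section \<open>Quadrilateral and pentagonal sections\<close>

text \<open>Scaling by 24 clears the denominators of the moments, so that the identities below have
  integer coefficients; \<open>13824 = 24 ^ 3\<close>.\<close>

lemma det_mom_scale:
  "det_mom m0 mx my mxx mxy myy = det_mom (24 * m0) (24 * mx) (24 * my) (24 * mxx) (24 * mxy) (24 * myy) / 13824"
  by (simp add: det_mom_def field_simps power2_eq_square)

lemma gap_mom_lower:
  "gap_mom m (m * p) (m * p ^ 2 / 2) (m * p ^ 3 / 6) (m ^ 2 * p ^ 3 / 6) (m * p ^ 4 / 12) (m ^ 2 * p ^ 4 / 24) (m ^ 3 * p ^ 4 / 12) = m ^ 3 * p ^ 4 / 12"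
  by (simp add: gap_mom_def field_simps power_numeral_reduce)

lemma gap_mom_upper:
  "gap_mom (1 - n) (1 - n * q) (n * q ^ 2 / 2) (n * q ^ 3 / 6) (n * q ^ 2 / 2 - n * q ^ 3 / 6 - n ^ 2 * q ^ 3 / 6) (n * q ^ 4 / 12)
     (n * q ^ 3 / 6 - n * q ^ 4 / 12 - n ^ 2 * q ^ 4 / 24)
     (n * q ^ 2 / 2 + n * q ^ 4 / 12 + n ^ 3 * q ^ 4 / 12 - 2 * (n * q ^ 3 / 6) - 2 * (n ^ 2 * q ^ 3 / 6) + 2 * (n ^ 2 * q ^ 4 / 24)) = n ^ 3 * q ^ 4 / 12"
  by (simp add: gap_mom_def field_simps power_numeral_reduce)

text \<open>
  For a pentagonal section, cutting off corners of relative sizes \<open>1 - x\<close> and \<open>1 - x (1 - s)\<close>, the \<open>dc\<close> and \<open>wc\<close> are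
  the coefficients in \<open>x\<close> of the moment determinant (\<open>pentagon_det\<close>) and of the mean gap (\<open>pentagon_gap\<close>).
\<close>
definition dc0 :: "real \<Rightarrow> real \<Rightarrow> real" where
  "dc0 n s = -24 * n^5 * s^5 + 120 * n^4 * s^4 - 240 * n^3 * s^3 + 240 * n^2 * s^2 - 120 * n * s + 24"

definition dc1 :: "real \<Rightarrow> real \<Rightarrow> real" where
  "dc1 n s = -60 * n^5 * s^6 + 120 * n^5 * s^5 + 240 * n^4 * s^5 - 516 * n^4 * s^4 - 48 * n^4 * s^3 + 24 * n^4 * s^2 - 384 * n^3 * s^4 + 960 * n^3 * s^3 + 72 * n^3 * s^2 - 48 * n^3 * s + 288 * n^2 * s^3 - 912 * n^2 * s^2 + 24 * n^2 - 84 * n * s^2 + 408 * n * s - 24 * n - 60"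

definition dc2 :: "real \<Rightarrow> real \<Rightarrow> real" where
  "dc2 n s = -64 * n^5 * s^7 + 240 * n^5 * s^6 - 240 * n^5 * s^5 + 208 * n^4 * s^6 - 816 * n^4 * s^5 + 784 * n^4 * s^4 + 240 * n^4 * s^3 - 96 * n^4 * s^2 - 288 * n^3 * s^5 + 1264 * n^3 * s^4 - 1456 * n^3 * s^3 - 336 * n^3 * s^2 + 176 * n^3 * s + 192 * n^2 * s^4 - 976 * n^2 * s^3 + 1488 * n^2 * s^2 + 16 * n^2 * s - 80 * n^2 - 48 * n * s^3 + 288 * n * s^2 - 640 * n * s + 80 * n + 64"

definition dc3 :: "real \<Rightarrow> real \<Rightarrow> real" where
  "dc3 n s = -36 * n^5 * s^8 + 192 * n^5 * s^7 - 360 * n^5 * s^6 + 240 * n^5 * s^5 + 96 * n^4 * s^7 - 516 * n^4 * s^6 + 936 * n^4 * s^5 - 408 * n^4 * s^4 - 432 * n^4 * s^3 + 144 * n^4 * s^2 - 132 * n^3 * s^6 + 744 * n^3 * s^5 - 1524 * n^3 * s^4 + 960 * n^3 * s^3 + 552 * n^3 * s^2 - 240 * n^3 * s + 96 * n^2 * s^5 - 564 * n^2 * s^4 + 1344 * n^2 * s^3 - 1308 * n^2 * s^2 - 24 * n^2 * s + 96 * n^2 - 24 * n * s^4 + 144 * n * s^3 - 396 * n * s^2 + 552 * n * s - 96 * n - 36"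

definition dc4 :: "real \<Rightarrow> real \<Rightarrow> real" where
  "dc4 n s = -10 * n^5 * s^9 + 72 * n^5 * s^8 - 192 * n^5 * s^7 + 240 * n^5 * s^6 - 120 * n^5 * s^5 + 18 * n^4 * s^8 - 144 * n^4 * s^7 + 368 * n^4 * s^6 - 360 * n^4 * s^5 - 72 * n^4 * s^4 + 336 * n^4 * s^3 - 96 * n^4 * s^2 - 24 * n^3 * s^7 + 216 * n^3 * s^6 - 612 * n^3 * s^5 + 768 * n^3 * s^4 - 208 * n^3 * s^3 - 384 * n^3 * s^2 + 144 * n^3 * s + 16 * n^2 * s^6 - 168 * n^2 * s^5 + 540 * n^2 * s^4 - 864 * n^2 * s^3 + 624 * n^2 * s^2 - 48 * n^2 + 24 * n * s^4 - 104 * n * s^3 + 216 * n * s^2 - 234 * n * s + 48 * n + 10"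

definition dc5 :: "real \<Rightarrow> real \<Rightarrow> real" where
  "dc5 n s = -1 * n^5 * s^10 + 10 * n^5 * s^9 - 36 * n^5 * s^8 + 64 * n^5 * s^7 - 60 * n^5 * s^6 + 24 * n^5 * s^5 - 9 * n^4 * s^8 + 40 * n^4 * s^7 - 56 * n^4 * s^6 + 92 * n^4 * s^4 - 96 * n^4 * s^3 + 24 * n^4 * s^2 + 16 * n^3 * s^7 - 82 * n^3 * s^6 + 156 * n^3 * s^5 - 128 * n^3 * s^4 - 16 * n^3 * s^3 + 96 * n^3 * s^2 - 32 * n^3 * s - 12 * n^2 * s^6 + 72 * n^2 * s^5 - 170 * n^2 * s^4 + 216 * n^2 * s^3 - 132 * n^2 * s^2 + 8 * n^2 * s + 8 * n^2 - 4 * n * s^4 + 16 * n * s^3 - 33 * n * s^2 + 34 * n * s - 8 * n - 1"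

definition wc0 :: "real \<Rightarrow> real \<Rightarrow> real" where
  "wc0 n s = -4 * n^3 * s + 4 * n^2 * s + 4 * n^2 - 2 * n * s - 4 * n + 2"

definition wc1 :: "real \<Rightarrow> real \<Rightarrow> real" where
  "wc1 n s = -6 * n^3 * s^2 + 12 * n^3 * s + 3 * n^2 * s^2 - 6 * n^2 * s - 12 * n^2 + 12 * n - 3"

definition wc2 :: "real \<Rightarrow> real \<Rightarrow> real" where
  "wc2 n s = -4 * n^3 * s^3 + 12 * n^3 * s^2 - 12 * n^3 * s + 12 * n^2 - 12 * n + 4"

definition wc3 :: "real \<Rightarrow> real \<Rightarrow> real" where
  "wc3 n s = -1 * n^3 * s^4 + 4 * n^3 * s^3 - 6 * n^3 * s^2 + 4 * n^3 * s - 3 * n^2 + 3 * n - 1"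

text \<open>As \<open>x\<close> tends to 0 the two lines close up and the shadow becomes a strip of
  width proportional to \<open>x\<close>. Three masses and one squared width give
  \<open>x ^ 5\<close>; with one more \<open>x\<close> from the gap this cancels the
  \<open>x ^ 6\<close> contained in \<open>(t' - t) ^ 6\<close>.\<close>

lemma pentagon_det:
  "det_mom (1/2 - (1 - n) * (1 - x) ^ 2 / 2 - n * q ^ 2 / 2) (1/6 - (1 - n) * (1 - x) ^ 3 / 6 - n * q ^ 3 / 6)
    (1/6 - (1 - n) ^ 2 * (1 - x) ^ 3 / 6 - (n * q ^ 2 / 2 - n * q ^ 3 / 6 - n ^ 2 * q ^ 3 / 6))
    (1/12 - (1 - n) * (1 - x) ^ 4 / 12 - n * q ^ 4 / 12)
    (1/24 - (1 - n) ^ 2 * (1 - x) ^ 4 / 24 - (n * q ^ 3 / 6 - n * q ^ 4 / 12 - n ^ 2 * q ^ 4 / 24))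
    (1/12 - (1 - n) ^ 3 * (1 - x) ^ 4 / 12 - (n * q ^ 2 / 2 + n * q ^ 4 / 12 + n ^ 3 * q ^ 4 / 12 - 2 * (n * q ^ 3 / 6) - 2 * (n ^ 2 * q ^ 3 / 6) + 2 * (n ^ 2 * q ^ 4 / 24)))
   = x ^ 5 * (dc0 n s + dc1 n s * x + dc2 n s * x ^ 2 + dc3 n s * x ^ 3 + dc4 n s * x ^ 4 + dc5 n s * x ^ 5) / 3456"
  (is "det_mom ?m0 ?mx ?my ?mxx ?mxy ?myy = ?R / 3456")
  if q: "q = 1 - x * (1 - s)"
proof -
  define p where "p = 1 - x"
  have *: "24 * ?m0 = 12 - 12 * (1 - n) * (1 - x) ^ 2 - 12 * n * (1 - x * (1 - s)) ^ 2"
    "24 * ?mx = 4 - 4 * (1 - n) * (1 - x) ^ 3 - 4 * n * (1 - x * (1 - s)) ^ 3"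
    "24 * ?my = 4 - 4 * (1 - n) ^ 2 * (1 - x) ^ 3 - 12 * n * (1 - x * (1 - s)) ^ 2 + 4 * n * (1 - x * (1 - s)) ^ 3 + 4 * n ^ 2 * (1 - x * (1 - s)) ^ 3"
    "24 * ?mxx = 2 - 2 * (1 - n) * (1 - x) ^ 4 - 2 * n * (1 - x * (1 - s)) ^ 4"
    "24 * ?mxy = 1 - (1 - n) ^ 2 * (1 - x) ^ 4 - 4 * n * (1 - x * (1 - s)) ^ 3 + 2 * n * (1 - x * (1 - s)) ^ 4 + n ^ 2 * (1 - x * (1 - s)) ^ 4"
    "24 * ?myy = 2 - 2 * (1 - n) ^ 3 * (1 - x) ^ 4 - 12 * n * (1 - x * (1 - s)) ^ 2 - 2 * n * (1 - x * (1 - s)) ^ 4 - 2 * n ^ 3 * (1 - x * (1 - s)) ^ 4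
       + 8 * n * (1 - x * (1 - s)) ^ 3 + 8 * n ^ 2 * (1 - x * (1 - s)) ^ 3 - 2 * n ^ 2 * (1 - x * (1 - s)) ^ 4"
    unfolding q[symmetric] p_def[symmetric] by simp_all
  have "det_mom (24 * ?m0) (24 * ?mx) (24 * ?my) (24 * ?mxx) (24 * ?mxy) (24 * ?myy) - 4 * ?R = 0"
    unfolding * det_mom_def dc0_def dc1_def dc2_def dc3_def dc4_def dc5_def by algebra
  then show ?thesis
    by (subst det_mom_scale) simp
qed

lemma pentagon_gap:
  assumes q: "q = 1 - x * (1 - s)"
  shows "((1 - n)\<^sup>2 + (1 - n) + 1) / 12 - ((1 - n) * (1 - x) + (1 - n * q)) * (1 + (1 - n)) / 6
     + (1 - n) * (1 - x) * (1 - n * q) / 2 + ((1 - n * q) - (1 - n) * (1 - x))\<^sup>2 / 4 - (1 - n) ^ 3 * (1 - x) ^ 4 / 12 - n ^ 3 * q ^ 4 / 12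
   = x * (wc0 n s + wc1 n s * x + wc2 n s * x ^ 2 + wc3 n s * x ^ 3) / 12" (is "?L = ?R / 12")
proof -
  have "12 * ?L - ?R = 0"
  proof -
    have "12 * (A / 12 - B / 6 + D / 2 + E / 4 - G / 12 - H / 12) = A - 2 * B + 6 * D + 3 * E - G - H" for A B D E G H :: real
      by simp
    then have "12 * ?L = ((1 - n)\<^sup>2 + (1 - n) + 1) - 2 * (((1 - n) * (1 - x) + (1 - n * q)) * (1 + (1 - n)))
     + 6 * ((1 - n) * (1 - x) * (1 - n * q)) + 3 * ((1 - n * q) - (1 - n) * (1 - x))\<^sup>2 - (1 - n) ^ 3 * (1 - x) ^ 4 - n ^ 3 * q ^ 4" .
    also have "\<dots> - ?R = 0"
      unfolding q wc0_def wc1_def wc2_def wc3_def by algebra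
    finally show ?thesis .
  qed
  moreover have "L = R / 12" if "12 * L - R = 0" for L R :: real
    using that by simp
  ultimately show ?thesis by blast
qed

text \<open>The integral over \<open>0 < x < 1\<close> of \<open>x\<close> times the product of the
  two polynomials with coefficients \<open>dc\<close> and \<open>wc\<close>, sorted by powers of
  \<open>x\<close>. The extra \<open>x\<close> is the Jacobian of
  \<open>y = x (1 - s)\<close>.\<close>

definition pent_sum :: "real \<Rightarrow> real \<Rightarrow> real" where
  "pent_sum n s =
     dc0 n s * wc0 n s / 2
   + (dc0 n s * wc1 n s + dc1 n s * wc0 n s) / 3
   + (dc0 n s * wc2 n s + dc1 n s * wc1 n s + dc2 n s * wc0 n s) / 4
   + (dc0 n s * wc3 n s + dc1 n s * wc2 n s + dc2 n s * wc1 n s + dc3 n s * wc0 n s) / 5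
   + (dc1 n s * wc3 n s + dc2 n s * wc2 n s + dc3 n s * wc1 n s + dc4 n s * wc0 n s) / 6
   + (dc2 n s * wc3 n s + dc3 n s * wc2 n s + dc4 n s * wc1 n s + dc5 n s * wc0 n s) / 7
   + (dc3 n s * wc3 n s + dc4 n s * wc2 n s + dc5 n s * wc1 n s) / 8
   + (dc4 n s * wc3 n s + dc5 n s * wc2 n s) / 9
   + dc5 n s * wc3 n s / 10"

lemma nn_integral_poly_product:
  fixes K :: real
  assumes nn: "\<And>x. 0 < x \<Longrightarrow> x < 1 \<Longrightarrow> 0 \<le> K * (x * ((d0 + d1 * x + d2 * x ^ 2 + d3 * x ^ 3 + d4 * x ^ 4 + d5 * x ^ 5) * (w0 + w1 * x + w2 * x ^ 2 + w3 * x ^ 3)))"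
  defines "S \<equiv> d0 * w0 / 2 + (d0 * w1 + d1 * w0) / 3 + (d0 * w2 + d1 * w1 + d2 * w0) / 4
    + (d0 * w3 + d1 * w2 + d2 * w1 + d3 * w0) / 5 + (d1 * w3 + d2 * w2 + d3 * w1 + d4 * w0) / 6
    + (d2 * w3 + d3 * w2 + d4 * w1 + d5 * w0) / 7 + (d3 * w3 + d4 * w2 + d5 * w1) / 8 + (d4 * w3 + d5 * w2) / 9 + d5 * w3 / 10"
  shows "(\<integral>\<^sup>+x. indicator {0<..<1} x * ennreal (K * (x * ((d0 + d1 * x + d2 * x ^ 2 + d3 * x ^ 3 + d4 * x ^ 4 + d5 * x ^ 5) * (w0 + w1 * x + w2 * x ^ 2 + w3 * x ^ 3)))) \<partial>lborel)
      = ennreal (K * S)" and "0 \<le> K * S"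
proof -
  define f where "f x = K * (x * ((d0 + d1 * x + d2 * x ^ 2 + d3 * x ^ 3 + d4 * x ^ 4 + d5 * x ^ 5) * (w0 + w1 * x + w2 * x ^ 2 + w3 * x ^ 3)))" for x
  define F where "F x = K * (d0 * w0 / 2 * x ^ 2 + (d0 * w1 + d1 * w0) / 3 * x ^ 3 + (d0 * w2 + d1 * w1 + d2 * w0) / 4 * x ^ 4
    + (d0 * w3 + d1 * w2 + d2 * w1 + d3 * w0) / 5 * x ^ 5 + (d1 * w3 + d2 * w2 + d3 * w1 + d4 * w0) / 6 * x ^ 6
    + (d2 * w3 + d3 * w2 + d4 * w1 + d5 * w0) / 7 * x ^ 7 + (d3 * w3 + d4 * w2 + d5 * w1) / 8 * x ^ 8 + (d4 * w3 + d5 * w2) / 9 * x ^ 9 + d5 * w3 / 10 * x ^ 10)" for x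
  have D: "(F has_real_derivative f x) (at x)" for x
  proof -
    have "f x = K * (d0 * w0 * x + (d0 * w1 + d1 * w0) * x ^ 2 + (d0 * w2 + d1 * w1 + d2 * w0) * x ^ 3
    + (d0 * w3 + d1 * w2 + d2 * w1 + d3 * w0) * x ^ 4 + (d1 * w3 + d2 * w2 + d3 * w1 + d4 * w0) * x ^ 5
    + (d2 * w3 + d3 * w2 + d4 * w1 + d5 * w0) * x ^ 6 + (d3 * w3 + d4 * w2 + d5 * w1) * x ^ 7 + (d4 * w3 + d5 * w2) * x ^ 8 + d5 * w3 * x ^ 9)"
      unfolding f_def by algebra
    then show ?thesis
      unfolding F_def by (auto intro!: derivative_eq_intros)
  qed
  have c: "isCont f x" for x
    unfolding f_def by (intro continuous_intros)
  have F: "F 1 - F 0 = K * S" by (simp add: F_def S_def)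
  show "(\<integral>\<^sup>+x. indicator {0<..<1} x * ennreal (K * (x * ((d0 + d1 * x + d2 * x ^ 2 + d3 * x ^ 3 + d4 * x ^ 4 + d5 * x ^ 5) * (w0 + w1 * x + w2 * x ^ 2 + w3 * x ^ 3)))) \<partial>lborel)
      = ennreal (K * S)" "0 \<le> K * S"
    using nn_integral_FTC_open[of 0 1 F f] D c nn unfolding F by (auto simp: f_def)
qed

text \<open>Twice the integral over the half \<open>y < x\<close>, in anticipation of the reflected
  half. A single half carries \<open>6 / (3456 * 12) = 1 / 6912\<close>, from the determinant and
  the gap.\<close>

definition pent_dens :: "real \<Rightarrow> real \<Rightarrow> real" where
  "pent_dens n s = n * (1 - n) / (3456 * (1 - n * s) ^ 6) * pent_sum n s"

lemma pos_one_minus_mult: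
  fixes n s :: real
  assumes "0 < n" "n < 1" "0 < s" "s < 1"
  shows "0 < 1 - n * s"
  using mult_strict_mono[of n 1 s 1] assms by simp

text \<open>The relative distances of the two levels from \<open>m = 1 - n\<close> are
  \<open>x\<close> and \<open>y = x (1 - s)\<close>. This blows up the point
  \<open>x = y = 0\<close>, where both lines pass through the middle vertex: \<open>t' - t\<close>
  becomes \<open>x (1 - n s)\<close>, the powers of \<open>x\<close> cancel, and the only
  denominator left is \<open>(1 - n s) ^ 6\<close>.\<close>

lemma pentagon_inner:
  assumes n: "0 < n" "n < 1" and s: "0 < s" "s < 1"
  shows "(\<integral>\<^sup>+x. indicator {0<..<1} x * (ennreal x * (ennreal (n * (1 - n)) * dens (1 - n) ((1 - n) * (1 - x)) (1 - n * (1 - x * (1 - s))))) \<partial>lborel)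
     = ennreal (pent_dens n s / 2)" and "0 \<le> pent_dens n s"
proof -
  define w where "w = 1 - n * s"
  have w: "0 < w" using pos_one_minus_mult[OF n s] by (simp add: w_def)
  define K where "K = n * (1 - n) / (6912 * w ^ 6)"
  let ?d = "\<lambda>x. dc0 n s + dc1 n s * x + dc2 n s * x ^ 2 + dc3 n s * x ^ 3 + dc4 n s * x ^ 4 + dc5 n s * x ^ 5"
  let ?w = "\<lambda>x. wc0 n s + wc1 n s * x + wc2 n s * x ^ 2 + wc3 n s * x ^ 3"
  have d: "ennreal x * (ennreal (n * (1 - n)) * dens (1 - n) ((1 - n) * (1 - x)) (1 - n * (1 - x * (1 - s)))) = ennreal (K * (x * (?d x * ?w x)))"
    and nn: "0 \<le> K * (x * (?d x * ?w x))" if x: "0 < x" "x < 1" for x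
  proof -
    define q where "q = 1 - x * (1 - s)"
    have "x * (1 - s) < 1 * 1" using x s by (intro mult_strict_mono) auto
    then have q: "0 < q" "q \<le> 1" using x s by (auto simp: q_def)
    have m: "0 < 1 - n" "1 - n < 1" using n by auto
    have p: "0 < 1 - x" "1 - x \<le> 1" using x by auto
    have k: "1 - n * q - (1 - n) * (1 - x) = x * w"
      by (simp add: q_def w_def algebra_simps)
    have less: "(1 - n) * (1 - x) < 1 - n * q" using k x w by (smt (verit) mult_pos_pos)
    note * = dens_eval[OF less has_moments_lower(1)[OF m p] has_moments_upper[OF n q] refl refl,
        unfolded gap_mom_lower gap_mom_upper, unfolded pentagon_det[OF q_def] pentagon_gap[OF q_def], unfolded k]
    have pos: "0 \<le> 6 * (x ^ 5 * ?d x / 3456) * (x * ?w x / 12) / (x * w) ^ 6"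
      using *(2,3) x w by simp
    have eq: "x * (n * (1 - n) * (6 * (x ^ 5 * ?d x / 3456) * (x * ?w x / 12) / (x * w) ^ 6)) = K * (x * (?d x * ?w x))"
    proof -
      have "x * (n * (1 - n) * (6 * (x ^ 5 * a / 3456) * (x * b / 12) / (x * w) ^ 6)) = K * (x * (a * b))" for a b
        using x w by (simp add: K_def field_simps power_numeral_reduce)
      then show ?thesis .
    qed
    show "0 \<le> K * (x * (?d x * ?w x))"
      unfolding eq[symmetric] using pos x n by (intro mult_nonneg_nonneg) auto
    have "ennreal x * (ennreal (n * (1 - n)) * dens (1 - n) ((1 - n) * (1 - x)) (1 - n * (1 - x * (1 - s))))
      = ennreal (x * (n * (1 - n) * (6 * (x ^ 5 * ?d x / 3456) * (x * ?w x / 12) / (x * w) ^ 6)))"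
      unfolding q_def[symmetric] *(1) using pos x n by (simp only: ennreal_mult' mult_nonneg_nonneg less_imp_le diff_gt_0_iff_gt)
    then show "ennreal x * (ennreal (n * (1 - n)) * dens (1 - n) ((1 - n) * (1 - x)) (1 - n * (1 - x * (1 - s)))) = ennreal (K * (x * (?d x * ?w x)))"
      unfolding eq .
  qed
  have "(\<integral>\<^sup>+x. indicator {0<..<1} x * (ennreal x * (ennreal (n * (1 - n)) * dens (1 - n) ((1 - n) * (1 - x)) (1 - n * (1 - x * (1 - s))))) \<partial>lborel)
    = (\<integral>\<^sup>+x. indicator {0<..<1} x * ennreal (K * (x * (?d x * ?w x))) \<partial>lborel)"
    by (rule nn_integral_cong) (auto split: split_indicator simp: d)
  also have "\<dots> = ennreal (K * pent_sum n s)"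
    unfolding pent_sum_def by (rule nn_integral_poly_product(1)[OF nn])
  also have K: "K * pent_sum n s = pent_dens n s / 2"
    by (simp add: K_def pent_dens_def w_def)
  finally show "(\<integral>\<^sup>+x. indicator {0<..<1} x * (ennreal x * (ennreal (n * (1 - n)) * dens (1 - n) ((1 - n) * (1 - x)) (1 - n * (1 - x * (1 - s))))) \<partial>lborel)
     = ennreal (pent_dens n s / 2)" .
  have "0 \<le> K * pent_sum n s"
    unfolding pent_sum_def by (rule nn_integral_poly_product(2)[OF nn])
  then show "0 \<le> pent_dens n s" using K by simp
qed

text \<open>The ray integral of \<open>nn_integral_dens_ray\<close> for \<open>m = 1 - n\<close> and
  \<open>T = 1 - n s\<close>, where \<open>s\<close> is the relative size of the corner cut off at
  \<open>(0, 1)\<close>. The leading \<open>n\<close> is the Jacobian of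
  \<open>t' = 1 - n s\<close>.\<close>

definition quad_dens :: "real \<Rightarrow> real \<Rightarrow> real" where
  "quad_dens n s = n * (6 * det_mom (1/2 - n * s ^ 2 / 2) (1/6 - n * s ^ 3 / 6) (1/6 - (n * s ^ 2 / 2 - n * s ^ 3 / 6 - n ^ 2 * s ^ 3 / 6))
     (1/12 - n * s ^ 4 / 12) (1/24 - (n * s ^ 3 / 6 - n * s ^ 4 / 12 - n ^ 2 * s ^ 4 / 24))
     (1/12 - (n * s ^ 2 / 2 + n * s ^ 4 / 12 + n ^ 3 * s ^ 4 / 12 - 2 * (n * s ^ 3 / 6) - 2 * (n ^ 2 * s ^ 3 / 6) + 2 * (n ^ 2 * s ^ 4 / 24)))
   * ((((1 - n)\<^sup>2 + (1 - n) + 1) / 12 - (1 - n * s) * (1 + (1 - n)) / 3 + (1 - n * s)\<^sup>2 / 2 - n ^ 3 * s ^ 4 / 12) / (5 * (1 - n * s) ^ 5)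
      + ((1 + (1 - n)) / 6 - (1 - n * s) / 2) / (4 * (1 - n * s) ^ 4) + 1 / (12 * (1 - n * s) ^ 3)))"

lemma quad_inner:
  assumes n: "0 < n" "n < 1" and s: "0 < s" "s < 1"
  shows "ennreal n * (\<integral>\<^sup>+t. indicator {..<0} t * dens (1 - n) t (1 - n * s) \<partial>lborel) = ennreal (quad_dens n s)"
    and "0 \<le> quad_dens n s"
proof -
  have w: "0 < 1 - n * s" using pos_one_minus_mult[OF n s] .
  have m: "0 < 1 - n" using n by simp
  note * = nn_integral_dens_ray[OF m w has_moments_upper[OF n s(1) less_imp_le[OF s(2)]] refl, unfolded gap_mom_upper]
  show "0 \<le> quad_dens n s"
    unfolding quad_dens_def by (rule mult_nonneg_nonneg[OF less_imp_le[OF n(1)] *(2)])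
  show "ennreal n * (\<integral>\<^sup>+t. indicator {..<0} t * dens (1 - n) t (1 - n * s) \<partial>lborel) = ennreal (quad_dens n s)"
    unfolding *(1) quad_dens_def using n by (intro ennreal_mult'[symmetric]) simp
qed

text \<open>The quadrilaterals count twice because of their mirror images. \<open>2520\<close> is
  the least common multiple of the denominators 2 to 10 in \<open>pent_sum\<close>, and
  \<open>6 / 52254720\<close> is \<open>1 / (3456 * 2520)\<close>.\<close>

lemma quad_pent_sum:
  assumes "1 - n * s \<noteq> 0"
  shows "pent_dens n s + 2 * quad_dens n s = 6 / 52254720 * (beukers_num n s / (1 - n * s) ^ 6)"
proof -
  define w where "w = 1 - n * s"
  have w: "w \<noteq> 0" using assms by (simp add: w_def)
  define D where "D = det_mom (12 - 12 * n * s ^ 2) (4 - 4 * n * s ^ 3) (4 - 12 * n * s ^ 2 + 4 * n * s ^ 3 + 4 * n ^ 2 * s ^ 3)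
     (2 - 2 * n * s ^ 4) (1 - 4 * n * s ^ 3 + 2 * n * s ^ 4 + n ^ 2 * s ^ 4)
     (2 - 12 * n * s ^ 2 - 2 * n * s ^ 4 - 2 * n ^ 3 * s ^ 4 + 8 * n * s ^ 3 + 8 * n ^ 2 * s ^ 3 - 2 * n ^ 2 * s ^ 4)"
  define a where "a = (1 - n)\<^sup>2 + (1 - n) + 1 - 4 * w * (2 - n) + 6 * w\<^sup>2 - n ^ 3 * s ^ 4"
  define b where "b = 2 - n - 3 * w"
  have quad: "quad_dens n s = n * D / 2304 * (a / (60 * w ^ 5) + b / (24 * w ^ 4) + 1 / (12 * w ^ 3))"
  proof -
    have "quad_dens n s = n * (6 * (D / 13824) * (a / 12 / (5 * w ^ 5) + b / 6 / (4 * w ^ 4) + 1 / (12 * w ^ 3)))"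
      unfolding quad_dens_def D_def w_def[symmetric]
      by (subst det_mom_scale) (simp add: a_def b_def diff_divide_distrib add_divide_distrib algebra_simps)
    then show ?thesis by simp
  qed
  have sum: "2520 * pent_sum n s = 1260 * (dc0 n s * wc0 n s)
   + 840 * (dc0 n s * wc1 n s + dc1 n s * wc0 n s)
   + 630 * (dc0 n s * wc2 n s + dc1 n s * wc1 n s + dc2 n s * wc0 n s)
   + 504 * (dc0 n s * wc3 n s + dc1 n s * wc2 n s + dc2 n s * wc1 n s + dc3 n s * wc0 n s)
   + 420 * (dc1 n s * wc3 n s + dc2 n s * wc2 n s + dc3 n s * wc1 n s + dc4 n s * wc0 n s)
   + 360 * (dc2 n s * wc3 n s + dc3 n s * wc2 n s + dc4 n s * wc1 n s + dc5 n s * wc0 n s)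
   + 315 * (dc3 n s * wc3 n s + dc4 n s * wc2 n s + dc5 n s * wc1 n s)
   + 280 * (dc4 n s * wc3 n s + dc5 n s * wc2 n s)
   + 252 * (dc5 n s * wc3 n s)"
    unfolding pent_sum_def by (simp add: field_simps)
  have "n * (1 - n) * (2520 * pent_sum n s) + 63 * (n * D) * (2 * a * w + 5 * b * w ^ 2 + 10 * w ^ 3) - beukers_num n s = 0"
    unfolding sum D_def a_def b_def w_def det_mom_def dc0_def dc1_def dc2_def dc3_def dc4_def dc5_def wc0_def wc1_def wc2_def wc3_def beukers_num_def
    by algebra
  then have B: "beukers_num n s = n * (1 - n) * (2520 * pent_sum n s) + 63 * (n * D) * (2 * a * w + 5 * b * w ^ 2 + 10 * w ^ 3)"
    by simp
  show ?thesis
    unfolding pent_dens_def quad B w_def[symmetric] using w by (simp add: field_simps power_numeral_reduce)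
qed

text \<open>The plane misses the prism, so all moments of the shadow vanish and with them the
  determinant.\<close>

lemma dens_eq_0:
  assumes m: "0 < m" "m < 1" and t: "t' < 0 \<or> 1 < t"
  shows "dens m t t' = 0"
proof (cases "t < t'")
  case True
  have all: "0 \<le> m * fst P + snd P \<and> m * fst P + snd P \<le> 1" if "P \<in> unit_tri" for P
  proof -
    have "m * fst P \<le> fst P" using that m by (auto simp: unit_tri_def intro: mult_left_le_one_le)
    then show ?thesis using that m by (auto simp: unit_tri_def)
  qed
  from t show ?thesis
  proof
    assume t': "t' < 0"
    then have "{P \<in> unit_tri. m * fst P + snd P > t'} = unit_tri"
      using all by fastforce
    then have E: "has_moments {P \<in> unit_tri. m * fst P + snd P > t'} (1/2) (1/6) (1/6) (1/12) (1/24) (1/12)"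
      using has_moments_unit_tri by (simp only:)
    have "t \<le> 0" using True t' by simp
    from dens_eval(1)[OF True has_moments_lower_empty[OF m(1) this] E refl refl] show ?thesis
      by (simp add: det_mom_def)
  next
    assume t': "1 < t"
    then have "{P \<in> unit_tri. m * fst P + snd P < t} = unit_tri"
      using all by fastforce
    then have C: "has_moments {P \<in> unit_tri. m * fst P + snd P < t} (1/2) (1/6) (1/6) (1/12) (1/24) (1/12)"
      using has_moments_unit_tri by (simp only:)
    have "1 \<le> t'" using True t' by simp
    from dens_eval(1)[OF True C has_moments_upper_empty[OF m this] refl refl] show ?thesis
      by (simp add: det_mom_def)
  qed
qed (simp add: dens_def)

lemma nn_integral2_add:
  fixes f g :: "real \<Rightarrow> real \<Rightarrow> ennreal"
  assumes [measurable]: "case_prod f \<in> borel_measurable (borel \<Otimes>\<^sub>M borel)" "case_prod g \<in> borel_measurable (borel \<Otimes>\<^sub>M borel)"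
  shows "(\<integral>\<^sup>+x. \<integral>\<^sup>+y. f x y + g x y \<partial>lborel \<partial>lborel) = (\<integral>\<^sup>+x. \<integral>\<^sup>+y. f x y \<partial>lborel \<partial>lborel) + (\<integral>\<^sup>+x. \<integral>\<^sup>+y. g x y \<partial>lborel \<partial>lborel)"
proof -
  have "(\<integral>\<^sup>+x. \<integral>\<^sup>+y. f x y + g x y \<partial>lborel \<partial>lborel) = (\<integral>\<^sup>+x. (\<integral>\<^sup>+y. f x y \<partial>lborel) + (\<integral>\<^sup>+y. g x y \<partial>lborel) \<partial>lborel)"
    by (rule nn_integral_cong, rule nn_integral_add) measurable
  also have "\<dots> = (\<integral>\<^sup>+x. \<integral>\<^sup>+y. f x y \<partial>lborel \<partial>lborel) + (\<integral>\<^sup>+x. \<integral>\<^sup>+y. g x y \<partial>lborel \<partial>lborel)"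
    by (rule nn_integral_add) measurable
  finally show ?thesis .
qed

text \<open>\<open>0\<close>, \<open>m\<close>, \<open>1\<close> are the levels of the three
  vertices, so the shape of the shadow is constant on each cell. Of the nine cells with
  \<open>t < 1\<close> and \<open>t' > 0\<close>, the condition \<open>t < t'\<close> excludes
  one.\<close>

lemma nn_integral_dens_split:
  assumes m: "0 < m" "m < 1"
  shows "(\<integral>\<^sup>+t. \<integral>\<^sup>+t'. dens m t t' \<partial>lborel \<partial>lborel) =
    reg m {..<0} {0<..<m} + reg m {..<0} {m<..<1} + reg m {..<0} {1<..} + reg m {0<..<m} {0<..<m}
    + reg m {0<..<m} {m<..<1} + reg m {0<..<m} {1<..} + reg m {m<..<1} {m<..<1} + reg m {m<..<1} {1<..}"
proof -
  let ?r = "\<lambda>A B t t'. indicator A t * (indicator B t' * dens m t t') :: ennreal"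
  let ?s = "\<lambda>t t'. ?r {..<0} {0<..<m} t t' + ?r {..<0} {m<..<1} t t' + ?r {..<0} {1<..} t t' + ?r {0<..<m} {0<..<m} t t'
    + ?r {0<..<m} {m<..<1} t t' + ?r {0<..<m} {1<..} t t' + ?r {m<..<1} {m<..<1} t t' + ?r {m<..<1} {1<..} t t'"
  have generic: "AE t in lborel. t \<noteq> 0 \<and> t \<noteq> m \<and> t \<noteq> 1"
    using AE_lborel_singleton[of 0] AE_lborel_singleton[of m] AE_lborel_singleton[of 1] by eventually_elim auto
  have "(\<integral>\<^sup>+t. \<integral>\<^sup>+t'. dens m t t' \<partial>lborel \<partial>lborel) = (\<integral>\<^sup>+t. \<integral>\<^sup>+t'. ?s t t' \<partial>lborel \<partial>lborel)"
  proof (rule nn_integral_cong_AE)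
    show "AE t in lborel. (\<integral>\<^sup>+t'. dens m t t' \<partial>lborel) = (\<integral>\<^sup>+t'. ?s t t' \<partial>lborel)"
      using generic
    proof eventually_elim
      case t: (elim t)
      show ?case
      proof (rule nn_integral_cong_AE)
        show "AE t' in lborel. dens m t t' = ?s t t'"
          using generic
        proof eventually_elim
          case (elim t')
          have zero: "dens m t t' = 0" if "t' < 0 \<or> 1 < t \<or> t' \<le> t"
          proof (cases "t' \<le> t")
            case False
            then show ?thesis using that dens_eq_0[OF m, of t' t] by simp
          qed (simp add: dens_def)
          show ?case
          proof (cases "t' < 0 \<or> 1 < t \<or> t' \<le> t")
            case True
            then show ?thesis by (simp add: zero)
          next
            case False
            then have less: "0 \<le> t'" "t \<le> 1" "t < t'" by auto
            have T: "t < 0 \<or> (0 < t \<and> t < m) \<or> (m < t \<and> t < 1)"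
              using t less(2) by auto
            have T': "(0 < t' \<and> t' < m) \<or> (m < t' \<and> t' < 1) \<or> 1 < t'"
              using elim less(1) by auto
            from T T' less(3) m show ?thesis
              by (elim disjE conjE; (simp; fail | linarith))
          qed
        qed
      qed
    qed
  qed
  also have "\<dots> = reg m {..<0} {0<..<m} + reg m {..<0} {m<..<1} + reg m {..<0} {1<..} + reg m {0<..<m} {0<..<m}
    + reg m {0<..<m} {m<..<1} + reg m {0<..<m} {1<..} + reg m {m<..<1} {m<..<1} + reg m {m<..<1} {1<..}"
    unfolding reg_def
    by (intro trans[OF nn_integral2_add] arg_cong2[where f = "(+)"] refl; measurable)
  finally show ?thesis .
qed

lemma nn_integral_flip:
  fixes f :: "real \<Rightarrow> ennreal"
  assumes [measurable]: "f \<in> borel_measurable borel"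
  shows "(\<integral>\<^sup>+x. f x \<partial>lborel) = (\<integral>\<^sup>+x. f (1 - x) \<partial>lborel)"
  by (subst nn_integral_real_affine[of _ "-1" 1]) auto

lemma reg_reflect:
  assumes [measurable]: "A \<in> sets borel" "B \<in> sets borel" "A' \<in> sets borel" "B' \<in> sets borel"
    and A: "\<And>t. 1 - t \<in> A \<longleftrightarrow> t \<in> A'" and B: "\<And>t. 1 - t \<in> B \<longleftrightarrow> t \<in> B'"
  shows "reg (1 - m) A B = reg m B' A'"
proof -
  have "reg (1 - m) A B = (\<integral>\<^sup>+t. \<integral>\<^sup>+t'. indicator A (1 - t) * (indicator B (1 - t') * dens (1 - m) (1 - t) (1 - t')) \<partial>lborel \<partial>lborel)"
  proof -
    have "reg (1 - m) A B = (\<integral>\<^sup>+t. \<integral>\<^sup>+t'. indicator A (1 - t) * (indicator B t' * dens (1 - m) (1 - t) t') \<partial>lborel \<partial>lborel)"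
      unfolding reg_def by (rule nn_integral_flip) measurable
    also have "\<dots> = (\<integral>\<^sup>+t. \<integral>\<^sup>+t'. indicator A (1 - t) * (indicator B (1 - t') * dens (1 - m) (1 - t) (1 - t')) \<partial>lborel \<partial>lborel)"
      by (intro nn_integral_cong nn_integral_flip) measurable
    finally show ?thesis .
  qed
  also have "\<dots> = (\<integral>\<^sup>+t. \<integral>\<^sup>+t'. indicator B' t' * (indicator A' t * dens m t' t) \<partial>lborel \<partial>lborel)"
    unfolding dens_reflect by (intro nn_integral_cong) (simp add: A B indicator_def)
  also have "\<dots> = reg m B' A'"
    unfolding reg_def by (rule nn_integral_lborel_swap) simp
  finally show ?thesis .
qed

text \<open>Three cells are reflections of the quadrilateral, corner and trapezoid cells. The whole
  triangle and the pentagons are the cells that reflect to themselves.\<close>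

lemma reg_mirror:
  "reg m {0<..<m} {1<..} = reg (1 - m) {..<0} {1 - m<..<1}"
  "reg m {m<..<1} {1<..} = reg (1 - m) {..<0} {0<..<1 - m}"
  "reg m {m<..<1} {m<..<1} = reg (1 - m) {0<..<1 - m} {0<..<1 - m}"
  by (rule reg_reflect[symmetric]; auto)+

text \<open>The only piece removed is the corner at the vertex \<open>(0, 1)\<close>; its relative
  size \<open>s\<close> replaces \<open>t' = 1 - n s\<close> as variable.\<close>

lemma reg_quad:
  assumes m: "0 < m" "m < 1"
  shows "reg m {..<0} {m<..<1} = (\<integral>\<^sup>+s. indicator {0<..<1} s * ennreal (quad_dens (1 - m) s) \<partial>lborel)"
proof -
  define n where "n = 1 - m"
  have n: "0 < n" "n < 1" and mn: "m = 1 - n" using m by (auto simp: n_def)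
  have "reg m {..<0} {m<..<1} = (\<integral>\<^sup>+t'. indicator {m<..<1} t' * (\<integral>\<^sup>+t. indicator {..<0} t * dens m t t' \<partial>lborel) \<partial>lborel)"
    by (rule reg_swap) auto
  also have "\<dots> = ennreal n * (\<integral>\<^sup>+s. indicator {m<..<1} (1 - n * s) * (\<integral>\<^sup>+t. indicator {..<0} t * dens m t (1 - n * s) \<partial>lborel) \<partial>lborel)"
    using n by (subst nn_integral_real_affine[of _ "- n" 1]) auto
  also have "\<dots> = (\<integral>\<^sup>+s. ennreal n * (indicator {m<..<1} (1 - n * s) * (\<integral>\<^sup>+t. indicator {..<0} t * dens m t (1 - n * s) \<partial>lborel)) \<partial>lborel)"
    by (subst nn_integral_cmult) auto
  also have "\<dots> = (\<integral>\<^sup>+s. indicator {0<..<1} s * ennreal (quad_dens n s) \<partial>lborel)"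
  proof (rule nn_integral_cong)
    fix s :: real
    have "1 - n * s \<in> {m<..<1} \<longleftrightarrow> s \<in> {0<..<1}"
      using n by (auto simp: mn zero_less_mult_iff)
    then have "indicator {m<..<1} (1 - n * s) = (indicator {0<..<1} s :: ennreal)"
      by (simp add: indicator_def)
    then show "ennreal n * (indicator {m<..<1} (1 - n * s) * (\<integral>\<^sup>+t. indicator {..<0} t * dens m t (1 - n * s) \<partial>lborel)) =
        indicator {0<..<1} s * ennreal (quad_dens n s)"
      using quad_inner(1)[OF n, of s] by (auto simp: mn split: split_indicator)
  qed
  finally show ?thesis by (simp add: n_def)
qed

text \<open>\<open>x\<close> and \<open>y\<close> are the distances of the two levels from
  \<open>m = 1 - n\<close>, relative to the available room \<open>m\<close> and \<open>n\<close>. In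
  these variables the reflection is simply \<open>(n, x, y)\<close> to \<open>(1 - n, y, x)\<close>.
  The factor \<open>n (1 - n)\<close> is the Jacobian.\<close>

definition pent_kernel :: "real \<Rightarrow> real \<Rightarrow> real \<Rightarrow> ennreal" where
  "pent_kernel n x y = ennreal (n * (1 - n)) * dens (1 - n) ((1 - n) * (1 - x)) (1 - n * (1 - y))"

lemma measurable_pent_kernel [measurable (raw)]:
  assumes [measurable]: "n \<in> borel_measurable M" "x \<in> borel_measurable M" "y \<in> borel_measurable M"
  shows "(\<lambda>z. pent_kernel (n z) (x z) (y z)) \<in> borel_measurable M"
  unfolding pent_kernel_def by measurable

lemma pent_kernel_mirror: "pent_kernel (1 - n) y x = pent_kernel n x y"
  using dens_reflect[of "1 - n" "1 - n * (1 - y)" "(1 - n) * (1 - x)"]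
  by (simp add: pent_kernel_def mult.commute)

lemma reg_pent:
  assumes m: "0 < m" "m < 1"
  shows "reg m {0<..<m} {m<..<1} = (\<integral>\<^sup>+x. \<integral>\<^sup>+y. indicator {0<..<1} x * (indicator {0<..<1} y * pent_kernel (1 - m) x y) \<partial>lborel \<partial>lborel)"
proof -
  define n where "n = 1 - m"
  have n: "0 < n" "n < 1" and mn: "m = 1 - n" using m by (auto simp: n_def)
  have "reg m {0<..<m} {m<..<1} = ennreal m * (\<integral>\<^sup>+x. \<integral>\<^sup>+t'. indicator {0<..<m} (m - m * x) * (indicator {m<..<1} t' * dens m (m - m * x) t') \<partial>lborel \<partial>lborel)"
    unfolding reg_def using m by (subst nn_integral_real_affine[of _ "- m" m]) auto
  also have "\<dots> = ennreal m * (\<integral>\<^sup>+x. ennreal n * (\<integral>\<^sup>+y. indicator {0<..<m} (m - m * x) * (indicator {m<..<1} (m + n * y) * dens m (m - m * x) (m + n * y)) \<partial>lborel) \<partial>lborel)"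
    using n by (subst (2) nn_integral_real_affine[of _ n m]) auto
  also have "\<dots> = (\<integral>\<^sup>+x. \<integral>\<^sup>+y. ennreal m * (ennreal n * (indicator {0<..<m} (m - m * x) * (indicator {m<..<1} (m + n * y) * dens m (m - m * x) (m + n * y)))) \<partial>lborel \<partial>lborel)"
    by (simp add: nn_integral_cmult)
  also have "\<dots> = (\<integral>\<^sup>+x. \<integral>\<^sup>+y. indicator {0<..<1} x * (indicator {0<..<1} y * pent_kernel n x y) \<partial>lborel \<partial>lborel)"
  proof (intro nn_integral_cong)
    fix x y :: real
    have "m - m * x \<in> {0<..<m} \<longleftrightarrow> x \<in> {0<..<1}"
      using m by (auto simp: zero_less_mult_iff)
    then have 1: "indicator {0<..<m} (m - m * x) = (indicator {0<..<1} x :: ennreal)"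
      by (simp add: indicator_def)
    have "m + n * y \<in> {m<..<1} \<longleftrightarrow> y \<in> {0<..<1}"
      using n by (auto simp: mn zero_less_mult_iff)
    then have 2: "indicator {m<..<1} (m + n * y) = (indicator {0<..<1} y :: ennreal)"
      by (simp add: indicator_def)
    have 3: "m - m * x = (1 - n) * (1 - x)" "m + n * y = 1 - n * (1 - y)" "ennreal m * ennreal n = ennreal (n * (1 - n))"
      using n by (simp_all add: mn algebra_simps ennreal_mult'[symmetric])
    have "ennreal m * (ennreal n * (indicator {0<..<m} (m - m * x) * (indicator {m<..<1} (m + n * y) * dens m (m - m * x) (m + n * y))))
       = indicator {0<..<1} x * (indicator {0<..<1} y * ((ennreal m * ennreal n) * dens m (m - m * x) (m + n * y)))"
      unfolding 1 2 by (simp add: mult_ac)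
    then show "ennreal m * (ennreal n * (indicator {0<..<m} (m - m * x) * (indicator {m<..<1} (m + n * y) * dens m (m - m * x) (m + n * y))))
       = indicator {0<..<1} x * (indicator {0<..<1} y * pent_kernel n x y)"
      unfolding 3 pent_kernel_def unfolding mn .
  qed
  finally show ?thesis by (simp add: n_def)
qed

text \<open>Each coefficient polynomial enters through continuity on the plane, so that only short
  expressions in these coefficients remain to be shown measurable.\<close>

lemma measurable_pent_quad [measurable (raw)]:
  assumes [measurable]: "n \<in> borel_measurable M" "s \<in> borel_measurable M"
  shows "(\<lambda>z. pent_dens (n z) (s z)) \<in> borel_measurable M" "(\<lambda>z. quad_dens (n z) (s z)) \<in> borel_measurable M"
proof -
  have "continuous_on UNIV (\<lambda>P::real\<times>real. dc0 (fst P) (snd P))"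
    unfolding dc0_def by (intro continuous_intros)
  from borel_measurable_continuous_onI[OF this, THEN measurable_compose[rotated], of "\<lambda>z. (n z, s z)"]
  have [measurable]: "(\<lambda>z. dc0 (n z) (s z)) \<in> borel_measurable M"
    by simp
  have "continuous_on UNIV (\<lambda>P::real\<times>real. dc1 (fst P) (snd P))"
    unfolding dc1_def by (intro continuous_intros)
  from borel_measurable_continuous_onI[OF this, THEN measurable_compose[rotated], of "\<lambda>z. (n z, s z)"]
  have [measurable]: "(\<lambda>z. dc1 (n z) (s z)) \<in> borel_measurable M"
    by simp
  have "continuous_on UNIV (\<lambda>P::real\<times>real. dc2 (fst P) (snd P))"
    unfolding dc2_def by (intro continuous_intros)
  from borel_measurable_continuous_onI[OF this, THEN measurable_compose[rotated], of "\<lambda>z. (n z, s z)"]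
  have [measurable]: "(\<lambda>z. dc2 (n z) (s z)) \<in> borel_measurable M"
    by simp
  have "continuous_on UNIV (\<lambda>P::real\<times>real. dc3 (fst P) (snd P))"
    unfolding dc3_def by (intro continuous_intros)
  from borel_measurable_continuous_onI[OF this, THEN measurable_compose[rotated], of "\<lambda>z. (n z, s z)"]
  have [measurable]: "(\<lambda>z. dc3 (n z) (s z)) \<in> borel_measurable M"
    by simp
  have "continuous_on UNIV (\<lambda>P::real\<times>real. dc4 (fst P) (snd P))"
    unfolding dc4_def by (intro continuous_intros)
  from borel_measurable_continuous_onI[OF this, THEN measurable_compose[rotated], of "\<lambda>z. (n z, s z)"]
  have [measurable]: "(\<lambda>z. dc4 (n z) (s z)) \<in> borel_measurable M"
    by simp
  have "continuous_on UNIV (\<lambda>P::real\<times>real. dc5 (fst P) (snd P))"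
    unfolding dc5_def by (intro continuous_intros)
  from borel_measurable_continuous_onI[OF this, THEN measurable_compose[rotated], of "\<lambda>z. (n z, s z)"]
  have [measurable]: "(\<lambda>z. dc5 (n z) (s z)) \<in> borel_measurable M"
    by simp
  have "continuous_on UNIV (\<lambda>P::real\<times>real. wc0 (fst P) (snd P))"
    unfolding wc0_def by (intro continuous_intros)
  from borel_measurable_continuous_onI[OF this, THEN measurable_compose[rotated], of "\<lambda>z. (n z, s z)"]
  have [measurable]: "(\<lambda>z. wc0 (n z) (s z)) \<in> borel_measurable M"
    by simp
  have "continuous_on UNIV (\<lambda>P::real\<times>real. wc1 (fst P) (snd P))"
    unfolding wc1_def by (intro continuous_intros)
  from borel_measurable_continuous_onI[OF this, THEN measurable_compose[rotated], of "\<lambda>z. (n z, s z)"]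
  have [measurable]: "(\<lambda>z. wc1 (n z) (s z)) \<in> borel_measurable M"
    by simp
  have "continuous_on UNIV (\<lambda>P::real\<times>real. wc2 (fst P) (snd P))"
    unfolding wc2_def by (intro continuous_intros)
  from borel_measurable_continuous_onI[OF this, THEN measurable_compose[rotated], of "\<lambda>z. (n z, s z)"]
  have [measurable]: "(\<lambda>z. wc2 (n z) (s z)) \<in> borel_measurable M"
    by simp
  have "continuous_on UNIV (\<lambda>P::real\<times>real. wc3 (fst P) (snd P))"
    unfolding wc3_def by (intro continuous_intros)
  from borel_measurable_continuous_onI[OF this, THEN measurable_compose[rotated], of "\<lambda>z. (n z, s z)"]
  have [measurable]: "(\<lambda>z. wc3 (n z) (s z)) \<in> borel_measurable M"
    by simp
  show "(\<lambda>z. pent_dens (n z) (s z)) \<in> borel_measurable M"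
    unfolding pent_dens_def pent_sum_def by measurable
  show "(\<lambda>z. quad_dens (n z) (s z)) \<in> borel_measurable M"
    unfolding quad_dens_def det_mom_def by measurable
qed

text \<open>On the half \<open>y < x\<close> the substitution \<open>y = x (1 - s)\<close> has
  Jacobian \<open>x\<close> and, after exchanging the integrals, produces the inner integral of
  \<open>pentagon_inner\<close>.\<close>

lemma nn_integral_pent_half:
  assumes n: "0 < n" "n < 1"
  shows "(\<integral>\<^sup>+x. \<integral>\<^sup>+y. indicator {0<..<1} x * (indicator {0<..<1} y * (indicator {0<..} (x - y) * pent_kernel n x y)) \<partial>lborel \<partial>lborel)
    = (\<integral>\<^sup>+s. indicator {0<..<1} s * ennreal (pent_dens n s / 2) \<partial>lborel)"
proof -
  have "(\<integral>\<^sup>+x. \<integral>\<^sup>+y. indicator {0<..<1} x * (indicator {0<..<1} y * (indicator {0<..} (x - y) * pent_kernel n x y)) \<partial>lborel \<partial>lborel)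
    = (\<integral>\<^sup>+x. \<integral>\<^sup>+s. indicator {0<..<1} s * (indicator {0<..<1} x * (ennreal x * pent_kernel n x (x * (1 - s)))) \<partial>lborel \<partial>lborel)"
  proof (rule nn_integral_cong)
    fix x :: real
    show "(\<integral>\<^sup>+y. indicator {0<..<1} x * (indicator {0<..<1} y * (indicator {0<..} (x - y) * pent_kernel n x y)) \<partial>lborel)
     = (\<integral>\<^sup>+s. indicator {0<..<1} s * (indicator {0<..<1} x * (ennreal x * pent_kernel n x (x * (1 - s)))) \<partial>lborel)"
    proof (cases "x \<in> {0<..<1}")
      case True
      have "(\<integral>\<^sup>+y. indicator {0<..<1} x * (indicator {0<..<1} y * (indicator {0<..} (x - y) * pent_kernel n x y)) \<partial>lborel)
        = ennreal x * (\<integral>\<^sup>+s. indicator {0<..<1} x * (indicator {0<..<1} (x + (- x) * s) * (indicator {0<..} (x - (x + (- x) * s)) * pent_kernel n x (x + (- x) * s))) \<partial>lborel)"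
        using True by (subst nn_integral_real_affine[of _ "- x" x]) auto
      also have "\<dots> = (\<integral>\<^sup>+s. ennreal x * (indicator {0<..<1} x * (indicator {0<..<1} (x + (- x) * s) * (indicator {0<..} (x - (x + (- x) * s)) * pent_kernel n x (x + (- x) * s)))) \<partial>lborel)"
        by (subst nn_integral_cmult) auto
      also have "\<dots> = (\<integral>\<^sup>+s. indicator {0<..<1} s * (indicator {0<..<1} x * (ennreal x * pent_kernel n x (x * (1 - s)))) \<partial>lborel)"
      proof (rule nn_integral_cong)
        fix s :: real
        have "x + (- x) * s \<in> {0<..<1} \<and> x - (x + (- x) * s) \<in> {0<..} \<longleftrightarrow> s \<in> {0<..<1}"
        proof -
          have "x + (- x) * s = x * (1 - s)" by (simp add: algebra_simps)
          moreover have "x * (1 - s) < 1" if "0 < s" "s < 1"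
            using mult_strict_mono[of x 1 "1 - s" 1] that True by auto
          ultimately show ?thesis using True by (auto simp: zero_less_mult_iff)
        qed
        then have "indicator {0<..<1} (x + (- x) * s) * indicator {0<..} (x - (x + (- x) * s)) = (indicator {0<..<1} s :: ennreal)"
          by (auto simp: indicator_def)
        moreover have "x + (- x) * s = x * (1 - s)" by (simp add: algebra_simps)
        ultimately show "ennreal x * (indicator {0<..<1} x * (indicator {0<..<1} (x + (- x) * s) * (indicator {0<..} (x - (x + (- x) * s)) * pent_kernel n x (x + (- x) * s))))
          = indicator {0<..<1} s * (indicator {0<..<1} x * (ennreal x * pent_kernel n x (x * (1 - s))))"
          by (simp only: mult.assoc[symmetric]) (simp only: mult_ac)
      qed
      finally show ?thesis .
    qed auto
  qed
  also have "\<dots> = (\<integral>\<^sup>+s. \<integral>\<^sup>+x. indicator {0<..<1} s * (indicator {0<..<1} x * (ennreal x * pent_kernel n x (x * (1 - s)))) \<partial>lborel \<partial>lborel)"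
    by (rule nn_integral_lborel_swap) simp
  also have "\<dots> = (\<integral>\<^sup>+s. indicator {0<..<1} s * ennreal (pent_dens n s / 2) \<partial>lborel)"
    using pentagon_inner(1)[OF n]
    by (intro nn_integral_cong) (auto simp: nn_integral_cmult pent_kernel_def split: split_indicator)
  finally show ?thesis .
qed

text \<open>
  The reflection \<open>n \<mapsto> 1 - n\<close> exchanges the halves \<open>y < x\<close> and \<open>x < y\<close> of the square.
\<close>
lemma nn_integral_pent:
  "(\<integral>\<^sup>+n. indicator {0<..<1} n * (\<integral>\<^sup>+x. \<integral>\<^sup>+y. indicator {0<..<1} x * (indicator {0<..<1} y * pent_kernel n x y) \<partial>lborel \<partial>lborel) \<partial>lborel)
   = (\<integral>\<^sup>+n. \<integral>\<^sup>+s. indicator {0<..<1} n * (indicator {0<..<1} s * ennreal (pent_dens n s)) \<partial>lborel \<partial>lborel)"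
proof -
  define L where "L n = (\<integral>\<^sup>+x. \<integral>\<^sup>+y. indicator {0<..<1} x * (indicator {0<..<1} y * (indicator {0<..} (x - y) * pent_kernel n x y)) \<partial>lborel \<partial>lborel)" for n
  define U where "U n = (\<integral>\<^sup>+x. \<integral>\<^sup>+y. indicator {0<..<1} x * (indicator {0<..<1} y * (indicator {0<..} (y - x) * pent_kernel n x y)) \<partial>lborel \<partial>lborel)" for n
  have [measurable]: "L \<in> borel_measurable borel" "U \<in> borel_measurable borel"
    unfolding L_def[abs_def] U_def[abs_def] by measurable
  have split: "(\<integral>\<^sup>+x. \<integral>\<^sup>+y. indicator {0<..<1} x * (indicator {0<..<1} y * pent_kernel n x y) \<partial>lborel \<partial>lborel) = L n + U n" for n
  proof -
    have "(\<integral>\<^sup>+x. \<integral>\<^sup>+y. indicator {0<..<1} x * (indicator {0<..<1} y * pent_kernel n x y) \<partial>lborel \<partial>lborel)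
      = (\<integral>\<^sup>+x. \<integral>\<^sup>+y. indicator {0<..<1} x * (indicator {0<..<1} y * (indicator {0<..} (x - y) * pent_kernel n x y))
         + indicator {0<..<1} x * (indicator {0<..<1} y * (indicator {0<..} (y - x) * pent_kernel n x y)) \<partial>lborel \<partial>lborel)"
    proof (rule nn_integral_cong, rule nn_integral_cong_AE)
      fix x :: real
      show "AE y in lborel. indicator {0<..<1} x * (indicator {0<..<1} y * pent_kernel n x y) = indicator {0<..<1} x * (indicator {0<..<1} y * (indicator {0<..} (x - y) * pent_kernel n x y))
         + indicator {0<..<1} x * (indicator {0<..<1} y * (indicator {0<..} (y - x) * pent_kernel n x y))"
        using AE_lborel_singleton[of x]
      proof eventually_elim
        case (elim y)
        then consider "y < x" | "x < y" by linarith
        then show ?case by cases simp_all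
      qed
    qed
    also have "\<dots> = (\<integral>\<^sup>+x. (\<integral>\<^sup>+y. indicator {0<..<1} x * (indicator {0<..<1} y * (indicator {0<..} (x - y) * pent_kernel n x y)) \<partial>lborel)
         + (\<integral>\<^sup>+y. indicator {0<..<1} x * (indicator {0<..<1} y * (indicator {0<..} (y - x) * pent_kernel n x y)) \<partial>lborel) \<partial>lborel)"
      by (rule nn_integral_cong, rule nn_integral_add) measurable
    also have "\<dots> = L n + U n"
      unfolding L_def U_def by (rule nn_integral_add) measurable
    finally show ?thesis .
  qed
  have U: "U n = L (1 - n)" for n
  proof -
    have "U n = (\<integral>\<^sup>+y. \<integral>\<^sup>+x. indicator {0<..<1} x * (indicator {0<..<1} y * (indicator {0<..} (y - x) * pent_kernel n x y)) \<partial>lborel \<partial>lborel)"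
      unfolding U_def by (rule nn_integral_lborel_swap) simp
    also have "\<dots> = L (1 - n)"
      unfolding L_def by (intro nn_integral_cong) (simp add: pent_kernel_mirror mult_ac)
    finally show ?thesis .
  qed
  have "(\<integral>\<^sup>+n. indicator {0<..<1} n * U n \<partial>lborel) = (\<integral>\<^sup>+n. indicator {0<..<1} n * L n \<partial>lborel)"
  proof -
    have "(\<integral>\<^sup>+n. indicator {0<..<1} n * L n \<partial>lborel) = (\<integral>\<^sup>+n. indicator {0<..<1} (1 - n) * L (1 - n) \<partial>lborel)"
      by (rule nn_integral_flip) measurable
    also have "\<dots> = (\<integral>\<^sup>+n. indicator {0<..<1} n * U n \<partial>lborel)"
      unfolding U by (intro nn_integral_cong) (auto split: split_indicator)
    finally show ?thesis by simp
  qed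
  then have "(\<integral>\<^sup>+n. indicator {0<..<1} n * (L n + U n) \<partial>lborel) = (\<integral>\<^sup>+n. indicator {0<..<1} n * L n + indicator {0<..<1} n * L n \<partial>lborel)"
    by (simp add: distrib_left nn_integral_add)
  also have "\<dots> = (\<integral>\<^sup>+n. \<integral>\<^sup>+s. indicator {0<..<1} n * (indicator {0<..<1} s * ennreal (pent_dens n s)) \<partial>lborel \<partial>lborel)"
  proof (rule nn_integral_cong)
    fix n :: real
    show "indicator {0<..<1} n * L n + indicator {0<..<1} n * L n = (\<integral>\<^sup>+s. indicator {0<..<1} n * (indicator {0<..<1} s * ennreal (pent_dens n s)) \<partial>lborel)"
    proof (cases "n \<in> {0<..<1}")
      case True
      have "L n + L n = (\<integral>\<^sup>+s. indicator {0<..<1} s * ennreal (pent_dens n s / 2) + indicator {0<..<1} s * ennreal (pent_dens n s / 2) \<partial>lborel)"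
        unfolding L_def nn_integral_pent_half[OF True[unfolded greaterThanLessThan_iff, THEN conjunct1] True[unfolded greaterThanLessThan_iff, THEN conjunct2]]
        by (rule nn_integral_add[symmetric]) measurable
      also have "\<dots> = (\<integral>\<^sup>+s. indicator {0<..<1} s * ennreal (pent_dens n s) \<partial>lborel)"
      proof (rule nn_integral_cong)
        fix s :: real
        have "ennreal (pent_dens n s / 2) + ennreal (pent_dens n s / 2) = ennreal (pent_dens n s)" if "0 < s" "s < 1"
          using pentagon_inner(2)[of n s] True that by (subst ennreal_plus[symmetric]) auto
        then show "indicator {0<..<1} s * ennreal (pent_dens n s / 2) + indicator {0<..<1} s * ennreal (pent_dens n s / 2) = indicator {0<..<1} s * ennreal (pent_dens n s)"
          by (cases "s \<in> {0<..<1}") auto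
      qed
      finally show ?thesis using True by simp
    qed simp
  qed
  finally show ?thesis by (simp add: split)
qed

section \<open>Summation over all shapes\<close>

lemma nn_integral_unit_poly:
  fixes p F :: "real \<Rightarrow> real"
  assumes D: "\<And>x. (F has_real_derivative p x) (at x)" and c: "\<And>x. isCont p x"
    and nn: "\<And>x. 0 < x \<Longrightarrow> x < 1 \<Longrightarrow> 0 \<le> p x" and v: "v = F 1 - F 0"
  shows "(\<integral>\<^sup>+x. indicator {0<..<1} x * ennreal (p x) \<partial>lborel) = ennreal v"
  unfolding v by (rule nn_integral_FTC_open) (use D c nn in auto)

lemma nn_integral_unit_flip:
  fixes f :: "real \<Rightarrow> ennreal"
  assumes [measurable]: "f \<in> borel_measurable borel"
  shows "(\<integral>\<^sup>+x. indicator {0<..<1} x * f (1 - x) \<partial>lborel) = (\<integral>\<^sup>+x. indicator {0<..<1} x * f x \<partial>lborel)"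
proof -
  have "(\<integral>\<^sup>+x. indicator {0<..<1} x * f x \<partial>lborel) = (\<integral>\<^sup>+x. indicator {0<..<1} (1 - x) * f (1 - x) \<partial>lborel)"
    by (rule nn_integral_flip) measurable
  also have "\<dots> = (\<integral>\<^sup>+x. indicator {0<..<1} x * f (1 - x) \<partial>lborel)"
    by (intro nn_integral_cong) (auto split: split_indicator)
  finally show ?thesis ..
qed

lemma nn_integral_quad_pent:
  "(\<integral>\<^sup>+n. \<integral>\<^sup>+s. indicator {0<..<1} n * (indicator {0<..<1} s * ennreal (pent_dens n s)) \<partial>lborel \<partial>lborel)
   + 2 * (\<integral>\<^sup>+n. \<integral>\<^sup>+s. indicator {0<..<1} n * (indicator {0<..<1} s * ennreal (quad_dens n s)) \<partial>lborel \<partial>lborel)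
   = ennreal (6 / 52254720 * (1584871/600 - 16 * pi\<^sup>2))"
proof -
  have sum: "pent_dens n s + 2 * quad_dens n s = 6 / 52254720 * (beukers_num n s / (1 - n * s) ^ 6)"
    "0 \<le> pent_dens n s" "0 \<le> quad_dens n s" "0 < 1 - n * s"
    if "0 < n" "n < 1" "0 < s" "s < 1" for n s
    using quad_pent_sum[of n s] pentagon_inner(2)[OF that] quad_inner(2)[OF that] pos_one_minus_mult[OF that] by auto
  \<comment> \<open>The sign is inherited from the two densities, which are integrals of nonnegative
    functions.\<close>
  have nn: "0 \<le> beukers_num n s" if "0 < n" "n < 1" "0 < s" "s < 1" for n s
  proof -
    have "0 \<le> 6 / 52254720 * (beukers_num n s / (1 - n * s) ^ 6)"
      using sum(1-3)[OF that] by linarith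
    moreover have "0 < (1 - n * s) ^ 6" using sum(4)[OF that] by simp
    ultimately show ?thesis by (simp add: zero_le_divide_iff)
  qed
  have "(\<integral>\<^sup>+n. \<integral>\<^sup>+s. indicator {0<..<1} n * (indicator {0<..<1} s * ennreal (pent_dens n s)) \<partial>lborel \<partial>lborel)
   + 2 * (\<integral>\<^sup>+n. \<integral>\<^sup>+s. indicator {0<..<1} n * (indicator {0<..<1} s * ennreal (quad_dens n s)) \<partial>lborel \<partial>lborel)
   = (\<integral>\<^sup>+n. \<integral>\<^sup>+s. indicator {0<..<1} n * (indicator {0<..<1} s * ennreal (pent_dens n s)) + 2 * (indicator {0<..<1} n * (indicator {0<..<1} s * ennreal (quad_dens n s))) \<partial>lborel \<partial>lborel)"
    by (subst nn_integral2_add) (measurable, simp add: nn_integral_cmult)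
  also have "\<dots> = (\<integral>\<^sup>+n. \<integral>\<^sup>+s. ennreal (6 / 52254720) * (indicator {0<..<1} n * (indicator {0<..<1} s * ennreal (beukers_num n s / (1 - n * s) ^ 6))) \<partial>lborel \<partial>lborel)"
  proof (intro nn_integral_cong)
    fix n s :: real
    show "indicator {0<..<1} n * (indicator {0<..<1} s * ennreal (pent_dens n s)) + 2 * (indicator {0<..<1} n * (indicator {0<..<1} s * ennreal (quad_dens n s)))
      = ennreal (6 / 52254720) * (indicator {0<..<1} n * (indicator {0<..<1} s * ennreal (beukers_num n s / (1 - n * s) ^ 6)))"
    proof (cases "n \<in> {0<..<1} \<and> s \<in> {0<..<1}")
      case True
      then have *: "0 < n" "n < 1" "0 < s" "s < 1" by auto
      have "ennreal (pent_dens n s) + 2 * ennreal (quad_dens n s) = ennreal (pent_dens n s + 2 * quad_dens n s)"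
        using sum(2,3)[OF *] by (simp add: ennreal_mult')
      also have "\<dots> = ennreal (6 / 52254720) * ennreal (beukers_num n s / (1 - n * s) ^ 6)"
        unfolding sum(1)[OF *] by (rule ennreal_mult') simp
      finally show ?thesis using True by simp
    qed (auto split: split_indicator)
  qed
  also have "\<dots> = ennreal (6 / 52254720) * (\<integral>\<^sup>+n. \<integral>\<^sup>+s. indicator {0<..<1} n * (indicator {0<..<1} s * ennreal (beukers_num n s / (1 - n * s) ^ 6)) \<partial>lborel \<partial>lborel)"
    by (subst nn_integral_cmult[symmetric], unfold beukers_num_def, measurable) (intro nn_integral_cong nn_integral_cmult, measurable)
  also have "\<dots> = ennreal (6 / 52254720 * (1584871/600 - 16 * pi\<^sup>2))"
    by (subst nn_integral_beukers_num, rule nn, assumption+) (rule ennreal_mult'[symmetric], simp)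
  finally show ?thesis .
qed

text \<open>\<open>A\<close> collects the cells that come in mirror pairs: corner, quadrilateral and
  trapezoid. Since \<open>m\<close> and \<open>1 - m\<close> range over the same interval, each pair
  counts as twice one cell; the whole triangle (\<open>p3\<close>) and the pentagons
  (\<open>R\<close>) count once.\<close>

lemma nn_integral_dens:
  "(\<integral>\<^sup>+m. indicator {0<..<1} m * (\<integral>\<^sup>+t. \<integral>\<^sup>+t'. dens m t t' \<partial>lborel \<partial>lborel) \<partial>lborel)
   = ennreal (2 * (721 / 165888000 + 41767 / 580608000) + 7 / 165888 + 6 / 52254720 * (1584871/600 - 16 * pi\<^sup>2))"
proof -
  define p1 where "p1 m = 1/576 * (m ^ 4 / 600 + (1 + m) * m ^ 2 / 168 - m ^ 3 / 192)" for m :: real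
  define p3 where "p3 m = (m\<^sup>2 - m + 6) / 138240" for m :: real
  define p4 where "p4 m = 1/576 * (49/6 * ((1 + m) * m\<^sup>2 / 42 - m ^ 3 / 16) + 244/105 * m ^ 3 / 32 + 28319/1260 * m ^ 4 / 120)" for m :: real
  define Q where "Q m = (\<integral>\<^sup>+s. indicator {0<..<1} s * ennreal (quad_dens (1 - m) s) \<partial>lborel)" for m
  define R where "R m = (\<integral>\<^sup>+x. \<integral>\<^sup>+y. indicator {0<..<1} x * (indicator {0<..<1} y * pent_kernel m x y) \<partial>lborel \<partial>lborel)" for m
  define A where "A m = ennreal (p1 m) + Q m + ennreal (p4 m)" for m
  have [measurable]: "Q \<in> borel_measurable borel" "R \<in> borel_measurable borel"
    unfolding Q_def[abs_def] R_def[abs_def] by measurable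
  have [measurable]: "p1 \<in> borel_measurable borel" "p3 \<in> borel_measurable borel" "p4 \<in> borel_measurable borel"
    unfolding p1_def[abs_def] p3_def[abs_def] p4_def[abs_def] by measurable
  have [measurable]: "A \<in> borel_measurable borel"
    unfolding A_def[abs_def] by measurable
  let ?I = "\<lambda>f. (\<integral>\<^sup>+m. indicator {0<..<1} m * f m \<partial>lborel)"
  have "(\<integral>\<^sup>+t. \<integral>\<^sup>+t'. dens m t t' \<partial>lborel \<partial>lborel) = A m + A (1 - m) + ennreal (p3 m) + R (1 - m)" if m: "0 < m" "m < 1" for m
  proof -
    have m': "0 < 1 - m" "1 - m < 1" using m by auto
    have "(\<integral>\<^sup>+t. \<integral>\<^sup>+t'. dens m t t' \<partial>lborel \<partial>lborel) = ennreal (p1 m) + Q m + ennreal (p3 m) + ennreal (p4 m) + R (1 - m)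
       + Q (1 - m) + ennreal (p4 (1 - m)) + ennreal (p1 (1 - m))"
      unfolding nn_integral_dens_split[OF m] reg_mirror reg_corner[OF m] reg_corner[OF m'] reg_all[OF m] reg_trapezoid[OF m] reg_trapezoid[OF m']
        reg_quad[OF m] reg_quad[OF m'] reg_pent[OF m] p1_def p3_def p4_def Q_def R_def ..
    then show ?thesis by (simp add: A_def ac_simps)
  qed
  then have "?I (\<lambda>m. \<integral>\<^sup>+t. \<integral>\<^sup>+t'. dens m t t' \<partial>lborel \<partial>lborel) = ?I (\<lambda>m. A m + A (1 - m) + ennreal (p3 m) + R (1 - m))"
    by (intro nn_integral_cong) (auto split: split_indicator)
  also have "\<dots> = (\<integral>\<^sup>+m. indicator {0<..<1} m * A m + indicator {0<..<1} m * A (1 - m) + indicator {0<..<1} m * ennreal (p3 m) + indicator {0<..<1} m * R (1 - m) \<partial>lborel)"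
    by (simp add: distrib_left)
  also have "\<dots> = ?I A + ?I (\<lambda>m. A (1 - m)) + ?I (\<lambda>m. ennreal (p3 m)) + ?I (\<lambda>m. R (1 - m))"
    by (intro trans[OF nn_integral_add] arg_cong2[where f = "(+)"] refl; measurable)
  also have "\<dots> = ?I A + ?I A + ?I (\<lambda>m. ennreal (p3 m)) + ?I R"
    by (simp add: nn_integral_unit_flip)
  also have "?I A = (\<integral>\<^sup>+m. indicator {0<..<1} m * ennreal (p1 m) + indicator {0<..<1} m * Q m + indicator {0<..<1} m * ennreal (p4 m) \<partial>lborel)"
    by (simp add: distrib_left A_def)
  also have "\<dots> = ?I (\<lambda>m. ennreal (p1 m)) + ?I Q + ?I (\<lambda>m. ennreal (p4 m))"
    by (intro trans[OF nn_integral_add] arg_cong2[where f = "(+)"] refl; measurable)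
  also have "?I (\<lambda>m. ennreal (p1 m)) = ennreal (721 / 165888000)"
  proof (rule nn_integral_unit_poly)
    show "((\<lambda>m. 1/576 * (m ^ 5 / 3000 + m ^ 3 / 504 + m ^ 4 / 672 - m ^ 4 / 768)) has_real_derivative p1 m) (at m)" for m
      unfolding p1_def by (auto intro!: derivative_eq_intros simp: field_simps power2_eq_square power3_eq_cube)
    show "isCont p1 m" for m
      unfolding p1_def[abs_def] by (intro continuous_intros) auto
    show "0 \<le> p1 m" if "0 < m" "m < 1" for m
    proof -
      have "m ^ 3 \<le> m ^ 2" using that by (intro power_decreasing) auto
      moreover have "0 \<le> m ^ 4" "0 \<le> m ^ 3" using that by auto
      ultimately have "0 \<le> m ^ 4 / 600 + (m ^ 2 + m ^ 3) / 168 - m ^ 3 / 192"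
        unfolding add_divide_distrib using zero_le_power2[of m] by (simp add: field_simps)
      moreover have "(1 + m) * m ^ 2 = m ^ 2 + m ^ 3" by (simp add: algebra_simps power2_eq_square power3_eq_cube)
      ultimately show ?thesis unfolding p1_def by simp
    qed
  qed simp
  also have "?I (\<lambda>m. ennreal (p4 m)) = ennreal (41767 / 580608000)"
  proof (rule nn_integral_unit_poly)
    show "((\<lambda>m. 1/576 * (49/6 * (m ^ 3 / 126 + m ^ 4 / 168 - m ^ 4 / 64) + 244/105 * m ^ 4 / 128 + 28319/1260 * m ^ 5 / 600)) has_real_derivative p4 m) (at m)" for m
      unfolding p4_def by (auto intro!: derivative_eq_intros simp: field_simps power2_eq_square power3_eq_cube)
    show "isCont p4 m" for m
      unfolding p4_def[abs_def] by (intro continuous_intros) auto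
    show "0 \<le> p4 m" if "0 < m" "m < 1" for m
    proof -
      have eq: "p4 m = 1/576 * m\<^sup>2 * (7/36 + (7/36 - 49/96 + 61/840) * m + 28319/151200 * m\<^sup>2)"
        unfolding p4_def by (simp add: field_simps power_numeral_reduce)
      have "0 \<le> 7/36 + (7/36 - 49/96 + 61/840) * m + 28319/151200 * m\<^sup>2"
      proof -
        \<comment> \<open>The tangent of the parabola at \<open>2/3\<close>, close to the minimum of
          the quadratic above, reduces the claim to a linear inequality.\<close>
        have "4/3 * m - 4/9 \<le> m\<^sup>2"
          using zero_le_power2[of "m - 2/3"] by (simp add: power2_eq_square field_simps)
        then show ?thesis using that by simp
      qed
      then show ?thesis unfolding eq by (intro mult_nonneg_nonneg) auto
    qed
  qed simp
  also have "?I (\<lambda>m. ennreal (p3 m)) = ennreal (7 / 165888)"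
  proof (rule nn_integral_unit_poly)
    show "((\<lambda>m. (m ^ 3 / 3 - m ^ 2 / 2 + 6 * m) / 138240) has_real_derivative p3 m) (at m)" for m
      unfolding p3_def by (auto intro!: derivative_eq_intros)
    show "isCont p3 m" for m
      unfolding p3_def[abs_def] by (intro continuous_intros) auto
    show "0 \<le> p3 m" if "0 < m" "m < 1" for m
    proof -
      have "0 \<le> m\<^sup>2 - m + 6" using that zero_le_power2[of m] by linarith
      then show ?thesis by (simp add: p3_def)
    qed
  qed simp
  also have "?I Q = (\<integral>\<^sup>+n. \<integral>\<^sup>+s. indicator {0<..<1} n * (indicator {0<..<1} s * ennreal (quad_dens n s)) \<partial>lborel \<partial>lborel)"
  proof -
    have "?I Q = ?I (\<lambda>n. Q (1 - n))" by (rule nn_integral_unit_flip[symmetric]) measurable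
    then show ?thesis by (simp add: Q_def nn_integral_cmult)
  qed
  also have "?I R = (\<integral>\<^sup>+n. \<integral>\<^sup>+s. indicator {0<..<1} n * (indicator {0<..<1} s * ennreal (pent_dens n s)) \<partial>lborel \<partial>lborel)"
    unfolding R_def by (rule nn_integral_pent)
  finally have "?I (\<lambda>m. \<integral>\<^sup>+t. \<integral>\<^sup>+t'. dens m t t' \<partial>lborel \<partial>lborel)
    = 2 * (ennreal (721 / 165888000) + ennreal (41767 / 580608000)) + ennreal (7 / 165888)
      + ((\<integral>\<^sup>+n. \<integral>\<^sup>+s. indicator {0<..<1} n * (indicator {0<..<1} s * ennreal (pent_dens n s)) \<partial>lborel \<partial>lborel)
       + 2 * (\<integral>\<^sup>+n. \<integral>\<^sup>+s. indicator {0<..<1} n * (indicator {0<..<1} s * ennreal (quad_dens n s)) \<partial>lborel \<partial>lborel))"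
    by (simp only: mult_2 ac_simps)
  also have "\<dots> = ennreal (2 * (721 / 165888000 + 41767 / 580608000) + 7 / 165888 + 6 / 52254720 * (1584871/600 - 16 * pi\<^sup>2))"
  proof -
    have "pi\<^sup>2 \<le> 4\<^sup>2" using pi_less_4 pi_gt_zero by (intro power_mono) auto
    then have "0 \<le> 6 / 52254720 * (1584871/600 - 16 * pi\<^sup>2)" by simp
    then show ?thesis
      unfolding nn_integral_quad_pent by (simp add: ennreal_plus[symmetric] ennreal_mult'[symmetric] flip: ennreal_numeral del: ennreal_plus)
  qed
  finally show ?thesis .
qed

section \<open>Vertex heights as coordinates\<close>

text \<open>Two models of space are in use: nested pairs for iterated integrals,
  \<open>real ^ 3\<close> for matrices and determinants. Their measures are compared on
  boxes.\<close>

lemma lborel_vector3: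
  "lborel = distr (lborel :: (real \<times> real \<times> real) measure) borel (\<lambda>P. vector [fst P, fst (snd P), snd (snd P)] :: real ^ 3)"
proof (rule lborel_eqI)
  let ?g = "\<lambda>P. vector [fst P, fst (snd P), snd (snd P)] :: real ^ 3"
  have g: "?g = (\<lambda>P. fst P *\<^sub>R axis 1 1 + fst (snd P) *\<^sub>R axis 2 1 + snd (snd P) *\<^sub>R axis 3 1)"
    by (auto simp: fun_eq_iff vec_eq_iff forall_3 axis_def)
  have [measurable]: "?g \<in> borel_measurable borel"
    unfolding g by (intro borel_measurable_continuous_onI continuous_intros)
  show "sets (distr lborel borel ?g) = sets borel" by simp
  fix l u :: "real ^ 3" assume le: "\<And>b. b \<in> Basis \<Longrightarrow> l \<bullet> b \<le> u \<bullet> b"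
  have le': "l $ i \<le> u $ i" for i
    using le[of "axis i 1"] by (auto simp: Basis_vec_def inner_axis)
  have "emeasure (distr lborel borel ?g) (box l u) = emeasure lborel (?g -` box l u)"
    by (subst emeasure_distr) auto
  also have "?g -` box l u = box (l $ 1, l $ 2, l $ 3) (u $ 1, u $ 2, u $ 3)"
  proof (intro set_eqI)
    fix P :: "real \<times> real \<times> real"
    have "P \<in> ?g -` box l u \<longleftrightarrow> (l $ 1 < fst P \<and> fst P < u $ 1) \<and> (l $ 2 < fst (snd P) \<and> fst (snd P) < u $ 2) \<and> (l $ 3 < snd (snd P) \<and> snd (snd P) < u $ 3)"
      by (auto simp: mem_box_cart forall_3)
    also have "\<dots> \<longleftrightarrow> P \<in> box (l $ 1, l $ 2, l $ 3) (u $ 1, u $ 2, u $ 3)"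
      by (cases P) (auto simp: mem_box Basis_prod_def)
    finally show "P \<in> ?g -` box l u \<longleftrightarrow> P \<in> box (l $ 1, l $ 2, l $ 3) (u $ 1, u $ 2, u $ 3)" .
  qed
  also have "emeasure lborel \<dots> = ennreal ((u $ 1 - l $ 1) * ((u $ 2 - l $ 2) * (u $ 3 - l $ 3)))"
  proof -
    have B: "(Basis :: (real \<times> real \<times> real) set) = {(1, 0, 0), (0, 1, 0), (0, 0, 1)}"
      by (auto simp: Basis_prod_def zero_prod_def)
    have "(l $ 1, l $ 2, l $ 3) \<bullet> b \<le> (u $ 1, u $ 2, u $ 3) \<bullet> b" if "b \<in> Basis" for b
    proof -
      from that consider "b = (1, 0, 0)" | "b = (0, 1, 0)" | "b = (0, 0, 1)" unfolding B by blast
      then show ?thesis using le' by cases (simp_all only: inner_Pair inner_real_def mult_1_right mult_zero_right add_0_left add_0_right)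
    qed
    then have "emeasure lborel (box (l $ 1, l $ 2, l $ 3) (u $ 1, u $ 2, u $ 3)) = ennreal (\<Prod>b\<in>Basis. ((u $ 1, u $ 2, u $ 3) - (l $ 1, l $ 2, l $ 3)) \<bullet> b)"
      by (rule emeasure_lborel_box)
    then show ?thesis by (simp add: B)
  qed
  also have "(u $ 1 - l $ 1) * ((u $ 2 - l $ 2) * (u $ 3 - l $ 3)) = (\<Prod>b\<in>Basis. (u - l) \<bullet> b)"
  proof -
    have "(\<Prod>b\<in>Basis. (u - l) \<bullet> b) = (\<Prod>i\<in>UNIV. (u - l) $ i)"
    proof -
      have B: "(Basis :: (real ^ 3) set) = (\<lambda>i. axis i 1) ` UNIV" by (auto simp: Basis_vec_def)
      have "inj (\<lambda>i::3. axis i (1::real))" by (auto simp: inj_on_def axis_eq_axis)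
      then have "(\<Prod>b\<in>Basis. (u - l) \<bullet> b) = (\<Prod>i\<in>UNIV. (u - l) \<bullet> axis i 1)"
        unfolding B by (simp only: prod.reindex o_def)
      then show ?thesis by (simp only: inner_axis inner_real_def mult_1_right)
    qed
    moreover have "prod f (UNIV :: 3 set) = f 1 * (f 2 * f 3)" for f :: "3 \<Rightarrow> real"
      unfolding UNIV_3 by simp
    ultimately show ?thesis by (simp only: vector_minus_component)
  qed
  finally show "emeasure (distr lborel borel ?g) (box l u) = ennreal (\<Prod>b\<in>Basis. (u - l) \<bullet> b)" .
qed

lemma nn_integral_vector3:
  fixes f :: "real ^ 3 \<Rightarrow> ennreal"
  assumes "f \<in> borel_measurable borel"
  shows "(\<integral>\<^sup>+p. f p \<partial>lborel) = (\<integral>\<^sup>+x. \<integral>\<^sup>+y. \<integral>\<^sup>+z. f (vector [x, y, z]) \<partial>lborel \<partial>lborel \<partial>lborel)"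
proof -
  let ?g = "\<lambda>P. vector [fst P, fst (snd P), snd (snd P)] :: real ^ 3"
  have g: "?g = (\<lambda>P. fst P *\<^sub>R axis 1 1 + fst (snd P) *\<^sub>R axis 2 1 + snd (snd P) *\<^sub>R axis 3 1)"
    by (auto simp: fun_eq_iff vec_eq_iff forall_3 axis_def)
  have gm: "?g \<in> borel_measurable borel"
    unfolding g by (intro borel_measurable_continuous_onI continuous_intros)
  have m: "(\<lambda>P. f (?g P)) \<in> borel_measurable borel"
    using gm assms by (rule measurable_compose)
  have "(\<integral>\<^sup>+p. f p \<partial>lborel) = (\<integral>\<^sup>+P. f (?g P) \<partial>lborel)"
  proof -
    have "(\<integral>\<^sup>+p. f p \<partial>lborel) = (\<integral>\<^sup>+p. f p \<partial>(distr lborel borel ?g))"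
      using arg_cong[OF lborel_vector3, of "\<lambda>M. integral\<^sup>N M f"] .
    also have "\<dots> = (\<integral>\<^sup>+P. f (?g P) \<partial>lborel)"
      using gm assms by (intro nn_integral_distr) simp_all
    finally show ?thesis .
  qed
  also have "\<dots> = (\<integral>\<^sup>+x. \<integral>\<^sup>+Q. f (?g (x, Q)) \<partial>lborel \<partial>lborel)"
    by (rule nn_integral_lborel_pair[OF m])
  also have "\<dots> = (\<integral>\<^sup>+x. \<integral>\<^sup>+y. \<integral>\<^sup>+z. f (?g (x, y, z)) \<partial>lborel \<partial>lborel \<partial>lborel)"
  proof (rule nn_integral_cong)
    fix x :: real
    have "(\<lambda>Q. ?g (x, Q)) = (\<lambda>Q. x *\<^sub>R axis 1 1 + fst Q *\<^sub>R axis 2 1 + snd Q *\<^sub>R axis 3 1)"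
      by (auto simp: fun_eq_iff vec_eq_iff forall_3 axis_def)
    also have "\<dots> \<in> borel_measurable borel"
      by (intro borel_measurable_continuous_onI continuous_intros)
    finally have "(\<lambda>Q. f (?g (x, Q))) \<in> borel_measurable borel"
      using assms by (rule measurable_compose)
    then show "(\<integral>\<^sup>+Q. f (?g (x, Q)) \<partial>lborel) = (\<integral>\<^sup>+y. \<integral>\<^sup>+z. f (?g (x, y, z)) \<partial>lborel \<partial>lborel)"
      by (rule nn_integral_lborel_pair)
  qed
  finally show ?thesis by (simp only: fst_conv snd_conv)
qed

text \<open>Lebesgue measure is determined by its values on boxes. For the preimage of a box these
  come from the volume of a linear image, and nonnegative functions then follow from a density over
  the image measure.\<close>

lemma nn_integral_linear_cart:
  fixes f :: "real ^ 3 \<Rightarrow> ennreal" and A :: "real ^ 3 ^ 3"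
  assumes [measurable]: "f \<in> borel_measurable borel" and A: "det A \<noteq> 0"
  shows "(\<integral>\<^sup>+p. f p \<partial>lborel) = ennreal \<bar>det A\<bar> * (\<integral>\<^sup>+p. f (c + A *v p) \<partial>lborel)"
proof -
  let ?g = "\<lambda>p. c + A *v p"
  have [measurable]: "?g \<in> borel_measurable borel"
    by (intro borel_measurable_continuous_onI continuous_intros matrix_vector_mult_linear_continuous_on)
  have "lborel = density (distr lborel borel ?g) (\<lambda>_. ennreal \<bar>det A\<bar>)"
  proof (rule lborel_eqI)
    show "sets (density (distr lborel borel ?g) (\<lambda>_. ennreal \<bar>det A\<bar>)) = sets borel" by simp
    fix l u :: "real ^ 3" assume le: "\<And>b. b \<in> Basis \<Longrightarrow> l \<bullet> b \<le> u \<bullet> b"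
    define S where "S = ?g -` box l u"
    obtain B where inv: "B ** A = mat 1" "A ** B = mat 1"
      using A invertible_det_nz[of A] by (auto simp: invertible_def)
    have S: "S = (\<lambda>p. B *v (p - c)) ` box l u"
    proof (intro set_eqI iffI)
      fix p assume "p \<in> S"
      then have "p = B *v (?g p - c)" "?g p \<in> box l u"
        by (simp_all add: S_def matrix_vector_mul_assoc inv)
      then show "p \<in> (\<lambda>p. B *v (p - c)) ` box l u" by blast
    qed (auto simp: S_def matrix_vector_mul_assoc inv)
    have "(\<lambda>p. B *v (p - c)) ` box l u = (*v) (B) ` ((\<lambda>p. p - c) ` box l u)"
      by (simp add: image_image)
    moreover have "bounded ((\<lambda>p. p - c) ` box l u)"
      using bounded_translation[OF bounded_box, of "- c" l u] by simp
    ultimately have "bounded S"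
      unfolding S using bounded_linear_image[OF _ matrix_vector_mul_bounded_linear] by metis
    moreover have S_borel: "S \<in> sets borel"
      unfolding S_def by (rule measurable_sets_borel) measurable
    ultimately have lm: "S \<in> lmeasurable"
      by (intro bounded_set_imp_lmeasurable) auto
    have fin: "emeasure lborel S < \<infinity>"
      using \<open>bounded S\<close> by (rule emeasure_bounded_finite)
    have "(*v) A ` S = (+) (- c) ` box l u"
      unfolding S by (simp add: image_image matrix_vector_mul_assoc inv)
    then have "measure lebesgue (box l u) = \<bar>det A\<bar> * measure lebesgue S"
      using measure_linear_image[OF matrix_vector_mul_linear[of A] lm] measure_translation[of "- c" "box l u"]
      by simp
    then have "measure lborel (box l u) = \<bar>det A\<bar> * measure lborel S"
      using S_borel by simp
    then have "ennreal (measure lborel (box l u)) = ennreal \<bar>det A\<bar> * emeasure lborel S"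
      using fin by (simp add: ennreal_mult emeasure_eq_ennreal_measure)
    moreover have "emeasure (density (distr lborel borel ?g) (\<lambda>_. ennreal \<bar>det A\<bar>)) (box l u) = ennreal \<bar>det A\<bar> * emeasure lborel S"
      by (simp add: emeasure_density nn_integral_cmult_indicator emeasure_distr S_def)
    ultimately show "emeasure (density (distr lborel borel ?g) (\<lambda>_. ennreal \<bar>det A\<bar>)) (box l u) = ennreal (\<Prod>b\<in>Basis. (u - l) \<bullet> b)"
      using le by (simp add: measure_lborel_box)
  qed
  then have "(\<integral>\<^sup>+p. f p \<partial>lborel) = (\<integral>\<^sup>+p. f p \<partial>(density (distr lborel borel ?g) (\<lambda>_. ennreal \<bar>det A\<bar>)))"
    by simp
  also have "\<dots> = (\<integral>\<^sup>+p. ennreal \<bar>det A\<bar> * f (?g p) \<partial>lborel)"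
    by (simp add: nn_integral_density nn_integral_distr)
  also have "\<dots> = ennreal \<bar>det A\<bar> * (\<integral>\<^sup>+p. f (?g p) \<partial>lborel)"
    by (rule nn_integral_cmult) measurable
  finally show ?thesis .
qed

text \<open>Six times the signed volume of the tetrahedron, expanded along the column of
  heights.\<close>

definition Det4 :: "real \<times> real \<Rightarrow> real \<Rightarrow> real \<times> real \<Rightarrow> real \<Rightarrow> real \<times> real \<Rightarrow> real \<Rightarrow> real \<times> real \<Rightarrow> real \<Rightarrow> real" where
  "Det4 P z P1 z1 P2 z2 P3 z3 = cross P P1 P2 * (z3 - z) - cross P P1 P3 * (z2 - z) + cross P P2 P3 * (z1 - z)"

lemma Det4_height:
  "Det4 P (height a b c P) P1 (height a b c P1) P2 (height a b c P2) P3 z = cross P P1 P2 * (z - height a b c P3)"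
  unfolding Det4_def cross_def height_def by algebra

lemma measurable_Det4 [measurable (raw)]:
  assumes [measurable]: "P \<in> borel_measurable M" "P1 \<in> borel_measurable M" "P2 \<in> borel_measurable M" "P3 \<in> borel_measurable M"
   "z \<in> borel_measurable M" "z1 \<in> borel_measurable M" "z2 \<in> borel_measurable M" "z3 \<in> borel_measurable M"
  shows "(\<lambda>x. Det4 (P x) (z x) (P1 x) (z1 x) (P2 x) (z2 x) (P3 x) (z3 x)) \<in> borel_measurable M"
  unfolding Det4_def by measurable

text \<open>The matrix with the barycentric coordinates of \<open>P\<close>, \<open>Q\<close>,
  \<open>R\<close> as rows sends the heights over the vertices to the heights over these points. Its
  determinant is \<open>cross P Q R\<close>.\<close>

lemma nn_integral_heights:
  fixes g :: "real \<Rightarrow> real \<Rightarrow> real \<Rightarrow> ennreal"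
  assumes g[measurable]: "(\<lambda>p::real^3. g (p $ 1) (p $ 2) (p $ 3)) \<in> borel_measurable borel" and d: "cross P Q R \<noteq> 0"
  shows "(\<integral>\<^sup>+x. \<integral>\<^sup>+y. \<integral>\<^sup>+z. g x y z \<partial>lborel \<partial>lborel \<partial>lborel) = ennreal \<bar>cross P Q R\<bar> *
     (\<integral>\<^sup>+p. g (height ((p :: real ^ 3) $ 1) (p $ 2) (p $ 3) P) (height (p $ 1) (p $ 2) (p $ 3) Q) (height (p $ 1) (p $ 2) (p $ 3) R) \<partial>lborel)"
proof -
  define A :: "real ^ 3 ^ 3" where "A = vector [vector [1 - fst P - snd P, fst P, snd P],
     vector [1 - fst Q - snd Q, fst Q, snd Q], vector [1 - fst R - snd R, fst R, snd R]]"
  have det: "det A = cross P Q R"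
    by (simp add: A_def det_3 cross_def algebra_simps)
  have h: "(0 + A *v p) $ 1 = height (p $ 1) (p $ 2) (p $ 3) P" "(0 + A *v p) $ 2 = height (p $ 1) (p $ 2) (p $ 3) Q" "(0 + A *v p) $ 3 = height (p $ 1) (p $ 2) (p $ 3) R" for p
    by (simp_all add: A_def matrix_vector_mult_def sum_3 height_def algebra_simps)
  have "(\<integral>\<^sup>+x. \<integral>\<^sup>+y. \<integral>\<^sup>+z. g x y z \<partial>lborel \<partial>lborel \<partial>lborel) = (\<integral>\<^sup>+p. g ((p :: real ^ 3) $ 1) (p $ 2) (p $ 3) \<partial>lborel)"
    by (subst nn_integral_vector3[OF g]) simp
  also have "\<dots> = ennreal \<bar>det A\<bar> * (\<integral>\<^sup>+p. g ((0 + A *v p) $ 1) ((0 + A *v p) $ 2) ((0 + A *v p) $ 3) \<partial>lborel)"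
    by (rule nn_integral_linear_cart[OF g]) (simp add: det d)
  finally show ?thesis by (simp only: det h)
qed

text \<open>Needed because the span \<open>c - a\<close> of the heights is the reciprocal of
  \<open>k = t' - t\<close>.\<close>

lemma nn_integral_inversion:
  fixes g :: "real \<Rightarrow> ennreal"
  assumes [measurable]: "g \<in> borel_measurable borel"
  shows "(\<integral>\<^sup>+k. indicator {0<..} k * (ennreal (1 / k\<^sup>2) * g (1 / k)) \<partial>lborel) = (\<integral>\<^sup>+x. indicator {0<..} x * g x \<partial>lborel)"
proof -
  define h where "h k = ennreal (1 / k\<^sup>2) * g (1 / k)" for k :: real
  have [measurable]: "h \<in> borel_measurable borel" unfolding h_def[abs_def] by measurable
  \<comment> \<open>Compact intervals that the inversion maps to themselves; the shift by 2 keeps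
    them nondegenerate.\<close>
  define A where "A n = {1 / real (n + 2) .. real (n + 2)}" for n
  have eq: "emeasure (density lborel h) (A n) = emeasure (density lborel g) (A n)" for n
  proof -
    define N where "N = real (n + 2)"
    have N: "2 \<le> N" by (simp add: N_def)
    have less: "1 / N < N"
    proof -
      have "1 / N < 1" using N by simp
      then show ?thesis using N by linarith
    qed
    \<comment> \<open>The substitution rule wants an increasing map, hence \<open>- 1 / x\<close>;
      the sign is undone by a reflection afterwards.\<close>
    have "(\<integral>\<^sup>+x. g (- x) * indicator {- 1 / (1 / N)..- 1 / N} x \<partial>lborel) = (\<integral>\<^sup>+x. g (- (- 1 / x)) * ennreal (1 / x\<^sup>2) * indicator {1 / N..N} x \<partial>lborel)"
    proof (rule nn_integral_substitution_aux[where g = "\<lambda>x. - 1 / x"])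
      show "((\<lambda>x. - 1 / x) has_real_derivative 1 / x\<^sup>2) (at x)" if "x \<in> {1 / N..N}" for x
      proof -
        have "0 < 1 / N" "1 / N \<le> x" using N that by auto
        then have "x \<noteq> 0" by linarith
        then show ?thesis by (auto intro!: derivative_eq_intros simp: power2_eq_square)
      qed
      show "continuous_on {1 / N..N} (\<lambda>x. 1 / x\<^sup>2)"
      proof (intro continuous_intros ballI)
        fix x assume "x \<in> {1 / N..N}"
        then have "1 / N \<le> x" by simp
        moreover have "0 < 1 / N" using N by simp
        ultimately have "0 < x" by linarith
        then show "x\<^sup>2 \<noteq> 0" by simp
      qed
    qed (use less in auto)
    also have "\<dots> = (\<integral>\<^sup>+x. h x * indicator {1 / N..N} x \<partial>lborel)"
      by (simp add: h_def mult_ac)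
    finally have 1: "(\<integral>\<^sup>+x. h x * indicator {1 / N..N} x \<partial>lborel) = (\<integral>\<^sup>+x. g (- x) * indicator {- N..- (1 / N)} x \<partial>lborel)"
      by simp
    also have "\<dots> = (\<integral>\<^sup>+x. g x * indicator {- N..- (1 / N)} (- x) \<partial>lborel)"
      by (subst nn_integral_real_affine[of _ "-1" 0]) auto
    also have "\<dots> = (\<integral>\<^sup>+x. g x * indicator {1 / N..N} x \<partial>lborel)"
      by (intro nn_integral_cong) (auto split: split_indicator)
    finally show ?thesis
      by (simp add: emeasure_density A_def N_def)
  qed
  have U: "(\<Union>n. A n) = {0<..}"
  proof (intro set_eqI iffI)
    fix x assume "x \<in> (\<Union>n. A n)"
    then obtain n where "1 / real (n + 2) \<le> x" by (auto simp: A_def)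
    moreover have "0 < 1 / real (n + 2)" by simp
    ultimately have "0 < x" by linarith
    then show "x \<in> {0<..}" by simp
  next
    fix x :: real assume "x \<in> {0<..}"
    then have x: "0 < x" by simp
    obtain n where n: "max x (1 / x) < real n" using reals_Archimedean2 by blast
    define N where "N = real (n + 2)"
    have "real n \<le> N" "0 < N" by (simp_all add: N_def)
    moreover have "1 / x < real n" "x < real n" using n by simp_all
    ultimately have "1 / x \<le> N" "x \<le> N" by linarith+
    moreover have "1 / N \<le> x"
      using \<open>1 / x \<le> N\<close> \<open>0 < N\<close> x by (simp add: divide_le_eq mult.commute)
    ultimately have "x \<in> A n" by (simp add: A_def N_def)
    then show "x \<in> (\<Union>n. A n)" by blast
  qed
  have inc: "incseq A"
  proof (rule incseq_SucI)
    fix n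
    have "1 / real (Suc n + 2) \<le> 1 / real (n + 2)" by (intro divide_left_mono) auto
    then show "A n \<le> A (Suc n)" by (auto simp: A_def)
  qed
  have incA: "(SUP n. emeasure M (A n)) = emeasure M (\<Union>n. A n)" if M: "sets M = sets borel" for M :: "real measure"
  proof (rule SUP_emeasure_incseq[OF _ inc])
    have "A n \<in> sets borel" for n unfolding A_def by (rule borel_closed) (rule closed_atLeastAtMost)
    then show "range A \<subseteq> sets M" unfolding M by blast
  qed
  have "emeasure (density lborel h) {0<..} = emeasure (density lborel g) {0<..}"
    unfolding U[symmetric] by (simp only: incA[symmetric] sets_density sets_lborel eq)
  then show ?thesis
    by (simp add: emeasure_density h_def[abs_def] mult.commute)
qed

section \<open>Sorting and normalising the vertex heights\<close>

definition sorted_Psi :: "real \<Rightarrow> real \<Rightarrow> real \<Rightarrow> ennreal" where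
  "sorted_Psi a b c = indicator {0<..} (b - a) * (indicator {0<..} (c - b) * Psi a b c)"

lemma measurable_sorted_Psi [measurable (raw)]:
  assumes [measurable]: "a \<in> borel_measurable M" "b \<in> borel_measurable M" "c \<in> borel_measurable M"
  shows "(\<lambda>x. sorted_Psi (a x) (b x) (c x)) \<in> borel_measurable M"
  unfolding sorted_Psi_def by measurable

text \<open>Away from coincident heights exactly one of the six orderings holds. \<open>Psi\<close>
  is symmetric, and exchanging the order of integration identifies the six contributions.\<close>

lemma nn_integral_Psi_sorted:
  "(\<integral>\<^sup>+a. \<integral>\<^sup>+b. \<integral>\<^sup>+c. Psi a b c \<partial>lborel \<partial>lborel \<partial>lborel)
    = 6 * (\<integral>\<^sup>+a. \<integral>\<^sup>+b. \<integral>\<^sup>+c. sorted_Psi a b c \<partial>lborel \<partial>lborel \<partial>lborel)"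
proof -
  let ?H = sorted_Psi
  let ?I = "\<lambda>G. (\<integral>\<^sup>+a. \<integral>\<^sup>+b. \<integral>\<^sup>+c. G a b c \<partial>lborel \<partial>lborel \<partial>lborel)"
  let ?S = "\<lambda>a b c. ?H a b c + ?H a c b + ?H b a c + ?H b c a + ?H c a b + ?H c b a"
  have split: "Psi a b c = ?S a b c" if "a \<noteq> b" "b \<noteq> c" "a \<noteq> c" for a b c
  proof -
    \<comment> \<open>The two transpositions of neighbouring arguments, from which every permutation
      is reached.\<close>
    have sym: "Psi y x z = Psi x y z" "Psi x z y = Psi x y z" for x y z
      by (metis Psi_swap Psi_reflect)+
    have *: "Psi a c b = Psi a b c" "Psi b a c = Psi a b c" "Psi b c a = Psi a b c" "Psi c a b = Psi a b c" "Psi c b a = Psi a b c"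
      by (metis sym)+
    have "(a < b \<and> b < c) \<or> (a < c \<and> c < b) \<or> (b < a \<and> a < c) \<or> (b < c \<and> c < a) \<or> (c < a \<and> a < b) \<or> (c < b \<and> b < a)"
      using that by auto
    then show ?thesis
      unfolding sorted_Psi_def * by (elim disjE conjE) simp_all
  qed
  have "?I Psi = ?I ?S"
  proof (rule nn_integral_cong, rule nn_integral_cong_AE)
    fix a :: real
    show "AE b in lborel. (\<integral>\<^sup>+c. Psi a b c \<partial>lborel) = (\<integral>\<^sup>+c. ?S a b c \<partial>lborel)"
      using AE_lborel_singleton[of a]
    proof eventually_elim
      case b: (elim b)
      have "AE c in lborel. Psi a b c = ?S a b c"
        using AE_lborel_singleton[of a] AE_lborel_singleton[of b]
        by eventually_elim (rule split, use b in auto)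
      then show ?case by (rule nn_integral_cong_AE)
    qed
  qed
  also have "\<dots> = (\<integral>\<^sup>+a. \<integral>\<^sup>+b. (\<integral>\<^sup>+c. ?H a b c \<partial>lborel) + (\<integral>\<^sup>+c. ?H a c b \<partial>lborel) + (\<integral>\<^sup>+c. ?H b a c \<partial>lborel)
      + (\<integral>\<^sup>+c. ?H b c a \<partial>lborel) + (\<integral>\<^sup>+c. ?H c a b \<partial>lborel) + (\<integral>\<^sup>+c. ?H c b a \<partial>lborel) \<partial>lborel \<partial>lborel)"
    by (rule nn_integral_cong, rule nn_integral_cong) (intro trans[OF nn_integral_add] arg_cong2[where f = "(+)"] refl; measurable)
  also have "\<dots> = ?I (\<lambda>a b c. ?H a b c) + ?I (\<lambda>a b c. ?H a c b) + ?I (\<lambda>a b c. ?H b a c) + ?I (\<lambda>a b c. ?H b c a) + ?I (\<lambda>a b c. ?H c a b) + ?I (\<lambda>a b c. ?H c b a)"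
    by (intro trans[OF nn_integral2_add] arg_cong2[where f = "(+)"] refl; measurable)
  also have "?I (\<lambda>a b c. ?H b c a) = ?I (\<lambda>a b c. ?H a c b)"
    by (rule nn_integral_lborel_swap) measurable
  also have "?I (\<lambda>a b c. ?H a c b) = ?I ?H"
    by (rule nn_integral_cong, rule nn_integral_lborel_swap) measurable
  also have "?I (\<lambda>a b c. ?H c b a) = ?I (\<lambda>a b c. ?H c a b)"
    by (rule nn_integral_lborel_swap) measurable
  also have "?I (\<lambda>a b c. ?H c a b) = ?I (\<lambda>a b c. ?H b a c)"
    by (rule nn_integral_cong, rule nn_integral_lborel_swap) measurable
  also have "?I (\<lambda>a b c. ?H b a c) = ?I ?H"
    by (rule nn_integral_lborel_swap) measurable
  also have "?I ?H + ?I ?H + ?I ?H + ?I ?H + ?I ?H + ?I ?H = 6 * ?I ?H"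
  proof -
    have "x + x + x + x + x + x = 6 * x" for x :: ennreal
    proof -
      have "6 * x = (1 + 1 + 1 + 1 + 1 + 1) * x" by simp
      then show ?thesis by (simp only: distrib_right mult_1)
    qed
    then show ?thesis .
  qed
  finally show ?thesis .
qed

text \<open>The change of variables \<open>a = - t / k\<close>, \<open>b = a + m / k\<close>,
  \<open>c = a + 1 / k\<close> with \<open>k = t' - t\<close> is made one variable at a time. The
  substitutions for \<open>t\<close> and \<open>m\<close> absorb one factor \<open>1 / k\<close>
  each, so that \<open>1 / k ^ 4\<close> shrinks to \<open>1 / k\<^sup>2\<close>, and the inversion
  of \<open>k\<close> absorbs the rest.\<close>

lemma nn_integral_dens_sorted:
  "(\<integral>\<^sup>+m. indicator {0<..<1} m * (\<integral>\<^sup>+t. \<integral>\<^sup>+t'. dens m t t' \<partial>lborel \<partial>lborel) \<partial>lborel)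
   = (\<integral>\<^sup>+a. \<integral>\<^sup>+b. \<integral>\<^sup>+c. indicator {0<..} (b - a) * (indicator {0<..} (c - b) * Psi a b c) \<partial>lborel \<partial>lborel \<partial>lborel)"
proof -
  have shift: "(\<integral>\<^sup>+t'. dens m t t' \<partial>lborel) = (\<integral>\<^sup>+k. indicator {0<..} k * (ennreal (1 / k ^ 4) * Psi (- t / k) ((m - t) / k) ((1 - t) / k)) \<partial>lborel)" for m t
    by (subst nn_integral_real_affine[of _ 1 t]) (auto intro!: nn_integral_cong simp: dens_def split: split_indicator)
  have scale_t: "(\<integral>\<^sup>+t. \<integral>\<^sup>+t'. dens m t t' \<partial>lborel \<partial>lborel)
    = (\<integral>\<^sup>+k. \<integral>\<^sup>+a. indicator {0<..} k * (ennreal (1 / k ^ 3) * Psi a (a + m / k) (a + 1 / k)) \<partial>lborel \<partial>lborel)" for m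
  proof -
    have "(\<integral>\<^sup>+t. \<integral>\<^sup>+t'. dens m t t' \<partial>lborel \<partial>lborel) = (\<integral>\<^sup>+k. \<integral>\<^sup>+t. indicator {0<..} k * (ennreal (1 / k ^ 4) * Psi (- t / k) ((m - t) / k) ((1 - t) / k)) \<partial>lborel \<partial>lborel)"
      unfolding shift by (rule nn_integral_lborel_swap) measurable
    also have "\<dots> = (\<integral>\<^sup>+k. \<integral>\<^sup>+a. indicator {0<..} k * (ennreal (1 / k ^ 3) * Psi a (a + m / k) (a + 1 / k)) \<partial>lborel \<partial>lborel)"
    proof (rule nn_integral_cong)
      fix k :: real
      show "(\<integral>\<^sup>+t. indicator {0<..} k * (ennreal (1 / k ^ 4) * Psi (- t / k) ((m - t) / k) ((1 - t) / k)) \<partial>lborel)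
        = (\<integral>\<^sup>+a. indicator {0<..} k * (ennreal (1 / k ^ 3) * Psi a (a + m / k) (a + 1 / k)) \<partial>lborel)"
      proof (cases "0 < k")
        case True
        have eq: "- (- k * a) / k = a" "(m - - k * a) / k = a + m / k" "(1 - - k * a) / k = a + 1 / k" for a
          using True by (auto simp: field_simps)
        have k: "ennreal k * ennreal (1 / k ^ 4) = ennreal (1 / k ^ 3)"
          using True by (simp add: ennreal_mult'[symmetric] power_numeral_reduce)
        have "(\<integral>\<^sup>+t. indicator {0<..} k * (ennreal (1 / k ^ 4) * Psi (- t / k) ((m - t) / k) ((1 - t) / k)) \<partial>lborel)
          = ennreal k * (\<integral>\<^sup>+a. indicator {0<..} k * (ennreal (1 / k ^ 4) * Psi a (a + m / k) (a + 1 / k)) \<partial>lborel)"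
        proof -
          have "(\<integral>\<^sup>+t. indicator {0<..} k * (ennreal (1 / k ^ 4) * Psi (- t / k) ((m - t) / k) ((1 - t) / k)) \<partial>lborel)
            = ennreal \<bar>- k\<bar> * (\<integral>\<^sup>+a. indicator {0<..} k * (ennreal (1 / k ^ 4) * Psi (- (0 + - k * a) / k) ((m - (0 + - k * a)) / k) ((1 - (0 + - k * a)) / k)) \<partial>lborel)"
            by (rule nn_integral_real_affine) (measurable, use True in simp)
          then show ?thesis using True by (simp only: add_0_left eq abs_minus_cancel abs_of_pos)
        qed
        also have "\<dots> = (\<integral>\<^sup>+a. ennreal k * (indicator {0<..} k * (ennreal (1 / k ^ 4) * Psi a (a + m / k) (a + 1 / k))) \<partial>lborel)"
          by (rule nn_integral_cmult[symmetric]) measurable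
        also have "\<dots> = (\<integral>\<^sup>+a. indicator {0<..} k * (ennreal (1 / k ^ 3) * Psi a (a + m / k) (a + 1 / k)) \<partial>lborel)"
          using True by (intro nn_integral_cong) (simp add: k[symmetric] mult.assoc)
        finally show ?thesis .
      qed simp
    qed
    finally show ?thesis .
  qed
  have scale_m: "(\<integral>\<^sup>+m. indicator {0<..<1} m * (indicator {0<..} k * (ennreal (1 / k ^ 3) * Psi a (a + m / k) (a + 1 / k))) \<partial>lborel)
    = (\<integral>\<^sup>+b. indicator {0<..} k * (ennreal (1 / k\<^sup>2) * (indicator {0<..<1} ((b - a) / (1 / k)) * Psi a b (a + 1 / k))) \<partial>lborel)" for k a
  proof (cases "0 < k")
    case True
    have eq: "a + (- (k * a) + k * b) / k = b" "- (k * a) + k * b = (b - a) / (1 / k)" for b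
      using True by (auto simp: field_simps)
    have k: "ennreal k * ennreal (1 / k ^ 3) = ennreal (1 / k\<^sup>2)"
      using True by (simp add: ennreal_mult'[symmetric] power_numeral_reduce power2_eq_square)
    have "(\<integral>\<^sup>+m. indicator {0<..<1} m * (indicator {0<..} k * (ennreal (1 / k ^ 3) * Psi a (a + m / k) (a + 1 / k))) \<partial>lborel)
      = ennreal \<bar>k\<bar> * (\<integral>\<^sup>+b. indicator {0<..<1} (- (k * a) + k * b) * (indicator {0<..} k * (ennreal (1 / k ^ 3) * Psi a (a + (- (k * a) + k * b) / k) (a + 1 / k))) \<partial>lborel)"
      using True by (intro nn_integral_real_affine) auto
    also have "\<dots> = ennreal k * (\<integral>\<^sup>+b. indicator {0<..<1} ((b - a) / (1 / k)) * (indicator {0<..} k * (ennreal (1 / k ^ 3) * Psi a b (a + 1 / k))) \<partial>lborel)"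
      unfolding eq(1) unfolding eq(2) using True by simp
    also have "\<dots> = (\<integral>\<^sup>+b. ennreal k * (indicator {0<..<1} ((b - a) / (1 / k)) * (indicator {0<..} k * (ennreal (1 / k ^ 3) * Psi a b (a + 1 / k)))) \<partial>lborel)"
      by (rule nn_integral_cmult[symmetric]) measurable
    also have "\<dots> = (\<integral>\<^sup>+b. indicator {0<..} k * (ennreal (1 / k\<^sup>2) * (indicator {0<..<1} ((b - a) / (1 / k)) * Psi a b (a + 1 / k))) \<partial>lborel)"
      using True by (intro nn_integral_cong) (simp add: k[symmetric] mult_ac)
    finally show ?thesis .
  qed simp
  have "(\<integral>\<^sup>+m. indicator {0<..<1} m * (\<integral>\<^sup>+t. \<integral>\<^sup>+t'. dens m t t' \<partial>lborel \<partial>lborel) \<partial>lborel)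
    = (\<integral>\<^sup>+m. \<integral>\<^sup>+k. \<integral>\<^sup>+a. indicator {0<..<1} m * (indicator {0<..} k * (ennreal (1 / k ^ 3) * Psi a (a + m / k) (a + 1 / k))) \<partial>lborel \<partial>lborel \<partial>lborel)"
    unfolding scale_t by (simp add: nn_integral_cmult)
  also have "\<dots> = (\<integral>\<^sup>+k. \<integral>\<^sup>+m. \<integral>\<^sup>+a. indicator {0<..<1} m * (indicator {0<..} k * (ennreal (1 / k ^ 3) * Psi a (a + m / k) (a + 1 / k))) \<partial>lborel \<partial>lborel \<partial>lborel)"
    by (rule nn_integral_lborel_swap) measurable
  also have "\<dots> = (\<integral>\<^sup>+k. \<integral>\<^sup>+a. \<integral>\<^sup>+m. indicator {0<..<1} m * (indicator {0<..} k * (ennreal (1 / k ^ 3) * Psi a (a + m / k) (a + 1 / k))) \<partial>lborel \<partial>lborel \<partial>lborel)"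
    by (rule nn_integral_cong, rule nn_integral_lborel_swap) measurable
  also have "\<dots> = (\<integral>\<^sup>+k. indicator {0<..} k * (ennreal (1 / k\<^sup>2) * (\<integral>\<^sup>+a. \<integral>\<^sup>+b. indicator {0<..<1} ((b - a) / (1 / k)) * Psi a b (a + 1 / k) \<partial>lborel \<partial>lborel)) \<partial>lborel)"
    unfolding scale_m by (simp add: nn_integral_cmult)
  \<comment> \<open>The new variable \<open>x = 1 / k\<close> is the span \<open>c - a\<close>, and
    \<open>1 / k\<^sup>2\<close> is its Jacobian.\<close>
  also have "\<dots> = (\<integral>\<^sup>+x. indicator {0<..} x * (\<integral>\<^sup>+a. \<integral>\<^sup>+b. indicator {0<..<1} ((b - a) / x) * Psi a b (a + x) \<partial>lborel \<partial>lborel) \<partial>lborel)"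
    by (rule nn_integral_inversion) measurable
  also have "\<dots> = (\<integral>\<^sup>+x. \<integral>\<^sup>+a. \<integral>\<^sup>+b. indicator {0<..} x * (indicator {0<..<1} ((b - a) / x) * Psi a b (a + x)) \<partial>lborel \<partial>lborel \<partial>lborel)"
    by (simp add: nn_integral_cmult)
  also have "\<dots> = (\<integral>\<^sup>+a. \<integral>\<^sup>+x. \<integral>\<^sup>+b. indicator {0<..} x * (indicator {0<..<1} ((b - a) / x) * Psi a b (a + x)) \<partial>lborel \<partial>lborel \<partial>lborel)"
    by (rule nn_integral_lborel_swap) measurable
  also have "\<dots> = (\<integral>\<^sup>+a. \<integral>\<^sup>+b. \<integral>\<^sup>+x. indicator {0<..} x * (indicator {0<..<1} ((b - a) / x) * Psi a b (a + x)) \<partial>lborel \<partial>lborel \<partial>lborel)"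
    by (rule nn_integral_cong, rule nn_integral_lborel_swap) measurable
  also have "\<dots> = (\<integral>\<^sup>+a. \<integral>\<^sup>+b. \<integral>\<^sup>+c. indicator {0<..} (b - a) * (indicator {0<..} (c - b) * Psi a b c) \<partial>lborel \<partial>lborel \<partial>lborel)"
  proof (rule nn_integral_cong, rule nn_integral_cong)
    fix a b :: real
    have "(\<integral>\<^sup>+c. indicator {0<..} (b - a) * (indicator {0<..} (c - b) * Psi a b c) \<partial>lborel)
      = (\<integral>\<^sup>+x. indicator {0<..} (b - a) * (indicator {0<..} (a + 1 * x - b) * Psi a b (a + 1 * x)) \<partial>lborel)"
      by (subst nn_integral_real_affine[of _ 1 a]) auto
    also have "\<dots> = (\<integral>\<^sup>+x. indicator {0<..} x * (indicator {0<..<1} ((b - a) / x) * Psi a b (a + x)) \<partial>lborel)"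
    proof (rule nn_integral_cong)
      fix x :: real
      have "(0 < b - a \<and> 0 < a + x - b) \<longleftrightarrow> (0 < x \<and> 0 < (b - a) / x \<and> (b - a) / x < 1)"
        by (auto simp: field_simps zero_less_divide_iff)
      then show "indicator {0<..} (b - a) * (indicator {0<..} (a + 1 * x - b) * Psi a b (a + 1 * x)) = indicator {0<..} x * (indicator {0<..<1} ((b - a) / x) * Psi a b (a + x))"
        by (auto split: split_indicator)
    qed
    finally show "(\<integral>\<^sup>+x. indicator {0<..} x * (indicator {0<..<1} ((b - a) / x) * Psi a b (a + x)) \<partial>lborel)
      = (\<integral>\<^sup>+c. indicator {0<..} (b - a) * (indicator {0<..} (c - b) * Psi a b c) \<partial>lborel)" ..
  qed
  finally show ?thesis .
qed

lemma nn_integral_Psi: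
  "(\<integral>\<^sup>+a. \<integral>\<^sup>+b. \<integral>\<^sup>+c. Psi a b c \<partial>lborel \<partial>lborel \<partial>lborel)
    = ennreal (6 * (2 * (721 / 165888000 + 41767 / 580608000) + 7 / 165888 + 6 / 52254720 * (1584871/600 - 16 * pi\<^sup>2)))"
proof -
  have "6 * ennreal x = ennreal (6 * x)" for x
    by (simp add: ennreal_mult')
  then show ?thesis
    unfolding nn_integral_Psi_sorted sorted_Psi_def nn_integral_dens_sorted[symmetric] nn_integral_dens .
qed

section \<open>From four points of the prism to planes\<close>

definition prism :: "real \<times> real \<Rightarrow> real \<Rightarrow> ennreal" where
  "prism P z = indicator unit_tri P * indicator {0..1} z"

lemma measurable_prism [measurable (raw)]:
  assumes [measurable]: "P \<in> borel_measurable M" "z \<in> borel_measurable M"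
  shows "(\<lambda>x. prism (P x) (z x)) \<in> borel_measurable M"
  unfolding prism_def by measurable

lemma prism_height: "prism P (height a b c P) = slab a b c P"
  by (simp add: prism_def slab_def)

definition gap_integral :: "real \<times> real \<Rightarrow> real \<Rightarrow> real \<times> real \<Rightarrow> real \<Rightarrow> real \<times> real \<Rightarrow> real \<Rightarrow> ennreal" where
  "gap_integral P z P1 z1 P2 z2 = (\<integral>\<^sup>+P3. \<integral>\<^sup>+z3. prism P3 z3 * ennreal \<bar>Det4 P z P1 z1 P2 z2 P3 z3\<bar> \<partial>lborel \<partial>lborel)"

lemma measurable_gap_integral [measurable (raw)]:
  assumes [measurable]: "P \<in> borel_measurable M" "P1 \<in> borel_measurable M" "P2 \<in> borel_measurable M"
   "z \<in> borel_measurable M" "z1 \<in> borel_measurable M" "z2 \<in> borel_measurable M"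
  shows "(\<lambda>x. gap_integral (P x) (z x) (P1 x) (z1 x) (P2 x) (z2 x)) \<in> borel_measurable M"
  unfolding gap_integral_def by measurable

lemma measurable_mean_gap [measurable (raw)]:
  assumes [measurable]: "a \<in> borel_measurable M" "b \<in> borel_measurable M" "c \<in> borel_measurable M"
  shows "(\<lambda>x. mean_gap (a x) (b x) (c x)) \<in> borel_measurable M"
  unfolding mean_gap_def by measurable

lemma gap_integral_height:
  "gap_integral P (height a b c P) P1 (height a b c P1) P2 (height a b c P2) = ennreal \<bar>cross P P1 P2\<bar> * mean_gap a b c"
proof -
  have "gap_integral P (height a b c P) P1 (height a b c P1) P2 (height a b c P2)
    = (\<integral>\<^sup>+P3. \<integral>\<^sup>+z3. ennreal \<bar>cross P P1 P2\<bar> * (indicator unit_tri P3 * (indicator {0..1} z3 * ennreal \<bar>z3 - height a b c P3\<bar>)) \<partial>lborel \<partial>lborel)"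
    unfolding gap_integral_def Det4_height abs_mult by (simp add: prism_def ennreal_mult mult_ac)
  also have "\<dots> = ennreal \<bar>cross P P1 P2\<bar> * mean_gap a b c"
    unfolding mean_gap_def by (simp add: nn_integral_cmult)
  finally show ?thesis .
qed

lemma measurable_vec_component [measurable (raw)]:
  fixes f :: "'a \<Rightarrow> real ^ 3"
  assumes "f \<in> borel_measurable M"
  shows "(\<lambda>x. f x $ i) \<in> borel_measurable M"
proof -
  have "(\<lambda>p :: real ^ 3. p $ i) \<in> borel_measurable borel"
    by (intro borel_measurable_continuous_onI continuous_intros)
  with assms show ?thesis by (rule measurable_compose)
qed

text \<open>The Jacobian of the vertex heights and the factor in \<open>gap_integral_height\<close>
  are both \<open>\<bar>cross P P1 P2\<bar>\<close>; together they form the square that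
  \<open>section_moment\<close> integrates.\<close>

lemma nn_integral_prism_heights:
  assumes d: "cross P P1 P2 \<noteq> 0"
  shows "(\<integral>\<^sup>+z. \<integral>\<^sup>+z1. \<integral>\<^sup>+z2. prism P z * (prism P1 z1 * (prism P2 z2 * gap_integral P z P1 z1 P2 z2)) \<partial>lborel \<partial>lborel \<partial>lborel)
    = (\<integral>\<^sup>+p. slab ((p :: real ^ 3) $ 1) (p $ 2) (p $ 3) P * (slab (p $ 1) (p $ 2) (p $ 3) P1 * (slab (p $ 1) (p $ 2) (p $ 3) P2 * ennreal ((cross P P1 P2)\<^sup>2))) * mean_gap (p $ 1) (p $ 2) (p $ 3) \<partial>lborel)"
proof -
  have sq: "ennreal \<bar>cross P P1 P2\<bar> * ennreal \<bar>cross P P1 P2\<bar> = ennreal ((cross P P1 P2)\<^sup>2)"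
    by (simp add: ennreal_mult[symmetric] power2_eq_square)
  have "(\<integral>\<^sup>+z. \<integral>\<^sup>+z1. \<integral>\<^sup>+z2. prism P z * (prism P1 z1 * (prism P2 z2 * gap_integral P z P1 z1 P2 z2)) \<partial>lborel \<partial>lborel \<partial>lborel)
    = ennreal \<bar>cross P P1 P2\<bar> * (\<integral>\<^sup>+p. slab ((p :: real ^ 3) $ 1) (p $ 2) (p $ 3) P * (slab (p $ 1) (p $ 2) (p $ 3) P1 * (slab (p $ 1) (p $ 2) (p $ 3) P2 * (ennreal \<bar>cross P P1 P2\<bar> * mean_gap (p $ 1) (p $ 2) (p $ 3)))) \<partial>lborel)"
    by (subst nn_integral_heights[OF _ d]) (measurable, simp add: prism_height gap_integral_height)
  also have "\<dots> = (\<integral>\<^sup>+p. ennreal \<bar>cross P P1 P2\<bar> * (slab ((p :: real ^ 3) $ 1) (p $ 2) (p $ 3) P * (slab (p $ 1) (p $ 2) (p $ 3) P1 * (slab (p $ 1) (p $ 2) (p $ 3) P2 * (ennreal \<bar>cross P P1 P2\<bar> * mean_gap (p $ 1) (p $ 2) (p $ 3))))) \<partial>lborel)"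
    by (rule nn_integral_cmult[symmetric]) measurable
  also have "\<dots> = (\<integral>\<^sup>+p. slab ((p :: real ^ 3) $ 1) (p $ 2) (p $ 3) P * (slab (p $ 1) (p $ 2) (p $ 3) P1 * (slab (p $ 1) (p $ 2) (p $ 3) P2 * ennreal ((cross P P1 P2)\<^sup>2))) * mean_gap (p $ 1) (p $ 2) (p $ 3) \<partial>lborel)"
    by (simp add: sq[symmetric] mult_ac)
  finally show ?thesis .
qed

lemma AE_pair_lborel:
  assumes "Measurable.pred borel (\<lambda>P::real\<times>real. Q P)" and Q: "AE x in lborel. AE y in lborel. Q (x, y)"
  shows "AE P in lborel. Q P"
proof -
  have "{P. Q P} \<in> sets borel"
    using assms(1) by (simp add: pred_def)
  then have "{P \<in> space (lborel \<Otimes>\<^sub>M lborel). Q P} \<in> sets (lborel \<Otimes>\<^sub>M lborel)"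
    by (simp only: lborel_prod space_lborel space_borel sets_lborel UNIV_I simp_thms)
  from lborel_pair.AE_pair_measure[OF this Q] show ?thesis by (simp only: lborel_prod)
qed

lemma AE_fst_neq: "AE P in lborel. fst (P :: real \<times> real) \<noteq> c"
proof (rule AE_pair_lborel)
  show "Measurable.pred borel (\<lambda>P::real\<times>real. fst P \<noteq> c)" by measurable
  show "AE x in lborel. AE y in lborel. fst (x, y :: real) \<noteq> c"
    using AE_lborel_singleton[of c] by eventually_elim simp
qed

lemma AE_cross_neq:
  assumes "fst P1 \<noteq> fst P"
  shows "AE P2 in lborel. cross P P1 P2 \<noteq> 0"
proof (rule AE_pair_lborel)
  show "Measurable.pred borel (\<lambda>P2. cross P P1 P2 \<noteq> 0)" by measurable
  show "AE x in lborel. AE y in lborel. cross P P1 (x, y) \<noteq> 0"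
  proof (rule AE_I2)
    fix x
    \<comment> \<open>The ordinate over \<open>x\<close> of the line through \<open>P\<close> and
      \<open>P1\<close>, the only one that makes the three points collinear.\<close>
    define y0 where "y0 = snd P + (x - fst P) * (snd P1 - snd P) / (fst P1 - fst P)"
    have neq: "cross P P1 (x, y) \<noteq> 0" if "y \<noteq> y0" for y
    proof
      assume "cross P P1 (x, y) = 0"
      then have "y = y0" using assms by (simp add: cross_def y0_def field_simps)
      with that show False by simp
    qed
    show "AE y in lborel. cross P P1 (x, y) \<noteq> 0"
      using AE_lborel_singleton[of y0] by eventually_elim (rule neq)
  qed
qed

text \<open>Tonelli moves the three heights innermost, where they are traded for a plane; collinear
  triples, for which this fails, are null. Then Tonelli moves the plane outermost, and the remaining
  integrals are \<open>Psi\<close>.\<close>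

lemma nn_integral_Det4:
  "(\<integral>\<^sup>+P. \<integral>\<^sup>+z. \<integral>\<^sup>+P1. \<integral>\<^sup>+z1. \<integral>\<^sup>+P2. \<integral>\<^sup>+z2. prism P z * (prism P1 z1 * (prism P2 z2 * gap_integral P z P1 z1 P2 z2)) \<partial>lborel \<partial>lborel \<partial>lborel \<partial>lborel \<partial>lborel \<partial>lborel)
   = (\<integral>\<^sup>+a. \<integral>\<^sup>+b. \<integral>\<^sup>+c. Psi a b c \<partial>lborel \<partial>lborel \<partial>lborel)"
proof -
  let ?f = "\<lambda>P z P1 z1 P2 z2. prism P z * (prism P1 z1 * (prism P2 z2 * gap_integral P z P1 z1 P2 z2))"
  let ?s = "\<lambda>p. slab ((p :: real ^ 3) $ 1) (p $ 2) (p $ 3)"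
  let ?g = "\<lambda>P P1 P2 p. ?s p P * (?s p P1 * (?s p P2 * ennreal ((cross P P1 P2)\<^sup>2))) * mean_gap (p $ 1) (p $ 2) (p $ 3)"
  have "(\<integral>\<^sup>+P. \<integral>\<^sup>+z. \<integral>\<^sup>+P1. \<integral>\<^sup>+z1. \<integral>\<^sup>+P2. \<integral>\<^sup>+z2. ?f P z P1 z1 P2 z2 \<partial>lborel \<partial>lborel \<partial>lborel \<partial>lborel \<partial>lborel \<partial>lborel)
    = (\<integral>\<^sup>+P. \<integral>\<^sup>+z. \<integral>\<^sup>+P1. \<integral>\<^sup>+P2. \<integral>\<^sup>+z1. \<integral>\<^sup>+z2. ?f P z P1 z1 P2 z2 \<partial>lborel \<partial>lborel \<partial>lborel \<partial>lborel \<partial>lborel \<partial>lborel)"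
    by (rule nn_integral_cong, rule nn_integral_cong, rule nn_integral_cong, rule nn_integral_lborel_swap) measurable
  also have "\<dots> = (\<integral>\<^sup>+P. \<integral>\<^sup>+P1. \<integral>\<^sup>+z. \<integral>\<^sup>+P2. \<integral>\<^sup>+z1. \<integral>\<^sup>+z2. ?f P z P1 z1 P2 z2 \<partial>lborel \<partial>lborel \<partial>lborel \<partial>lborel \<partial>lborel \<partial>lborel)"
    by (rule nn_integral_cong, rule nn_integral_lborel_swap) measurable
  also have "\<dots> = (\<integral>\<^sup>+P. \<integral>\<^sup>+P1. \<integral>\<^sup>+P2. \<integral>\<^sup>+z. \<integral>\<^sup>+z1. \<integral>\<^sup>+z2. ?f P z P1 z1 P2 z2 \<partial>lborel \<partial>lborel \<partial>lborel \<partial>lborel \<partial>lborel \<partial>lborel)"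
    by (rule nn_integral_cong, rule nn_integral_cong, rule nn_integral_lborel_swap) measurable
  also have "\<dots> = (\<integral>\<^sup>+P. \<integral>\<^sup>+P1. \<integral>\<^sup>+P2. \<integral>\<^sup>+p. ?g P P1 P2 p \<partial>lborel \<partial>lborel \<partial>lborel \<partial>lborel)"
  proof (rule nn_integral_cong, rule nn_integral_cong_AE)
    fix P :: "real \<times> real"
    show "AE P1 in lborel. (\<integral>\<^sup>+P2. \<integral>\<^sup>+z. \<integral>\<^sup>+z1. \<integral>\<^sup>+z2. ?f P z P1 z1 P2 z2 \<partial>lborel \<partial>lborel \<partial>lborel \<partial>lborel) = (\<integral>\<^sup>+P2. \<integral>\<^sup>+p. ?g P P1 P2 p \<partial>lborel \<partial>lborel)"
      using AE_fst_neq[of "fst P"]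
    proof eventually_elim
      case (elim P1)
      show ?case
      proof (rule nn_integral_cong_AE)
        show "AE P2 in lborel. (\<integral>\<^sup>+z. \<integral>\<^sup>+z1. \<integral>\<^sup>+z2. ?f P z P1 z1 P2 z2 \<partial>lborel \<partial>lborel \<partial>lborel) = (\<integral>\<^sup>+p. ?g P P1 P2 p \<partial>lborel)"
          using AE_cross_neq[OF elim] by eventually_elim (rule nn_integral_prism_heights)
      qed
    qed
  qed
  also have "\<dots> = (\<integral>\<^sup>+P. \<integral>\<^sup>+P1. \<integral>\<^sup>+p. \<integral>\<^sup>+P2. ?g P P1 P2 p \<partial>lborel \<partial>lborel \<partial>lborel \<partial>lborel)"
    by (rule nn_integral_cong, rule nn_integral_cong, rule nn_integral_lborel_swap) measurable
  also have "\<dots> = (\<integral>\<^sup>+P. \<integral>\<^sup>+p. \<integral>\<^sup>+P1. \<integral>\<^sup>+P2. ?g P P1 P2 p \<partial>lborel \<partial>lborel \<partial>lborel \<partial>lborel)"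
    by (rule nn_integral_cong, rule nn_integral_lborel_swap) measurable
  also have "\<dots> = (\<integral>\<^sup>+p. \<integral>\<^sup>+P. \<integral>\<^sup>+P1. \<integral>\<^sup>+P2. ?g P P1 P2 p \<partial>lborel \<partial>lborel \<partial>lborel \<partial>lborel)"
    by (rule nn_integral_lborel_swap) measurable
  also have "\<dots> = (\<integral>\<^sup>+p. Psi ((p :: real ^ 3) $ 1) (p $ 2) (p $ 3) \<partial>lborel)"
  proof (rule nn_integral_cong)
    fix p :: "real ^ 3"
    have "(\<integral>\<^sup>+P2. ?g P P1 P2 p \<partial>lborel) = ?s p P * (?s p P1 * (\<integral>\<^sup>+P2. ?s p P2 * ennreal ((cross P P1 P2)\<^sup>2) \<partial>lborel)) * mean_gap (p $ 1) (p $ 2) (p $ 3)" for P P1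
      by (subst nn_integral_multc, measurable, subst nn_integral_cmult, measurable, subst nn_integral_cmult, measurable)
    moreover have "(\<integral>\<^sup>+P1. ?s p P * (?s p P1 * (\<integral>\<^sup>+P2. ?s p P2 * ennreal ((cross P P1 P2)\<^sup>2) \<partial>lborel)) * mean_gap (p $ 1) (p $ 2) (p $ 3) \<partial>lborel)
       = ?s p P * (\<integral>\<^sup>+P1. ?s p P1 * (\<integral>\<^sup>+P2. ?s p P2 * ennreal ((cross P P1 P2)\<^sup>2) \<partial>lborel) \<partial>lborel) * mean_gap (p $ 1) (p $ 2) (p $ 3)" for P
      by (subst nn_integral_multc, measurable, subst nn_integral_cmult, measurable)
    moreover have "(\<integral>\<^sup>+P. ?s p P * (\<integral>\<^sup>+P1. ?s p P1 * (\<integral>\<^sup>+P2. ?s p P2 * ennreal ((cross P P1 P2)\<^sup>2) \<partial>lborel) \<partial>lborel) * mean_gap (p $ 1) (p $ 2) (p $ 3) \<partial>lborel)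
       = Psi (p $ 1) (p $ 2) (p $ 3)"
      unfolding Psi_def section_moment_def by (rule nn_integral_multc) measurable
    ultimately show "(\<integral>\<^sup>+P. \<integral>\<^sup>+P1. \<integral>\<^sup>+P2. ?g P P1 P2 p \<partial>lborel \<partial>lborel \<partial>lborel) = Psi (p $ 1) (p $ 2) (p $ 3)"
      by (simp only:)
  qed
  also have "\<dots> = (\<integral>\<^sup>+a. \<integral>\<^sup>+b. \<integral>\<^sup>+c. Psi a b c \<partial>lborel \<partial>lborel \<partial>lborel)"
  proof -
    have "(\<lambda>p::real^3. Psi (p $ 1) (p $ 2) (p $ 3)) \<in> borel_measurable borel" by measurable
    from nn_integral_vector3[OF this] show ?thesis by simp
  qed
  finally show ?thesis .
qed

section \<open>Expected volume in an affine image of the prism\<close>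

text \<open>The hull is a translate of a linear image of the standard simplex, whose volume is
  \<open>1/3!\<close>. Degenerate hulls are included, with a singular matrix.\<close>

lemma content_convex_hull_4:
  fixes p0 p1 p2 p3 :: "real ^ 3"
  shows "measure lborel (convex hull {p0, p1, p2, p3}) = \<bar>det (vector [p1 - p0, p2 - p0, p3 - p0] :: real ^ 3 ^ 3)\<bar> / 6"
proof -
  \<comment> \<open>The transpose turns the edges into columns, that is, into the images of the unit
    vectors.\<close>
  define M :: "real ^ 3 ^ 3" where "M = transpose (vector [p1 - p0, p2 - p0, p3 - p0])"
  define g where "g = (\<lambda>x. M *v x)"
  have g_axis: "g (axis 1 1) = p1 - p0" "g (axis 2 1) = p2 - p0" "g (axis 3 1) = p3 - p0"
    by (simp_all add: g_def M_def matrix_vector_mult_basis column_def transpose_def vec_eq_iff)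
  define std where "std = (convex hull insert 0 Basis :: (real ^ 3) set)"
  have compact: "compact std" unfolding std_def
    by (intro finite_imp_compact_convex_hull) auto
  have "measure lebesgue (convex hull {p0, p1, p2, p3}) = measure lebesgue ((+) (- p0) ` (convex hull {p0, p1, p2, p3}))"
    by (rule measure_translation [symmetric])
  also have "(+) (- p0) ` (convex hull {p0, p1, p2, p3}) = convex hull ((+) (- p0) ` {p0, p1, p2, p3})"
    by (rule convex_hull_translation [symmetric])
  also have "(+) (- p0) ` {p0, p1, p2, p3} = {0, p1 - p0, p2 - p0, p3 - p0}"
    by simp
  finally have eq: "measure lebesgue (convex hull {p0, p1, p2, p3}) = measure lebesgue (convex hull {0, p1 - p0, p2 - p0, p3 - p0})" .
  from compact have "measure lebesgue (g ` std) = \<bar>det M\<bar> * measure lebesgue std"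
    by (subst measure_lebesgue_linear_transformation)
       (auto intro: finite_imp_bounded_convex_hull dest: compact_imp_closed simp: g_def std_def)
  also have "measure lebesgue std = measure lborel std" using compact
    by (intro measure_completion) (auto dest: compact_imp_closed)
  also have "\<dots> = 1 / 6" unfolding std_def
    by (simp add: content_std_simplex fact_numeral)
  also have "g ` std = convex hull (g ` insert 0 Basis)" unfolding std_def
    by (rule convex_hull_linear_image) (auto simp: g_def)
  also have "(Basis :: (real ^ 3) set) = {axis 1 1, axis 2 1, axis 3 1}"
    by (auto simp: Basis_vec_def UNIV_3)
  also have "g ` insert 0 {axis 1 1, axis 2 1, axis 3 1} = {0, p1 - p0, p2 - p0, p3 - p0}"
    by (simp add: g_axis) (simp add: g_def)
  finally have "measure lebesgue (convex hull {p0, p1, p2, p3}) = \<bar>det M\<bar> / 6"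
    using eq by simp
  moreover have "measure lebesgue (convex hull {p0, p1, p2, p3}) = measure lborel (convex hull {p0, p1, p2, p3})"
    using finite_imp_compact_convex_hull[of "{p0, p1, p2, p3}"]
    by (intro measure_completion) (auto dest: compact_imp_closed)
  ultimately show ?thesis by (simp add: M_def det_transpose)
qed

section \<open>Normal form of a triangular prism and its uniform points\<close>

definition std_prism :: "(real ^ 3) set" where
  "std_prism = {q. 0 \<le> q $ 1 \<and> 0 \<le> q $ 2 \<and> q $ 1 + q $ 2 \<le> 1 \<and> 0 \<le> q $ 3 \<and> q $ 3 \<le> 1}"

text \<open>The edges of the triangle at one vertex and the length of the segment are absorbed into
  the linear map, which leaves the standard triangle times the unit interval.\<close>

lemma triangular_prism_affine:
  assumes "triangular_prism K"
  obtains p and A :: "real ^ 3 ^ 3" where "det A \<noteq> 0" "K = (\<lambda>q. p + A *v q) ` std_prism"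
proof -
  obtain h :: "(real ^ 2) \<times> real \<Rightarrow> real ^ 3" and c T and a b :: real
    where h: "linear h" "inj h" and T: "2 simplex T" and ab: "a < b"
      and K: "K = (\<lambda>x. c + h x) ` (T \<times> {a..b})"
    using assms by (auto simp: triangular_prism_def)
  from T obtain C where C: "\<not> affine_dependent C" "card C = 3" "T = convex hull C"
    by (auto simp: simplex_def)
  obtain t0 t1 t2 where t: "C = {t0, t1, t2}" "t0 \<noteq> t1" "t0 \<noteq> t2" "t1 \<noteq> t2"
    using C(2) by (auto simp: card_3_iff)
  have indep: "u = 0 \<and> v = 0" if "u *\<^sub>R (t1 - t0) + v *\<^sub>R (t2 - t0) = 0" for u v
  proof (rule ccontr)
    assume uv: "\<not> (u = 0 \<and> v = 0)"
    have ne: "t1 - t0 \<noteq> t2 - t0" using t by simp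
    let ?r = "\<lambda>x. if x = t1 - t0 then u else v"
    have "dependent {t1 - t0, t2 - t0}"
      unfolding real_vector.dependent_finite[of "{t1 - t0, t2 - t0}", simplified]
      using that uv ne t by (intro exI[of _ ?r]) auto
    moreover have "(\<lambda>x. - t0 + x) ` {t1, t2} = {t1 - t0, t2 - t0}" by simp
    ultimately have "affine_dependent C"
      unfolding t(1) using affine_dependent_iff_dependent[of t0 "{t1, t2}"] t by simp
    with C(1) show False by simp
  qed
  define L where "L q = h (q $ 1 *\<^sub>R (t1 - t0) + q $ 2 *\<^sub>R (t2 - t0), q $ 3 * (b - a))" for q :: "real ^ 3"
  have "linear L"
  proof -
    have "linear (\<lambda>q :: real ^ 3. (q $ 1 *\<^sub>R (t1 - t0) + q $ 2 *\<^sub>R (t2 - t0), q $ 3 * (b - a)))"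
      by (rule linearI) (simp_all add: algebra_simps scaleR_add_left)
    from linear_compose[OF this h(1)] show ?thesis by (simp add: L_def[abs_def] o_def)
  qed
  then have mL: "matrix L *v q = L q" for q using matrix_vector_mul(2)[of L] by metis
  \<comment> \<open>The kernel is trivial: \<open>h\<close> is injective, the two edges are
    independent, and the segment has positive length.\<close>
  have "det (matrix L) \<noteq> 0"
  proof -
    have "q = 0" if "matrix L *v q = 0" for q
    proof -
      have "h (q $ 1 *\<^sub>R (t1 - t0) + q $ 2 *\<^sub>R (t2 - t0), q $ 3 * (b - a)) = h 0"
        using that h(1) by (simp add: mL L_def linear_0)
      then have "(q $ 1 *\<^sub>R (t1 - t0) + q $ 2 *\<^sub>R (t2 - t0), q $ 3 * (b - a)) = 0"
        using h(2) by (rule injD[rotated])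
      then show "q = 0"
        using indep[of "q $ 1" "q $ 2"] ab by (auto simp: zero_prod_def vec_eq_iff forall_3)
    qed
    then show ?thesis
      using matrix_left_invertible_ker[of "matrix L"] invertible_left_inverse invertible_det_nz by metis
  qed
  moreover have "K = (\<lambda>q. c + h (t0, a) + matrix L *v q) ` std_prism"
  proof -
    have hL: "c + h (t0, a) + L q = c + h (t0 + q $ 1 *\<^sub>R (t1 - t0) + q $ 2 *\<^sub>R (t2 - t0), a + q $ 3 * (b - a))" for q
      by (simp add: L_def linear_add[OF h(1), symmetric] add.assoc)
    have "x \<in> (\<lambda>q. (t0 + q $ 1 *\<^sub>R (t1 - t0) + q $ 2 *\<^sub>R (t2 - t0), a + q $ 3 * (b - a))) ` std_prism \<longleftrightarrow> x \<in> T \<times> {a..b}" for x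
    proof
      assume "x \<in> (\<lambda>q. (t0 + q $ 1 *\<^sub>R (t1 - t0) + q $ 2 *\<^sub>R (t2 - t0), a + q $ 3 * (b - a))) ` std_prism"
      then obtain q where q: "q \<in> std_prism" "x = (t0 + q $ 1 *\<^sub>R (t1 - t0) + q $ 2 *\<^sub>R (t2 - t0), a + q $ 3 * (b - a))" by blast
      have "0 \<le> q $ 3 * (b - a)" "q $ 3 * (b - a) \<le> 1 * (b - a)"
        using q(1) ab by (auto simp: std_prism_def intro!: mult_right_mono mult_nonneg_nonneg)
      then have "a + q $ 3 * (b - a) \<in> {a..b}" by simp
      moreover have "t0 + q $ 1 *\<^sub>R (t1 - t0) + q $ 2 *\<^sub>R (t2 - t0) \<in> T"
        using q(1) unfolding C(3) t(1) convex_hull_3_alt by (auto simp: std_prism_def)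
      ultimately show "x \<in> T \<times> {a..b}" by (simp add: q(2))
    next
      assume "x \<in> T \<times> {a..b}"
      then obtain u v s where x: "x = (t0 + u *\<^sub>R (t1 - t0) + v *\<^sub>R (t2 - t0), s)" "0 \<le> u" "0 \<le> v" "u + v \<le> 1" "a \<le> s" "s \<le> b"
        unfolding C(3) t(1) convex_hull_3_alt by auto
      have "(vector [u, v, (s - a) / (b - a)] :: real ^ 3) \<in> std_prism"
        using x ab by (simp add: std_prism_def field_simps)
      moreover have "x = (\<lambda>q. (t0 + q $ 1 *\<^sub>R (t1 - t0) + q $ 2 *\<^sub>R (t2 - t0), a + q $ 3 * (b - a))) (vector [u, v, (s - a) / (b - a)] :: real ^ 3)"
        using x ab by simp
      ultimately show "x \<in> (\<lambda>q. (t0 + q $ 1 *\<^sub>R (t1 - t0) + q $ 2 *\<^sub>R (t2 - t0), a + q $ 3 * (b - a))) ` std_prism"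
        by (rule rev_image_eqI)
    qed
    then have "T \<times> {a..b} = (\<lambda>q. (t0 + q $ 1 *\<^sub>R (t1 - t0) + q $ 2 *\<^sub>R (t2 - t0), a + q $ 3 * (b - a))) ` std_prism"
      by blast
    then show ?thesis unfolding K by (simp add: image_image mL hL)
  qed
  ultimately show thesis by (rule that)
qed

lemma measurable_vector_3 [measurable (raw)]:
  assumes [measurable]: "x \<in> borel_measurable M" "y \<in> borel_measurable M" "z \<in> borel_measurable M"
  shows "(\<lambda>w. vector [x w, y w, z w] :: real ^ 3) \<in> borel_measurable M"
proof -
  have "(\<lambda>w. vector [x w, y w, z w] :: real ^ 3) = (\<lambda>w. x w *\<^sub>R axis 1 1 + y w *\<^sub>R axis 2 1 + z w *\<^sub>R axis 3 1)"
    by (auto simp: fun_eq_iff vec_eq_iff forall_3 axis_def)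
  also have "\<dots> \<in> borel_measurable M" by measurable
  finally show ?thesis .
qed

lemma measurable_matrix_vector_mult [measurable (raw)]:
  fixes A :: "real ^ 3 ^ 3"
  assumes "f \<in> borel_measurable M"
  shows "(\<lambda>w. A *v f w) \<in> borel_measurable M"
proof -
  have "(\<lambda>q. A *v q) \<in> borel_measurable borel"
    by (intro borel_measurable_continuous_onI matrix_vector_mult_linear_continuous_on)
  with assms show ?thesis by (rule measurable_compose)
qed

lemma std_prism_borel [measurable]: "std_prism \<in> sets borel"
  unfolding std_prism_def by measurable

lemma indicator_std_prism:
  "indicator std_prism (vector [fst P, snd P, z] :: real ^ 3) = prism P z"
  by (auto simp: prism_def unit_tri_def std_prism_def split: split_indicator)

definition prism_integral :: "(real \<times> real \<Rightarrow> real \<Rightarrow> ennreal) \<Rightarrow> ennreal" where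
  "prism_integral f = (\<integral>\<^sup>+P. \<integral>\<^sup>+z. prism P z * f P z \<partial>lborel \<partial>lborel)"

lemma prism_integral_cmult:
  assumes "(\<lambda>Q. f (fst Q) (snd Q)) \<in> borel_measurable borel"
  shows "prism_integral (\<lambda>P z. c * f P z) = c * prism_integral f"
proof -
  have m: "(\<lambda>Q. f (fst Q) (snd Q)) \<in> borel_measurable (borel \<Otimes>\<^sub>M borel)"
    using assms by (simp only: borel_prod)
  have m1: "(\<lambda>z. f P z) \<in> borel_measurable borel" for P
    using measurable_compose[OF measurable_Pair1' m, of P] by simp
  have m2: "(\<lambda>P. \<integral>\<^sup>+z. prism P z * f P z \<partial>lborel) \<in> borel_measurable lborel"
  proof -
    have "(\<lambda>(P, z). prism P z * f P z) \<in> borel_measurable (lborel \<Otimes>\<^sub>M lborel)"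
      using m by (simp add: case_prod_beta) measurable
    then show ?thesis by measurable
  qed
  have "prism_integral (\<lambda>P z. c * f P z) = (\<integral>\<^sup>+P. \<integral>\<^sup>+z. c * (prism P z * f P z) \<partial>lborel \<partial>lborel)"
    by (simp add: prism_integral_def mult_ac)
  also have "\<dots> = (\<integral>\<^sup>+P. c * (\<integral>\<^sup>+z. prism P z * f P z \<partial>lborel) \<partial>lborel)"
    using m1 by (intro nn_integral_cong nn_integral_cmult) measurable
  also have "\<dots> = c * prism_integral f"
    unfolding prism_integral_def using m2 by (rule nn_integral_cmult)
  finally show ?thesis .
qed

lemma prism_integral_1: "prism_integral (\<lambda>_ _. 1) = ennreal (1 / 2)"
proof -
  have "prism_integral (\<lambda>_ _. 1) = (\<integral>\<^sup>+P. indicator unit_tri P * ennreal 1 \<partial>lborel)"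
    unfolding prism_integral_def by (simp add: prism_def nn_integral_cmult)
  also have "\<dots> = ennreal (1 / 2)"
    by (rule has_moments_nn_integral[OF has_moments_unit_tri, where a = 1 and b = 0 and c = 0 and e = 0 and f = 0 and g = 0]) auto
  finally show ?thesis .
qed

context
  fixes K :: "(real ^ 3) set" and p :: "real ^ 3" and A :: "real ^ 3 ^ 3"
  assumes det: "det A \<noteq> 0" and K: "K = (\<lambda>q. p + A *v q) ` std_prism"
begin

lemma prism_image_borel [measurable]: "K \<in> sets borel"
proof -
  obtain B where inv: "B ** A = mat 1" "A ** B = mat 1"
    using det invertible_det_nz[of A] by (auto simp: invertible_def)
  have "K = (\<lambda>x. B *v (x - p)) -` std_prism"
  proof (intro set_eqI iffI)
    fix x assume "x \<in> (\<lambda>x. B *v (x - p)) -` std_prism"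
    then have "x = p + A *v (B *v (x - p))" "B *v (x - p) \<in> std_prism"
      by (simp_all add: matrix_vector_mul_assoc inv)
    then show "x \<in> K" unfolding K by blast
  qed (auto simp: K matrix_vector_mul_assoc inv)
  moreover have "(\<lambda>x. B *v (x - p)) \<in> borel_measurable borel" by measurable
  ultimately show ?thesis
    using measurable_sets[of "\<lambda>x. B *v (x - p)" borel borel std_prism] by simp
qed

lemma nn_integral_prism_image:
  assumes [measurable]: "f \<in> borel_measurable borel"
  shows "(\<integral>\<^sup>+x. f x * indicator K x \<partial>lborel) = ennreal \<bar>det A\<bar> * prism_integral (\<lambda>P z. f (p + A *v vector [fst P, snd P, z]))"
proof -
  have inj: "inj ((*v) A)"
    using det inj_matrix_vector_mult invertible_det_nz by blast
  have ind: "(indicator K (p + A *v q) :: ennreal) = indicator std_prism q" for q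
    using injD[OF inj] by (auto simp: K split: split_indicator) blast
  have "(\<integral>\<^sup>+x. f x * indicator K x \<partial>lborel) = ennreal \<bar>det A\<bar> * (\<integral>\<^sup>+q. f (p + A *v q) * indicator K (p + A *v q) \<partial>lborel)"
    by (rule nn_integral_linear_cart[OF _ det]) measurable
  also have "(\<integral>\<^sup>+q. f (p + A *v q) * indicator K (p + A *v q) \<partial>lborel) = (\<integral>\<^sup>+q. f (p + A *v q) * indicator std_prism q \<partial>lborel)"
    by (simp only: ind)
  also have "\<dots> = (\<integral>\<^sup>+x. \<integral>\<^sup>+y. \<integral>\<^sup>+z. f (p + A *v vector [x, y, z]) * indicator std_prism (vector [x, y, z] :: real ^ 3) \<partial>lborel \<partial>lborel \<partial>lborel)"
    by (rule nn_integral_vector3) measurable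
  also have "\<dots> = (\<integral>\<^sup>+x. \<integral>\<^sup>+y. (\<lambda>P. \<integral>\<^sup>+z. prism P z * f (p + A *v vector [fst P, snd P, z]) \<partial>lborel) (x, y) \<partial>lborel \<partial>lborel)"
    by (simp add: indicator_std_prism[symmetric] mult.commute)
  also have "\<dots> = prism_integral (\<lambda>P z. f (p + A *v vector [fst P, snd P, z]))"
    unfolding prism_integral_def by (rule nn_integral_lborel_pair[symmetric]) measurable
  finally show ?thesis .
qed

lemma emeasure_prism_image: "emeasure lborel K = ennreal (\<bar>det A\<bar> / 2)"
  using nn_integral_prism_image[of "\<lambda>_. 1"] by (simp add: prism_integral_1 ennreal_mult[symmetric] del: ennreal_half)

text \<open>The determinant cancels against the volume of \<open>K\<close>. The 2 that remains is
  the reciprocal of the volume of the standard prism.\<close>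

lemma nn_integral_uniform_prism:
  assumes [measurable]: "f \<in> borel_measurable borel"
  shows "(\<integral>\<^sup>+x. f x \<partial>uniform_measure lborel K) = 2 * prism_integral (\<lambda>P z. f (p + A *v vector [fst P, snd P, z]))"
proof -
  let ?J = "prism_integral (\<lambda>P z. f (p + A *v vector [fst P, snd P, z]))"
  have "(\<integral>\<^sup>+x. f x \<partial>uniform_measure lborel K) = ennreal \<bar>det A\<bar> * ?J / ennreal (\<bar>det A\<bar> / 2)"
    by (subst nn_integral_uniform_measure) (simp_all add: nn_integral_prism_image emeasure_prism_image)
  also have "\<dots> = ?J * (ennreal \<bar>det A\<bar> / ennreal (\<bar>det A\<bar> / 2))"
    by (subst ennreal_times_divide) (simp only: mult.commute)
  also have "ennreal \<bar>det A\<bar> / ennreal (\<bar>det A\<bar> / 2) = 2"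
    using det by (subst divide_ennreal) auto
  finally show ?thesis by (simp add: mult.commute)
qed

end

lemma det_vector_matrix_mult:
  fixes A :: "real ^ 3 ^ 3"
  shows "det (vector [A *v x, A *v y, A *v z] :: real ^ 3 ^ 3) = det A * det (vector [x, y, z] :: real ^ 3 ^ 3)"
proof -
  have "(vector [A *v x, A *v y, A *v z] :: real ^ 3 ^ 3) = vector [x, y, z] ** transpose A"
    by (simp add: vec_eq_iff forall_3 matrix_matrix_mult_def matrix_vector_mult_def transpose_def mult.commute)
  then show ?thesis by (simp add: det_mul det_transpose)
qed

lemma det_vector_Det4:
  "det (vector [vector [fst P1, snd P1, z1] - vector [fst P, snd P, z], vector [fst P2, snd P2, z2] - vector [fst P, snd P, z],
     vector [fst P3, snd P3, z3] - vector [fst P, snd P, z]] :: real ^ 3 ^ 3) = Det4 P z P1 z1 P2 z2 P3 z3"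
  by (simp add: det_3 Det4_def cross_def algebra_simps)

text \<open>The coordinates are peeled off the index set in the order 0, 1, 2, 3, so each lemma
  inside fixes the points already extracted.\<close>

lemma nn_integral_PiM_4:
  fixes M :: "'a::second_countable_topology measure" and f :: "'a \<times> 'a \<times> 'a \<times> 'a \<Rightarrow> ennreal"
  assumes "sigma_finite_measure M" and [measurable_cong]: "sets M = sets borel" and [measurable]: "f \<in> borel_measurable borel"
  shows "(\<integral>\<^sup>+X. f (X 0, X 1, X 2, X 3) \<partial>(\<Pi>\<^sub>M i\<in>{0..3::nat}. M))
    = (\<integral>\<^sup>+x0. \<integral>\<^sup>+x1. \<integral>\<^sup>+x2. \<integral>\<^sup>+x3. f (x0, x1, x2, x3) \<partial>M \<partial>M \<partial>M \<partial>M)"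
proof -
  interpret product_sigma_finite "\<lambda>_::nat. M" using assms(1) by (simp add: product_sigma_finite_def)
  have I: "{0..3::nat} = {0, 1, 2, 3}" by auto
  have 3: "(\<integral>\<^sup>+X. f (x0, x1, x2, X 3) \<partial>(Pi\<^sub>M {3::nat} (\<lambda>_. M))) = (\<integral>\<^sup>+x3. f (x0, x1, x2, x3) \<partial>M)" for x0 x1 x2
    by (rule product_nn_integral_singleton) measurable
  have 2: "(\<integral>\<^sup>+X. f (x0, x1, X 2, X 3) \<partial>(\<Pi>\<^sub>M i\<in>{2, 3::nat}. M)) = (\<integral>\<^sup>+x2. \<integral>\<^sup>+x3. f (x0, x1, x2, x3) \<partial>M \<partial>M)" for x0 x1
    by (subst product_nn_integral_insert_rev) (simp_all add: 3)
  have 1: "(\<integral>\<^sup>+X. f (x0, X 1, X 2, X 3) \<partial>(\<Pi>\<^sub>M i\<in>{1, 2, 3::nat}. M)) = (\<integral>\<^sup>+x1. \<integral>\<^sup>+x2. \<integral>\<^sup>+x3. f (x0, x1, x2, x3) \<partial>M \<partial>M \<partial>M)" for x0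
    by (subst product_nn_integral_insert_rev) (simp_all add: 2)
  show ?thesis unfolding I
    by (subst product_nn_integral_insert_rev) (simp_all add: 1[simplified])
qed

definition simplex_volume :: "(real ^ 3) \<times> (real ^ 3) \<times> (real ^ 3) \<times> (real ^ 3) \<Rightarrow> real" where
  "simplex_volume = (\<lambda>(p0, p1, p2, p3). \<bar>det (vector [p1 - p0, p2 - p0, p3 - p0] :: real ^ 3 ^ 3)\<bar> / 6)"

lemma measurable_simplex_volume [measurable]: "simplex_volume \<in> borel_measurable borel"
  unfolding simplex_volume_def case_prod_beta det_3 vector_3 vector_minus_component by measurable

lemma simplex_volume_affine:
  "simplex_volume (p + A *v vector [fst P, snd P, z], p + A *v vector [fst P1, snd P1, z1], p + A *v vector [fst P2, snd P2, z2], p + A *v vector [fst P3, snd P3, z3])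
    = \<bar>det A\<bar> / 6 * \<bar>Det4 P z P1 z1 P2 z2 P3 z3\<bar>"
  by (simp add: simplex_volume_def matrix_vector_mult_diff_distrib[symmetric] det_vector_matrix_mult det_vector_Det4 abs_mult)

theorem mainTheorem13:
  fixes K :: "(real ^ 3) set"
  assumes "triangular_prism K"
  shows "v31 K = 1859 / 116640 - pi\<^sup>2 / 17010"
proof -
  obtain p A where det: "det A \<noteq> 0" and K: "K = (\<lambda>q. p + A *v q) ` std_prism"
    using triangular_prism_affine[OF assms] .
  let ?U = "uniform_measure lborel K" and ?d = "\<bar>det A\<bar>"
  \<comment> \<open>The integral over normalised planes from \<open>nn_integral_dens\<close>; the
    six orderings of the heights turn it into \<open>6 * V\<close>.\<close>
  define V where "V = 2 * (721 / 165888000 + 41767 / 580608000) + 7 / 165888 + 6 / 52254720 * (1584871/600 - 16 * pi\<^sup>2)"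
  have d: "0 < ?d" using det by simp
  have K_borel: "K \<in> sets borel" by (rule prism_image_borel[OF det K])
  have eK: "emeasure lborel K = ennreal (?d / 2)" by (rule emeasure_prism_image[OF det K])
  have mK: "measure lborel K = ?d / 2" using eK d by (simp add: measure_def)
  have "prob_space ?U"
    using eK d by (intro prob_space_uniform_measure) simp_all
  then have sf: "sigma_finite_measure ?U"
    by (simp add: prob_space_def finite_measure_def)
  define c where "c = ennreal (?d / 6)"
  have inner: "prism_integral (\<lambda>P3 z3. ennreal (simplex_volume (p + A *v vector [fst P, snd P, z], p + A *v vector [fst P1, snd P1, z1], p + A *v vector [fst P2, snd P2, z2], p + A *v vector [fst P3, snd P3, z3])))
      = c * gap_integral P z P1 z1 P2 z2" for P z P1 z1 P2 z2
  proof -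
    have "prism_integral (\<lambda>P3 z3. ennreal (simplex_volume (p + A *v vector [fst P, snd P, z], p + A *v vector [fst P1, snd P1, z1], p + A *v vector [fst P2, snd P2, z2], p + A *v vector [fst P3, snd P3, z3])))
      = prism_integral (\<lambda>P3 z3. c * ennreal \<bar>Det4 P z P1 z1 P2 z2 P3 z3\<bar>)"
      unfolding simplex_volume_affine c_def by (subst ennreal_mult) auto
    also have "\<dots> = c * prism_integral (\<lambda>P3 z3. ennreal \<bar>Det4 P z P1 z1 P2 z2 P3 z3\<bar>)"
      by (rule prism_integral_cmult) measurable
    finally show ?thesis by (simp add: prism_integral_def gap_integral_def)
  qed
  let ?J = "prism_integral"
  let ?g = "\<lambda>w. ennreal (simplex_volume w)"
  have "(\<integral>\<^sup>+x0. \<integral>\<^sup>+x1. \<integral>\<^sup>+x2. \<integral>\<^sup>+x3. ?g (x0, x1, x2, x3) \<partial>?U \<partial>?U \<partial>?U \<partial>?U)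
    = (\<integral>\<^sup>+x0. \<integral>\<^sup>+x1. \<integral>\<^sup>+x2. 2 * ?J (\<lambda>P3 z3. ?g (x0, x1, x2, p + A *v vector [fst P3, snd P3, z3])) \<partial>?U \<partial>?U \<partial>?U)"
    by (rule nn_integral_cong, rule nn_integral_cong, rule nn_integral_cong, rule nn_integral_uniform_prism[OF det K]) measurable
  also have "\<dots> = (\<integral>\<^sup>+x0. \<integral>\<^sup>+x1. 2 * ?J (\<lambda>P2 z2. 2 * ?J (\<lambda>P3 z3. ?g (x0, x1, p + A *v vector [fst P2, snd P2, z2], p + A *v vector [fst P3, snd P3, z3]))) \<partial>?U \<partial>?U)"
    by (rule nn_integral_cong, rule nn_integral_cong, rule nn_integral_uniform_prism[OF det K]) (unfold prism_integral_def, measurable)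
  also have "\<dots> = (\<integral>\<^sup>+x0. 2 * ?J (\<lambda>P1 z1. 2 * ?J (\<lambda>P2 z2. 2 * ?J (\<lambda>P3 z3. ?g (x0, p + A *v vector [fst P1, snd P1, z1], p + A *v vector [fst P2, snd P2, z2], p + A *v vector [fst P3, snd P3, z3])))) \<partial>?U)"
    by (rule nn_integral_cong, rule nn_integral_uniform_prism[OF det K]) (unfold prism_integral_def, measurable)
  also have "\<dots> = 2 * ?J (\<lambda>P z. 2 * ?J (\<lambda>P1 z1. 2 * ?J (\<lambda>P2 z2. 2 * ?J (\<lambda>P3 z3. ?g (p + A *v vector [fst P, snd P, z], p + A *v vector [fst P1, snd P1, z1], p + A *v vector [fst P2, snd P2, z2], p + A *v vector [fst P3, snd P3, z3])))))"
    by (rule nn_integral_uniform_prism[OF det K]) (unfold prism_integral_def, measurable)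
  also have "\<dots> = 2 * ?J (\<lambda>P z. 2 * ?J (\<lambda>P1 z1. 2 * ?J (\<lambda>P2 z2. 2 * c * gap_integral P z P1 z1 P2 z2)))"
    by (simp only: inner mult.assoc)
  also have "(\<lambda>P z. 2 * ?J (\<lambda>P1 z1. 2 * ?J (\<lambda>P2 z2. 2 * c * gap_integral P z P1 z1 P2 z2)))
      = (\<lambda>P z. 2 * ?J (\<lambda>P1 z1. 2 * (2 * c) * ?J (\<lambda>P2 z2. gap_integral P z P1 z1 P2 z2)))"
    by (intro ext, subst prism_integral_cmult) (measurable, simp add: mult.assoc)
  also have "\<dots> = (\<lambda>P z. 2 * (2 * (2 * c)) * ?J (\<lambda>P1 z1. ?J (\<lambda>P2 z2. gap_integral P z P1 z1 P2 z2)))"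
    by (intro ext, subst prism_integral_cmult) (unfold prism_integral_def, measurable, simp add: mult.assoc)
  also have "2 * ?J \<dots> = 2 * (2 * (2 * (2 * c)) * ?J (\<lambda>P z. ?J (\<lambda>P1 z1. ?J (\<lambda>P2 z2. gap_integral P z P1 z1 P2 z2))))"
    by (subst prism_integral_cmult) (unfold prism_integral_def, measurable)
  also have "?J (\<lambda>P z. ?J (\<lambda>P1 z1. ?J (\<lambda>P2 z2. gap_integral P z P1 z1 P2 z2))) = ennreal (6 * V)"
  proof -
    have "?J (\<lambda>P z. ?J (\<lambda>P1 z1. ?J (\<lambda>P2 z2. gap_integral P z P1 z1 P2 z2)))
      = (\<integral>\<^sup>+P. \<integral>\<^sup>+z. \<integral>\<^sup>+P1. \<integral>\<^sup>+z1. \<integral>\<^sup>+P2. \<integral>\<^sup>+z2. prism P z * (prism P1 z1 * (prism P2 z2 * gap_integral P z P1 z1 P2 z2)) \<partial>lborel \<partial>lborel \<partial>lborel \<partial>lborel \<partial>lborel \<partial>lborel)"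
      unfolding prism_integral_def by (simp add: nn_integral_cmult)
    then show ?thesis by (simp only: nn_integral_Det4 nn_integral_Psi V_def)
  qed
  \<comment> \<open>The four factors 2 normalise the four uniform points, and the 6 of
    \<open>6 * V\<close> cancels the 1/6 that the tetrahedron puts into \<open>c\<close>.\<close>
  also have "2 * (2 * (2 * (2 * c)) * ennreal (6 * V)) = ennreal (16 * ?d * V)"
  proof -
    have "2 * (2 * (2 * (2 * c)) * ennreal (6 * V)) = ennreal (16 * (?d / 6)) * ennreal (6 * V)"
      unfolding c_def by (subst ennreal_mult) (auto simp: mult.assoc[symmetric])
    also have "\<dots> = ennreal (16 * (?d / 6) * (6 * V))"
      by (subst ennreal_mult') simp_all
    also have "16 * (?d / 6) * (6 * V) = 16 * ?d * V" by simp
    finally show ?thesis .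
  qed
  finally have total: "(\<integral>\<^sup>+x0. \<integral>\<^sup>+x1. \<integral>\<^sup>+x2. \<integral>\<^sup>+x3. ?g (x0, x1, x2, x3) \<partial>?U \<partial>?U \<partial>?U \<partial>?U) = ennreal (16 * ?d * V)" .
  have V_nonneg: "0 \<le> V"
  proof -
    have "pi \<le> 4" by (rule pi_less_4[THEN less_imp_le])
    then have "pi\<^sup>2 \<le> 4\<^sup>2" by (intro power_mono) auto
    then show ?thesis by (simp add: V_def)
  qed
  \<comment> \<open>The determinant formula also makes the volume a visibly measurable function of
    the four points.\<close>
  have "(\<integral>X. measure lborel (convex hull {X 0, X 1, X 2, X 3}) \<partial>(\<Pi>\<^sub>M i\<in>{0..3::nat}. ?U))
    = (\<integral>X. simplex_volume (X 0, X 1, X 2, X 3) \<partial>(\<Pi>\<^sub>M i\<in>{0..3::nat}. ?U))"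
    by (simp add: content_convex_hull_4 simplex_volume_def)
  also have "\<dots> = enn2real (\<integral>\<^sup>+X. ?g (X 0, X 1, X 2, X 3) \<partial>(\<Pi>\<^sub>M i\<in>{0..3::nat}. ?U))"
  proof (rule integral_eq_nn_integral)
    have [measurable_cong]: "sets ?U = sets borel" by simp
    show "(\<lambda>X. simplex_volume (X 0, X 1, X 2, X 3)) \<in> borel_measurable (\<Pi>\<^sub>M i\<in>{0..3::nat}. ?U)" by measurable
    show "AE X in \<Pi>\<^sub>M i\<in>{0..3::nat}. ?U. 0 \<le> simplex_volume (X 0, X 1, X 2, X 3)" by (simp add: simplex_volume_def)
  qed
  also have "(\<integral>\<^sup>+X. ?g (X 0, X 1, X 2, X 3) \<partial>(\<Pi>\<^sub>M i\<in>{0..3::nat}. ?U)) = ennreal (16 * ?d * V)"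
    by (subst nn_integral_PiM_4[OF sf]) (simp_all add: total)
  finally have "v31 K = 16 * ?d * V / (?d / 2)"
    using V_nonneg by (simp add: v31_def mK)
  \<comment> \<open>The determinant drops out, as affine invariance demands; the last factor 2 comes
    from dividing by the volume of \<open>K\<close>.\<close>
  also have "\<dots> = 32 * V" using d by simp
  also have "\<dots> = 1859 / 116640 - pi\<^sup>2 / 17010" by (simp add: V_def algebra_simps)
  finally show ?thesis .
qed

end
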